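(* Let $M$ be an oriented matroid on a linearly ordered set $E=\{e_1<\dots<e_n\}$ and let $B$ be a basis of $M$. Consider the following procedure, which computes step by step a mapping $\mathrm{Part}:E\to\mathrm{Int}(B)\cup\mathrm{Ext}(B)$, a label "internal" or "external" for each element, and a reorientation of $M$ (signs below are those in the current reorientation of $M$). For $k$ from $1$ to $n$ do: (I) If $e_k\in B$ and $e_k\in\mathrm{Int}(B)$: $e_k$ is internal, $\mathrm{Part}(e_k):=e_k$, and reorient $e_k$ or not, arbitrarily. (II) If $e_k\in B$ and $e_k\notin\mathrm{Int}(B)$: if there exists an external $c<e_k$ in $C^*(B;e_k)$, then $e_k$ is external and $\mathrm{Part}(e_k):=\mathrm{Part}(c)$ where $c\in C^*(B;e_k)$, $c<e_k$, $c$ is external and $\mathrm{Part}(c)$ is the greatest possible; otherwise $e_k$ is internal and $\mathrm{Part}(e_k):=\mathrm{Part}(c)$ where $c\in C^*(B;e_k)$, $c<e_k$ and $\mathrm{Part}(c)$ is the smallest possible. Then let $a$ be the smallest element of $C^*(B;e_k)$ with $\mathrm{Part}(a)=\mathrm{Part}(e_k)$, and reorient $e_k$ if necessary so that $e_k$ and $a$ have opposite signs in $C^*(B;e_k)$. (III) If $e_k\notin B$ and $e_k\in\mathrm{Ext}(B)$: $e_k$ is external, $\mathrm{Part}(e_k):=e_k$, and reorient $e_k$ or not, arbitrarily. (IV) If $e_k\notin B$ and $e_k\notin\mathrm{Ext}(B)$: if there exists an internal $c<e_k$ in $C(B;e_k)$, then $e_k$ is internal and $\mathrm{Part}(e_k):=\mathrm{Part}(c)$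 where $c\in C(B;e_k)$, $c<e_k$, $c$ is internal and $\mathrm{Part}(c)$ is the greatest possible; otherwise $e_k$ is external and $\mathrm{Part}(e_k):=\mathrm{Part}(c)$ where $c\in C(B;e_k)$, $c<e_k$ and $\mathrm{Part}(c)$ is the smallest possible. Then let $a$ be the smallest element of $C(B;e_k)$ with $\mathrm{Part}(a)=\mathrm{Part}(e_k)$, and reorient $e_k$ if necessary so that $e_k$ and $a$ have opposite signs in $C(B;e_k)$. Then $\mathrm{Part}$ maps each element onto the smallest element of its part in the active partition of $B$, an element being internal (resp. external) when its image is in $\mathrm{Int}(B)$ (resp. $\mathrm{Ext}(B)$). Moreover the set $\alpha^{-1}(B)$ of the $2^{|\mathrm{Int}(B)|+|\mathrm{Ext}(B)|}$ subsets $A\subseteq E$ with $\alpha(-_AM)=B$ is exactly the set of subsets of reoriented elements obtained by making all possible arbitrary choices in (I) and (III). Equivalently, these preimages can be retrieved from one another: for $A\in\alpha^{-1}(B)$, $$\alpha^{-1}(B)=\{A\,\triangle\,\mathrm{Part}^{-1}(P\cup Q)\ :\ P\subseteq\mathrm{Int}(B),\ Q\subseteq\mathrm{Ext}(B)\}.$$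
   Context: General conventions. $\subset$ is strict inclusion. $M(F)$ is the restriction to $F$, $M/F$ the contraction of $F$, $M^*$ the dual; all inherit the order of $E$. For $A\subseteq E$, $-_AM$ is the oriented matroid obtained by reorienting $A$. Signed circuits and cocircuits come in opposite pairs; one is positive if all its signs are positive. An oriented matroid is bounded w.r.t. $p$ if it has no positive circuit and every positive cocircuit contains $p$; dual-bounded w.r.t. $p$ if it has no positive cocircuit and every positive circuit contains $p$. Basis activities. For a basis $B$, $C^*(B;b)$ ($b\in B$) is the fundamental cocircuit, contained in $(E\setminus B)\cup\{b\}$, and $C(B;e)$ ($e\notin B$) the fundamental circuit, contained in $B\cup\{e\}$. $\mathrm{Int}(B)=\{b\in B: b=\min C^*(B;b)\}$, $\mathrm{Ext}(B)=\{e\in E\setminus B: e=\min C(B;e)\}$. $B$ is uniactive internal if $|\mathrm{Int}(B)|=1$, $\mathrm{Ext}(B)=\emptyset$, and uniactive external if $\mathrm{Int}(B)=\emptyset$, $|\mathrm{Ext}(B)|=1$. Active partition of a basis. A connected filtration of $M$ is a sequence $\emptyset=F'_\varepsilon\subset\cdots\subset F'_0=F_c=F_0\subset\cdots\subset F_\iota=E$ ($\iota,\varepsilon\ge0$) such that $\min(F_k\setminus F_{k-1})$ and $\min(F'_{k-1}\setminus F'_k)$ are increasing with $k$, each matroid $M(F_k)/F_{k-1}$ is connected and not a single loop, each $M(F'_{k-1})/F'_k$ is connected and not a single isthmus. It is known that for every basis $B$ there is a unique connected filtration, called the active filtration of $B$, such that $B\cap(F_k\setminus F_{k-1})$ is a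 uniactive internal basis of $M(F_k)/F_{k-1}$ for $1\le k\le\iota$ and $B\cap(F'_{k-1}\setminus F'_k)$ is a uniactive external basis of $M(F'_{k-1})/F'_k$ for $1\le k\le\varepsilon$. The active partition of $B$ is the partition of $E$ into the differences $F_k\setminus F_{k-1}$ and $F'_{k-1}\setminus F'_k$. Active filtration of an ordered oriented matroid $N$ on $E$. Let $a_1<\dots<a_\iota$ be the smallest elements of positive cocircuits of $N$ and $a'_1<\dots<a'_\varepsilon$ the smallest elements of positive circuits. It is $\emptyset=F'_\varepsilon\subset\cdots\subset F'_0=F_c=F_0\subset\cdots\subset F_\iota=E$ where $F_c$ is the union of all positive circuits; $F'_k$ is the union of all positive circuits $C$ with $\min C\ge a'_{k+1}$ ($0\le k\le\varepsilon-1$); $F_k$ is the complement of the union of all positive cocircuits $D$ with $\min D\ge a_{k+1}$ ($0\le k\le\iota-1$). Active basis $\alpha(N)$. Fundamental cocircuits/circuits are signed with $b$, resp. $e$, positive. If $N$ is bounded w.r.t. $p=\min(E)$, $\alpha(N)$ is the unique (it is known that exactly one exists) basis $B$ such that for all $b\in B\setminus\{p\}$ the signs of $b$ and $\min C^*(B;b)$ are opposite in $C^*(B;b)$, and for all $e\in E\setminus B$ the signs of $e$ and $\min C(B;e)$ are opposite in $C(B;e)$. If $N$ is dual-bounded w.r.t. $p$, $\alpha(N)=E\setminus\alpha(N^* )$. In general, with the active filtration of $N$, $\alpha(N)=\biguplus_{1\le k\le\iota}\alpha(N(F_k)/F_{k-1})\uplus\biguplus_{1\le k\le\varepsilon}\alpha(N(F'_{k-1})/F'_k)$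 (these minors being respectively bounded and dual-bounded w.r.t. their smallest elements). *)

theory Defs
  imports Main
begin

section \<open>Oriented matroids\<close>

text \<open>A signed set is a function with values in \<open>{-1, 0, 1}\<close>: the sign of each element,
  and \<open>0\<close> off the set.\<close>

type_synonym 'a signed_set = "'a \<Rightarrow> int"

definition supp :: "'a signed_set \<Rightarrow> 'a set" where
  "supp X = {e. X e \<noteq> 0}"

definition positive :: "'a signed_set \<Rightarrow> bool" where
  "positive X \<longleftrightarrow> (\<forall>e\<in>supp X. X e = 1)"

definition orthogonal :: "'a signed_set \<Rightarrow> 'a signed_set \<Rightarrow> bool" where
  "orthogonal X Y \<longleftrightarrow>
     (\<forall>e. X e * Y e = 0) \<or> (\<exists>e f. X e * Y e > 0 \<and> X f * Y f < 0)"

record 'a om =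
  ground :: "'a set"
  circuits :: "'a signed_set set"

text \<open>The signed circuit axioms; the last one is weak elimination.\<close>

locale oriented_matroid =
  fixes M :: "'a om"
  assumes finite_ground: "finite (ground M)"
    and signs: "X \<in> circuits M \<Longrightarrow> X e \<in> {-1, 0, 1}"
    and supp_subset: "X \<in> circuits M \<Longrightarrow> supp X \<subseteq> ground M"
    and supp_nonempty: "X \<in> circuits M \<Longrightarrow> supp X \<noteq> {}"
    and symmetric: "X \<in> circuits M \<Longrightarrow> - X \<in> circuits M"
    and incomparable:
      "X \<in> circuits M \<Longrightarrow> Y \<in> circuits M \<Longrightarrow> supp X \<subseteq> supp Y \<Longrightarrow> X = Y \<or> X = - Y"
    and elimination:
      "X \<in> circuits M \<Longrightarrow> Y \<in> circuits M \<Longrightarrow> X \<noteq> - Y \<Longrightarrow> X e = 1 \<Longrightarrow> Y e = -1 \<Longrightarrow>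
       \<exists>Z\<in>circuits M. Z e = 0 \<and>
         (\<forall>f. Z f = 1 \<longrightarrow> X f = 1 \<or> Y f = 1) \<and> (\<forall>f. Z f = -1 \<longrightarrow> X f = -1 \<or> Y f = -1)"

definition independent :: "'a om \<Rightarrow> 'a set \<Rightarrow> bool" where
  "independent M I \<longleftrightarrow> I \<subseteq> ground M \<and> (\<forall>X\<in>circuits M. \<not> supp X \<subseteq> I)"

definition basis :: "'a om \<Rightarrow> 'a set \<Rightarrow> bool" where
  "basis M B \<longleftrightarrow> independent M B \<and> (\<forall>I. independent M I \<and> B \<subseteq> I \<longrightarrow> I = B)"

text \<open>The cocircuits of the underlying matroid are the minimal sets meeting every basis. The
  signed cocircuits are the signed sets on them that are orthogonal to all signed circuits
  (for an oriented matroid there are exactly two, opposite, on each cocircuit).\<close>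

definition meets_bases :: "'a om \<Rightarrow> 'a set \<Rightarrow> bool" where
  "meets_bases M D \<longleftrightarrow> D \<subseteq> ground M \<and> (\<forall>B. basis M B \<longrightarrow> D \<inter> B \<noteq> {})"

definition cocircuits :: "'a om \<Rightarrow> 'a signed_set set" where
  "cocircuits M =
     {Y. (\<forall>e. Y e \<in> {-1, 0, 1}) \<and>
         meets_bases M (supp Y) \<and> (\<forall>D. meets_bases M D \<and> D \<subseteq> supp Y \<longrightarrow> D = supp Y) \<and>
         (\<forall>X\<in>circuits M. orthogonal X Y)}"

definition dual :: "'a om \<Rightarrow> 'a om" where
  "dual M = \<lparr>ground = ground M, circuits = cocircuits M\<rparr>"

definition restriction :: "'a om \<Rightarrow> 'a set \<Rightarrow> 'a om" where
  "restriction M F = \<lparr>ground = F, circuits = {X \<in> circuits M. supp X \<subseteq> F}\<rparr>"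

definition delete_signs :: "'a set \<Rightarrow> 'a signed_set \<Rightarrow> 'a signed_set" where
  "delete_signs F X = (\<lambda>e. if e \<in> F then 0 else X e)"

text \<open>The circuits of a contraction are the traces, of minimal nonempty support, of the circuits.\<close>

definition contraction :: "'a om \<Rightarrow> 'a set \<Rightarrow> 'a om" where
  "contraction M F =
     (let T = {X \<in> delete_signs F ` circuits M. supp X \<noteq> {}}
      in \<lparr>ground = ground M - F,
          circuits = {X \<in> T. \<forall>Y\<in>T. supp Y \<subseteq> supp X \<longrightarrow> supp Y = supp X}\<rparr>)"

text \<open>\<open>minor M F G\<close> is $M(F)/G$.\<close>

definition minor :: "'a om \<Rightarrow> 'a set \<Rightarrow> 'a set \<Rightarrow> 'a om" where
  "minor M F G = contraction (restriction M F) G"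

definition reorientation :: "'a set \<Rightarrow> 'a om \<Rightarrow> 'a om" where
  "reorientation A M =
     \<lparr>ground = ground M, circuits = (\<lambda>X e. if e \<in> A then - X e else X e) ` circuits M\<rparr>"

definition connected_om :: "'a om \<Rightarrow> bool" where
  "connected_om M \<longleftrightarrow>
     (\<forall>e\<in>ground M. \<forall>f\<in>ground M. e \<noteq> f \<longrightarrow> (\<exists>X\<in>circuits M. e \<in> supp X \<and> f \<in> supp X))"

definition single_loop :: "'a om \<Rightarrow> bool" where
  "single_loop M \<longleftrightarrow> (\<exists>e. ground M = {e} \<and> {e} \<in> supp ` circuits M)"

definition single_isthmus :: "'a om \<Rightarrow> bool" where
  "single_isthmus M \<longleftrightarrow> (\<exists>e. ground M = {e} \<and> {e} \<in> supp ` cocircuits M)"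


section \<open>Activities and active partition of a basis\<close>

text \<open>The linear order on the ground set is that of the type.\<close>

definition fund_circuit :: "'a om \<Rightarrow> 'a set \<Rightarrow> 'a \<Rightarrow> 'a signed_set" where
  "fund_circuit M B e = (THE X. X \<in> circuits M \<and> supp X \<subseteq> insert e B \<and> X e = 1)"

definition fund_cocircuit :: "'a om \<Rightarrow> 'a set \<Rightarrow> 'a \<Rightarrow> 'a signed_set" where
  "fund_cocircuit M B b =
     (THE Y. Y \<in> cocircuits M \<and> supp Y \<subseteq> insert b (ground M - B) \<and> Y b = 1)"

definition Int_act :: "'a::linorder om \<Rightarrow> 'a set \<Rightarrow> 'a set" where
  "Int_act M B = {b \<in> B. b = Min (supp (fund_cocircuit M B b))}"

definition Ext_act :: "'a::linorder om \<Rightarrow> 'a set \<Rightarrow> 'a set" where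
  "Ext_act M B = {e \<in> ground M - B. e = Min (supp (fund_circuit M B e))}"

definition uniactive_internal :: "'a::linorder om \<Rightarrow> 'a set \<Rightarrow> bool" where
  "uniactive_internal M B \<longleftrightarrow> card (Int_act M B) = 1 \<and> Ext_act M B = {}"

definition uniactive_external :: "'a::linorder om \<Rightarrow> 'a set \<Rightarrow> bool" where
  "uniactive_external M B \<longleftrightarrow> Int_act M B = {} \<and> card (Ext_act M B) = 1"

text \<open>A filtration $\emptyset = F'_\varepsilon \subset \dots \subset F'_0 = F_0 \subset \dots
  \subset F_\iota = E$ is encoded as the pair of the lists
  $[F'_0, \dots, F'_\varepsilon]$ and $[F_0, \dots, F_\iota]$, in this order.\<close>

type_synonym 'a filtration = "'a set list \<times> 'a set list"

definition ext_parts :: "'a set list \<Rightarrow> 'a set list" where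
  "ext_parts F' = map (\<lambda>k. F' ! (k - 1) - F' ! k) [1..<length F']"

definition int_parts :: "'a set list \<Rightarrow> 'a set list" where
  "int_parts F = map (\<lambda>k. F ! k - F ! (k - 1)) [1..<length F]"

definition connected_filtration :: "'a::linorder om \<Rightarrow> 'a filtration \<Rightarrow> bool" where
  "connected_filtration M = (\<lambda>(F', F).
     F' \<noteq> [] \<and> F \<noteq> [] \<and> last F' = {} \<and> hd F' = hd F \<and> last F = ground M \<and>
     sorted_wrt (\<supset>) F' \<and> sorted_wrt (\<subset>) F \<and>
     sorted_wrt (<) (map Min (ext_parts F')) \<and> sorted_wrt (<) (map Min (int_parts F)) \<and>
     (\<forall>k\<in>{1..<length F}.
        connected_om (minor M (F ! k) (F ! (k - 1))) \<and>
        \<not> single_loop (minor M (F ! k) (F ! (k - 1)))) \<and>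
     (\<forall>k\<in>{1..<length F'}.
        connected_om (minor M (F' ! (k - 1)) (F' ! k)) \<and>
        \<not> single_isthmus (minor M (F' ! (k - 1)) (F' ! k))))"

definition is_active_filtration :: "'a::linorder om \<Rightarrow> 'a set \<Rightarrow> 'a filtration \<Rightarrow> bool" where
  "is_active_filtration M B = (\<lambda>(F', F).
     connected_filtration M (F', F) \<and>
     (\<forall>k\<in>{1..<length F}.
        basis (minor M (F ! k) (F ! (k - 1))) (B \<inter> (F ! k - F ! (k - 1))) \<and>
        uniactive_internal (minor M (F ! k) (F ! (k - 1))) (B \<inter> (F ! k - F ! (k - 1)))) \<and>
     (\<forall>k\<in>{1..<length F'}.
        basis (minor M (F' ! (k - 1)) (F' ! k)) (B \<inter> (F' ! (k - 1) - F' ! k)) \<and>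
        uniactive_external (minor M (F' ! (k - 1)) (F' ! k)) (B \<inter> (F' ! (k - 1) - F' ! k))))"

definition active_filtration :: "'a::linorder om \<Rightarrow> 'a set \<Rightarrow> 'a filtration" where
  "active_filtration M B = (THE \<F>. is_active_filtration M B \<F>)"

definition active_partition :: "'a::linorder om \<Rightarrow> 'a set \<Rightarrow> 'a set set" where
  "active_partition M B =
     (case active_filtration M B of (F', F) \<Rightarrow> set (ext_parts F') \<union> set (int_parts F))"


section \<open>The active basis of an ordered oriented matroid\<close>

definition pos_circuits :: "'a om \<Rightarrow> 'a set set" where
  "pos_circuits N = {supp X | X. X \<in> circuits N \<and> positive X}"

definition pos_cocircuits :: "'a om \<Rightarrow> 'a set set" where
  "pos_cocircuits N = {supp Y | Y. Y \<in> cocircuits N \<and> positive Y}"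

text \<open>In \<open>om_ext N\<close> and \<open>om_int N\<close> the element with index \<open>k\<close> of the list \<open>as\<close> is the
  $a'_{k+1}$, resp. $a_{k+1}$, of the usual indexing from 1. The lists \<open>om_ext N\<close> and \<open>om_int N\<close>
  start with the same set $F_c$, the union of all positive circuits being the complement of the
  union of all positive cocircuits.\<close>

definition om_ext :: "'a::linorder om \<Rightarrow> 'a set list" where
  "om_ext N =
     (let as = sorted_list_of_set (Min ` pos_circuits N)
      in map (\<lambda>k. \<Union>{C \<in> pos_circuits N. Min C \<ge> as ! k}) [0..<length as] @ [{}])"

definition om_int :: "'a::linorder om \<Rightarrow> 'a set list" where
  "om_int N =
     (let as = sorted_list_of_set (Min ` pos_cocircuits N)
      in map (\<lambda>k. ground N - \<Union>{D \<in> pos_cocircuits N. Min D \<ge> as ! k}) [0..<length as]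
         @ [ground N])"

definition om_active_filtration :: "'a::linorder om \<Rightarrow> 'a filtration" where
  "om_active_filtration N = (om_ext N, om_int N)"

text \<open>Meaningful only for \<open>N\<close> bounded with respect to the smallest element \<open>p\<close> of its ground set,
  i.e. without positive circuit and such that \<open>p\<close> is in every positive cocircuit: the basis with
  the given property then exists and is unique.\<close>

definition alpha_bounded :: "'a::linorder om \<Rightarrow> 'a set" where
  "alpha_bounded N =
     (THE B. basis N B \<and>
        (\<forall>b\<in>B - {Min (ground N)}.
           let Y = fund_cocircuit N B b in Y b = - Y (Min (supp Y))) \<and>
        (\<forall>e\<in>ground N - B.
           let X = fund_circuit N B e in X e = - X (Min (supp X))))"

text \<open>Meaningful only if the dual of \<open>N\<close> is bounded with respect to its smallest element.\<close>

definition alpha_dual_bounded :: "'a::linorder om \<Rightarrow> 'a set" where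
  "alpha_dual_bounded N = ground N - alpha_bounded (dual N)"

text \<open>The minors below are bounded, resp. dual-bounded, with respect to their smallest elements. For
  \<open>N\<close> itself bounded, resp. dual-bounded, the filtration has a single step and \<open>alpha N\<close> is
  \<open>alpha_bounded N\<close>, resp. \<open>alpha_dual_bounded N\<close>.\<close>

definition alpha :: "'a::linorder om \<Rightarrow> 'a set" where
  "alpha N =
     (case om_active_filtration N of (F', F) \<Rightarrow>
        (\<Union>k\<in>{1..<length F}. alpha_bounded (minor N (F ! k) (F ! (k - 1)))) \<union>
        (\<Union>k\<in>{1..<length F'}. alpha_dual_bounded (minor N (F' ! (k - 1)) (F' ! k))))"

definition alpha_preimage :: "'a::linorder om \<Rightarrow> 'a set \<Rightarrow> 'a set set" where
  "alpha_preimage M B = {A. A \<subseteq> ground M \<and> alpha (reorientation A M) = B}"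


section \<open>The procedure\<close>

datatype side = Internal | External

text \<open>A state consists of the mapping Part and the labels, both defined on the elements treated
  so far, and of the set of elements reoriented so far.\<close>

record 'a state =
  part :: "'a \<rightharpoonup> 'a"
  label :: "'a \<rightharpoonup> side"
  reoriented :: "'a set"

text \<open>An element \<open>e\<close> that is not active: \<open>X\<close> is \<open>C*(B;e)\<close> if \<open>e \<in> B\<close> and \<open>C(B;e)\<close> otherwise,
  signed in the current reorientation; \<open>l\<close> is the label that is looked for first, External if
  \<open>e \<in> B\<close> and Internal otherwise, and \<open>l'\<close> is the other one.\<close>

definition assign :: "side \<Rightarrow> side \<Rightarrow> 'a signed_set \<Rightarrow> 'a::linorder \<Rightarrow> 'a state \<Rightarrow> 'a state" where
  "assign l l' X e s =
     (let below = {c \<in> supp X. c < e};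
          first = {c \<in> below. label s c = Some l};
          d = (if first \<noteq> {} then Max ((\<lambda>c. the (part s c)) ` first)
               else Min ((\<lambda>c. the (part s c)) ` below));
          part' = (part s)(e \<mapsto> d);
          a = Min {a \<in> supp X. part' a = Some d}
      in \<lparr>part = part',
          label = (label s)(e \<mapsto> (if first \<noteq> {} then l else l')),
          reoriented = (if X e = - X a then reoriented s else insert e (reoriented s))\<rparr>)"

text \<open>An active element \<open>e\<close>. The set \<open>S\<close> records the arbitrary choices: it consists of the active
  elements that one chooses to reorient.\<close>

definition assign_active :: "side \<Rightarrow> 'a set \<Rightarrow> 'a \<Rightarrow> 'a state \<Rightarrow> 'a state" where
  "assign_active l S e s =
     \<lparr>part = (part s)(e \<mapsto> e),
      label = (label s)(e \<mapsto> l),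
      reoriented = (if e \<in> S then insert e (reoriented s) else reoriented s)\<rparr>"

definition procedure_step ::
    "'a::linorder om \<Rightarrow> 'a set \<Rightarrow> 'a set \<Rightarrow> 'a \<Rightarrow> 'a state \<Rightarrow> 'a state" where
  "procedure_step M B S e s =
     (let M' = reorientation (reoriented s) M in
      if e \<in> B then
        if e \<in> Int_act M B then assign_active Internal S e s
        else assign External Internal (fund_cocircuit M' B e) e s
      else
        if e \<in> Ext_act M B then assign_active External S e s
        else assign Internal External (fund_circuit M' B e) e s)"

definition procedure :: "'a::linorder om \<Rightarrow> 'a set \<Rightarrow> 'a set \<Rightarrow> 'a state" where
  "procedure M B S =
     fold (procedure_step M B S) (sorted_list_of_set (ground M))
       \<lparr>part = Map.empty, label = Map.empty, reoriented = {}\<rparr>"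

end

theory Submission
  imports Defs
begin

text \<open>All arguments rest on the orthogonality of circuits and cocircuits. The map Part is determined
  by local conditions: the fundamental circuit of an external element outside \<open>B\<close> and the
  fundamental cocircuit of an internal element of \<open>B\<close> have the same label throughout and no smaller
  value of Part, and every inactive element has a smaller neighbour in its own part. These conditions
  make the parts the differences of a filtration compatible with \<open>B\<close>, and the signs chosen by the
  procedure force the positive circuits and cocircuits of the resulting reorientation to span the same
  filtration; hence \<open>B\<close> is its active basis, fully optimal bases being unique.

  Uniqueness: for two fully optimal bases \<open>B1 \<noteq> B2\<close>, painting with signs \<open>-\<close> on \<open>B1 - B2\<close> and \<open>+\<close> on
  \<open>B2 - B1\<close> yields a circuit inside \<open>B1 \<union> B2\<close> or a cocircuit avoiding \<open>B1 \<inter> B2\<close>. Over the reals such a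
  circuit has nonzero product with \<open>v1 - v2\<close>, where \<open>vi\<close> is the sum of the fundamental cocircuits
  \<open>C*(Bi; b)\<close> weighted by infinitesimals that decrease rapidly with \<open>b\<close>; the proof compares the
  leading terms. The cocircuit is excluded dually.

  The existence of fully optimal bases is not used: the outputs of the procedure for all bases and
  all choices are pairwise different, and by the covering of the Boolean lattice by the intervals
  from \<open>B - Int_act M B\<close> to \<open>B \<union> Ext_act M B\<close> there are at least as many of them as there are
  reorientations.\<close>

section \<open>Dual pairs of signed sets\<close>

text \<open>Everything about a basis is read off one sign matrix \<open>W\<close>: row
  \<open>x\<close> is the fundamental cocircuit or circuit of \<open>x\<close>. It has 1 on the
  diagonal, is skew symmetric off it, and its other nonzero entries lie between \<open>B\<close> and
  its complement. The dual has the same matrix, a minor compatible with \<open>B\<close> restricts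
  it, and a reorientation multiplies entries by signs. Hence the zero pattern, and with it Part and
  the labels, is common to all reorientations.

  The first obstacle is that cocircuits are given by orthogonality to all circuits, so that signed
  cocircuits must be constructed from circuit elimination. After that, the argument keeps only
  orthogonality, fundamental vectors, exchange and extension, which pass to duals and minors.

  The second obstacle is that \<open>active_filtration\<close> and \<open>alpha_bounded\<close> are
  definite descriptions: each is evaluated by exhibiting an object and proving that it is the only
  one. For the filtration this is done by passing to Part, whose values are forced by induction
  along the order.\<close>

lemma supp_iff: "e \<in> supp X \<longleftrightarrow> X e \<noteq> 0"
  by (simp add: supp_def)

lemma supp_uminus [simp]: "supp (- X) = supp X"
  by (simp add: supp_def)

lemma orthogonal_commute: "orthogonal X Y \<longleftrightarrow> orthogonal Y X"
  by (simp add: orthogonal_def mult.commute)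

lemma not_orthogonal:
  assumes "\<And>e. X e * Y e \<ge> 0" and "X f * Y f \<noteq> 0"
  shows "\<not> orthogonal X Y"
  using assms unfolding orthogonal_def by (metis leD)

lemma orthogonal_other:
  assumes "orthogonal X Y" and "X e \<noteq> 0" and "Y e \<noteq> 0"
  shows "\<exists>f. f \<noteq> e \<and> X f \<noteq> 0 \<and> Y f \<noteq> 0"
  using assms unfolding orthogonal_def
  by (metis less_irrefl mult_eq_0_iff order_less_asym)

text \<open>The source of skew symmetry: with at most two common elements the sign rule becomes an
  equation.\<close>

lemma orthogonal_pair:
  assumes "orthogonal X Y" and "e \<noteq> f" and "\<And>g. g \<noteq> e \<Longrightarrow> g \<noteq> f \<Longrightarrow> X g = 0 \<or> Y g = 0"
    and "X e \<in> {-1, 0, 1}" and "Y e \<in> {-1, 0, 1}" and "X f \<in> {-1, 0, 1}" and "Y f \<in> {-1, 0, 1}"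
  shows "X e * Y e = - (X f * Y f)"
proof -
  have "X g * Y g = 0" if "g \<noteq> e" "g \<noteq> f" for g
    using assms(3)[OF that] by auto
  then have "X e * Y e = 0 \<and> X f * Y f = 0 \<or> X e * Y e > 0 \<and> X f * Y f < 0 \<or>
      X e * Y e < 0 \<and> X f * Y f > 0"
    using assms(1) unfolding orthogonal_def by (metis less_irrefl order_less_asym)
  then show ?thesis using assms(4-7) by auto
qed

definition fund :: "'a signed_set set \<Rightarrow> 'a set \<Rightarrow> 'a \<Rightarrow> 'a signed_set" where
  "fund C B e = (THE X. X \<in> C \<and> supp X \<subseteq> insert e B \<and> X e = 1)"

text \<open>The sign analogue of the tableau of a basis. Joining the cocircuits of the elements of
  \<open>B\<close> and the circuits of the others gives a family that is the same for the dual and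
  the complement of \<open>B\<close>.\<close>

definition fund_vec ::
    "'a set \<Rightarrow> 'a signed_set set \<Rightarrow> 'a signed_set set \<Rightarrow> 'a set \<Rightarrow> 'a \<Rightarrow> 'a signed_set" where
  "fund_vec E C D B x = (if x \<in> B then fund D (E - B) x else fund C B x)"

text \<open>The axioms are invariant under exchanging circuits and cocircuits and complementing the
  bases, so that every consequence comes with its dual.\<close>

locale dual_pair =
  fixes E :: "'a set" and C D :: "'a signed_set set" and Bs :: "'a set set"
  assumes finite_E: "finite E"
    and C_sign: "X \<in> C \<Longrightarrow> X e \<in> {-1, 0, 1}"
    and C_supp: "X \<in> C \<Longrightarrow> supp X \<subseteq> E"
    and C_nonempty: "X \<in> C \<Longrightarrow> supp X \<noteq> {}"
    and C_uminus: "X \<in> C \<Longrightarrow> - X \<in> C"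
    and D_sign: "Y \<in> D \<Longrightarrow> Y e \<in> {-1, 0, 1}"
    and D_supp: "Y \<in> D \<Longrightarrow> supp Y \<subseteq> E"
    and D_nonempty: "Y \<in> D \<Longrightarrow> supp Y \<noteq> {}"
    and D_uminus: "Y \<in> D \<Longrightarrow> - Y \<in> D"
    and orth: "X \<in> C \<Longrightarrow> Y \<in> D \<Longrightarrow> orthogonal X Y"
    and bases_sub: "B \<in> Bs \<Longrightarrow> B \<subseteq> E"
    and fund_C_ex: "B \<in> Bs \<Longrightarrow> e \<in> E - B \<Longrightarrow> \<exists>X\<in>C. supp X \<subseteq> insert e B \<and> X e = 1"
    and fund_D_ex: "B \<in> Bs \<Longrightarrow> b \<in> B \<Longrightarrow> \<exists>Y\<in>D. supp Y \<subseteq> insert b (E - B) \<and> Y b = 1"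
    and exchange: "B \<in> Bs \<Longrightarrow> e \<in> E - B \<Longrightarrow> b \<in> B \<Longrightarrow> X \<in> C \<Longrightarrow> supp X \<subseteq> insert e B \<Longrightarrow>
      X b \<noteq> 0 \<Longrightarrow> insert e (B - {b}) \<in> Bs"
    and extend: "I \<subseteq> E \<Longrightarrow> (\<And>X. X \<in> C \<Longrightarrow> \<not> supp X \<subseteq> I) \<Longrightarrow> \<exists>B\<in>Bs. I \<subseteq> B"
begin

section \<open>Fundamental vectors of a dual pair\<close>

abbreviation V :: "'a set \<Rightarrow> 'a \<Rightarrow> 'a signed_set" where
  "V \<equiv> fund_vec E C D"

lemma fund_relation:
  assumes "B \<in> Bs" "b \<in> B" "e \<in> E - B" "X \<in> C" "supp X \<subseteq> insert e B"
    "Y \<in> D" "supp Y \<subseteq> insert b (E - B)"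
  shows "X e * Y e = - (X b * Y b)"
proof (rule orthogonal_pair)
  show "orthogonal X Y" using assms orth by blast
  show "e \<noteq> b" using assms by auto
  show "X g = 0 \<or> Y g = 0" if "g \<noteq> e" "g \<noteq> b" for g
    using assms that unfolding supp_def by blast
qed (use assms C_sign D_sign in blast)+

text \<open>Uniqueness by orthogonality: the fundamental cocircuit of \<open>b\<close> meets such a
  circuit at most in \<open>e\<close> and \<open>b\<close>, so the value at \<open>e\<close> fixes
  the value at \<open>b\<close>.\<close>

lemma fund_C:
  assumes "B \<in> Bs" "e \<in> E - B"
  shows "fund C B e \<in> C \<and> supp (fund C B e) \<subseteq> insert e B \<and> fund C B e e = 1"
    and "X \<in> C \<Longrightarrow> supp X \<subseteq> insert e B \<Longrightarrow> X e = 1 \<Longrightarrow> fund C B e = X"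
proof -
  have unique: "X = X'"
    if "X \<in> C" "supp X \<subseteq> insert e B" "X e = 1" "X' \<in> C" "supp X' \<subseteq> insert e B" "X' e = 1" for X X'
  proof
    fix b
    consider "b = e" | "b \<in> B" | "b \<notin> insert e B" by blast
    then show "X b = X' b"
    proof cases
      case 2
      then obtain Y where Y: "Y \<in> D" "supp Y \<subseteq> insert b (E - B)" "Y b = 1"
        using fund_D_ex[OF assms(1)] by blast
      show ?thesis
        using fund_relation[OF assms(1) 2 assms(2) that(1,2) Y(1,2)]
          fund_relation[OF assms(1) 2 assms(2) that(4,5) Y(1,2)] that Y by simp
    next
      case 3
      then have "b \<notin> supp X" "b \<notin> supp X'" using that by blast+
      then show ?thesis by (simp add: supp_def)
    qed (use that in simp)
  qed
  obtain X0 where X0: "X0 \<in> C" "supp X0 \<subseteq> insert e B" "X0 e = 1"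
    using fund_C_ex[OF assms] by blast
  have "fund C B e = X0" unfolding fund_def
    by (rule the_equality) (use X0 unique in blast)+
  then show "fund C B e \<in> C \<and> supp (fund C B e) \<subseteq> insert e B \<and> fund C B e e = 1"
    and "X \<in> C \<Longrightarrow> supp X \<subseteq> insert e B \<Longrightarrow> X e = 1 \<Longrightarrow> fund C B e = X"
    using X0 unique by blast+
qed

text \<open>A circuit inside \<open>B\<close> would meet the fundamental cocircuit of one of its
  elements in this element alone.\<close>

lemma bases_independent:
  assumes "B \<in> Bs" "X \<in> C"
  shows "\<not> supp X \<subseteq> B"
proof
  assume sub: "supp X \<subseteq> B"
  obtain b where b: "X b \<noteq> 0" using C_nonempty[OF assms(2)] by (auto simp: supp_def)
  then have "b \<in> B" using sub by (auto simp: supp_def)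
  then obtain Y where Y: "Y \<in> D" "supp Y \<subseteq> insert b (E - B)" "Y b = 1"
    using fund_D_ex[OF assms(1)] by blast
  show False
    using orthogonal_other[OF orth[OF assms(2) Y(1)] b] Y sub unfolding supp_def by auto
qed

text \<open>All axioms but \<open>exchange\<close> and \<open>extend\<close> are exchanged in pairs.
  The former dualises because the circuit of \<open>e\<close> contains \<open>b\<close> exactly if
  the cocircuit of \<open>b\<close> contains \<open>e\<close>; for the latter, a set that meets
  every basis is shown to contain a cocircuit.\<close>

lemma dual_pair_dual: "dual_pair E D C ((\<lambda>B. E - B) ` Bs)"
proof
  have cc: "E - (E - B) = B" if "B \<in> Bs" for B using bases_sub[OF that] by blast
  show "\<exists>X\<in>D. supp X \<subseteq> insert e B \<and> X e = 1" if "B \<in> (\<lambda>B. E - B) ` Bs" "e \<in> E - B" for B e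
    using that fund_D_ex cc by blast
  show "\<exists>Y\<in>C. supp Y \<subseteq> insert b (E - B) \<and> Y b = 1" if "B \<in> (\<lambda>B. E - B) ` Bs" "b \<in> B" for B b
    using that fund_C_ex cc by auto
  show "insert e (B - {b}) \<in> (\<lambda>B. E - B) ` Bs"
    if prems: "B \<in> (\<lambda>B. E - B) ` Bs" "e \<in> E - B" "b \<in> B" "Y \<in> D" "supp Y \<subseteq> insert e B" "Y b \<noteq> 0"
    for B e b Y
  proof -
    obtain B0 where B0: "B0 \<in> Bs" "B = E - B0" using prems(1) by blast
    have e: "e \<in> B0" and b: "b \<in> E - B0" using prems B0 bases_sub by auto
    obtain X where X: "X \<in> C" "supp X \<subseteq> insert b B0" "X b = 1"
      using fund_C_ex[OF B0(1) b] by blast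
    have "X e \<noteq> 0"
      using fund_relation[OF B0(1) e b X(1,2) prems(4)] prems(5,6) X(3) B0 by auto
    then have "insert b (B0 - {e}) \<in> Bs" using exchange[OF B0(1) b e X(1,2)] by blast
    moreover have "insert e (B - {b}) = E - insert b (B0 - {e})"
      using B0 e b bases_sub[OF B0(1)] by auto
    ultimately show ?thesis by blast
  qed
  show "\<exists>B\<in>(\<lambda>B. E - B) ` Bs. I \<subseteq> B" if I: "I \<subseteq> E" "\<And>X. X \<in> D \<Longrightarrow> \<not> supp X \<subseteq> I" for I
  proof (rule ccontr)
    assume no: "\<not> ?thesis"
    define meets where "meets J \<longleftrightarrow> (\<forall>B\<in>Bs. J \<inter> B \<noteq> {})" for J
    have "meets I" unfolding meets_def
    proof (intro ballI notI)
      fix B assume "B \<in> Bs" "I \<inter> B = {}"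
      then have "I \<subseteq> E - B" using I(1) by blast
      then show False using no \<open>B \<in> Bs\<close> by blast
    qed
    moreover have "finite {J. J \<subseteq> I \<and> meets J}"
      using finite_subset[OF I(1) finite_E] by simp
    ultimately have "\<exists>J\<in>{J. J \<subseteq> I \<and> meets J}. J \<subseteq> I \<and> (\<forall>K\<in>{J. J \<subseteq> I \<and> meets J}. K \<subseteq> J \<longrightarrow> J = K)"
      by (intro finite_has_minimal2) auto
    then obtain J where J: "J \<subseteq> I" "meets J" "\<And>K. meets K \<Longrightarrow> K \<subseteq> J \<Longrightarrow> K = J"
      by (metis (mono_tags, lifting) mem_Collect_eq order_trans)
    obtain B0 where "B0 \<in> Bs" using extend[of "{}"] C_nonempty by auto
    then obtain d where d: "d \<in> J" using J(2) unfolding meets_def by blast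
    \<comment> \<open>By minimality some basis \<open>B\<close> meets \<open>J\<close> in
      \<open>d\<close> alone. The fundamental cocircuit of \<open>d\<close> then lies in
      \<open>J\<close>, since each of its elements can replace \<open>d\<close> in
      \<open>B\<close>.\<close>
    then have "\<not> meets (J - {d})" using J(3) by blast
    then obtain B where B: "B \<in> Bs" "(J - {d}) \<inter> B = {}" unfolding meets_def by blast
    then have dB: "d \<in> B" using J(2) unfolding meets_def by blast
    obtain Y where Y: "Y \<in> D" "supp Y \<subseteq> insert d (E - B)" "Y d = 1"
      using fund_D_ex[OF B(1) dB] by blast
    have "supp Y \<subseteq> J"
    proof
      fix e assume e: "e \<in> supp Y"
      show "e \<in> J"
      proof (cases "e = d")
        case False
        then have eB: "e \<in> E - B" using e Y by blast
        obtain X where X: "X \<in> C" "supp X \<subseteq> insert e B" "X e = 1"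
          using fund_C_ex[OF B(1) eB] by blast
        have "X d \<noteq> 0"
          using fund_relation[OF B(1) dB eB X(1,2) Y(1,2)] e X(3) by (auto simp: supp_def)
        then have "insert e (B - {d}) \<in> Bs" using exchange[OF B(1) eB dB X(1,2)] by blast
        then have "J \<inter> insert e (B - {d}) \<noteq> {}" using J(2) unfolding meets_def by blast
        then show ?thesis using B(2) by auto
      qed (use d in simp)
    qed
    then show False using I(2)[OF Y(1)] J(1) by blast
  qed
  show "orthogonal Y X" if "Y \<in> D" "X \<in> C" for X Y
    using orth that orthogonal_commute by metis
  show "B \<subseteq> E" if "B \<in> (\<lambda>B. E - B) ` Bs" for B
    using that by blast
qed (fact finite_E | erule C_sign C_supp C_nonempty C_uminus D_sign D_supp D_nonempty D_uminus)+

lemma fund_D: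
  assumes "B \<in> Bs" "b \<in> B"
  shows "fund D (E - B) b \<in> D \<and> supp (fund D (E - B) b) \<subseteq> insert b (E - B) \<and>
      fund D (E - B) b b = 1"
    and "Y \<in> D \<Longrightarrow> supp Y \<subseteq> insert b (E - B) \<Longrightarrow> Y b = 1 \<Longrightarrow> fund D (E - B) b = Y"
  using dual_pair.fund_C[OF dual_pair_dual, of "E - B" b] assms bases_sub by auto

lemma V_dual:
  assumes "B \<in> Bs" "x \<in> E"
  shows "fund_vec E D C (E - B) x = V B x"
  using assms bases_sub[OF assms(1)] unfolding fund_vec_def by (simp add: double_diff)

lemma V_D: "B \<in> Bs \<Longrightarrow> b \<in> B \<Longrightarrow> V B b \<in> D"
  using fund_D by (simp add: fund_vec_def)

lemma V_C: "B \<in> Bs \<Longrightarrow> e \<in> E - B \<Longrightarrow> V B e \<in> C"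
  using fund_C by (simp add: fund_vec_def)

lemma V_D_eq: "B \<in> Bs \<Longrightarrow> b \<in> B \<Longrightarrow> Y \<in> D \<Longrightarrow> supp Y \<subseteq> insert b (E - B) \<Longrightarrow> Y b = 1 \<Longrightarrow> V B b = Y"
  using fund_D by (simp add: fund_vec_def)

lemma V_C_eq: "B \<in> Bs \<Longrightarrow> e \<in> E - B \<Longrightarrow> X \<in> C \<Longrightarrow> supp X \<subseteq> insert e B \<Longrightarrow> X e = 1 \<Longrightarrow> V B e = X"
  using fund_C by (simp add: fund_vec_def)

lemma V_self: "B \<in> Bs \<Longrightarrow> x \<in> E \<Longrightarrow> V B x x = 1"
  using fund_C fund_D by (simp add: fund_vec_def)

lemma V_side: "B \<in> Bs \<Longrightarrow> x \<in> E \<Longrightarrow> V B x y \<noteq> 0 \<Longrightarrow> y \<noteq> x \<Longrightarrow> (y \<in> B \<longleftrightarrow> x \<notin> B)"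
  using fund_C[of B x] fund_D[of B x] unfolding fund_vec_def supp_def
  by (cases "x \<in> B") auto

lemma V_E: "B \<in> Bs \<Longrightarrow> x \<in> E \<Longrightarrow> V B x y \<noteq> 0 \<Longrightarrow> y \<in> E"
  using V_C[of B x] V_D[of B x] C_supp D_supp by (cases "x \<in> B") (auto simp: supp_def)

lemma V_sign: "B \<in> Bs \<Longrightarrow> x \<in> E \<Longrightarrow> V B x y \<in> {-1, 0, 1}"
  using V_C[of B x] V_D[of B x] C_sign D_sign by (cases "x \<in> B") (blast+)

lemma V_skew:
  assumes "B \<in> Bs" "x \<in> E" "y \<in> E" "x \<noteq> y"
  shows "V B x y = - V B y x"
proof -
  have *: "V B e b = - V B b e" if "b \<in> B" "e \<in> E - B" for b e
    using fund_relation[OF assms(1) that, of "V B e" "V B b"] V_self[OF assms(1)] that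
      fund_C[OF assms(1) that(2)] fund_D[OF assms(1) that(1)] bases_sub[OF assms(1)]
    by (auto simp: fund_vec_def split: if_splits)
  consider "x \<in> B" "y \<in> B" | "x \<in> B" "y \<in> E - B" | "x \<in> E - B" "y \<in> B" | "x \<notin> B" "y \<notin> B"
    using assms by blast
  then show ?thesis
  proof cases
    case 2 then show ?thesis using *[of x y] by simp
  next
    case 3 then show ?thesis using *[of y x] by simp
  qed (use V_side[OF assms(1,2), of y] V_side[OF assms(1,3), of x] assms(4) in
      \<open>metis neg_equal_0_iff_equal\<close>)+
qed

lemma V_adj: "B \<in> Bs \<Longrightarrow> x \<in> E \<Longrightarrow> y \<in> E \<Longrightarrow> V B x y \<noteq> 0 \<longleftrightarrow> V B y x \<noteq> 0"
  using V_skew[of B x y] by (cases "x = y") auto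

lemma V_supp_finite: "B \<in> Bs \<Longrightarrow> x \<in> E \<Longrightarrow> finite {y. V B x y \<noteq> 0}"
  by (rule finite_subset[OF _ finite_E]) (auto dest: V_E)

lemma exchange_V:
  assumes "B \<in> Bs" "e \<in> E - B" "b \<in> B" "V B e b \<noteq> 0"
  shows "insert e (B - {b}) \<in> Bs"
  using exchange[OF assms(1-3), of "V B e"] fund_C[OF assms(1,2)] assms by (auto simp: fund_vec_def)

text \<open>Add \<open>e\<close> to a maximal independent part \<open>J\<close> of
  \<open>Z - {e}\<close>. If this creates a circuit, it passes through \<open>e\<close>. Otherwise
  complete to a basis: the fundamental cocircuit of \<open>e\<close> avoids \<open>Z - {e}\<close>,
  because a circuit in \<open>insert z J\<close> would meet it in \<open>z\<close> alone.\<close>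

lemma unsigned_painting:
  assumes "e \<in> E"
  shows "(\<exists>X\<in>C. X e \<noteq> 0 \<and> supp X \<subseteq> insert e Z) \<or> (\<exists>Y\<in>D. Y e \<noteq> 0 \<and> supp Y \<inter> (Z - {e}) = {})"
proof -
  define indep where "indep J \<longleftrightarrow> (\<forall>X\<in>C. \<not> supp X \<subseteq> J)" for J
  have fin: "finite {J. J \<subseteq> E \<inter> Z - {e} \<and> indep J}" using finite_E by simp
  have "{} \<in> {J. J \<subseteq> E \<inter> Z - {e} \<and> indep J}" using C_nonempty by (auto simp: indep_def)
  then obtain J where J: "J \<subseteq> E \<inter> Z - {e}" "indep J"
    "\<And>K. K \<subseteq> E \<inter> Z - {e} \<Longrightarrow> indep K \<Longrightarrow> J \<subseteq> K \<Longrightarrow> K = J"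
    using finite_has_maximal[OF fin] by (smt (verit) empty_iff mem_Collect_eq)
  show ?thesis
  proof (cases "indep (insert e J)")
    case True
    then obtain B where B: "B \<in> Bs" "insert e J \<subseteq> B"
      using extend[of "insert e J"] J assms by (auto simp: indep_def)
    have "V B e z = 0" if z: "z \<in> Z - {e}" for z
    proof (rule ccontr)
      assume nz: "V B e z \<noteq> 0"
      have zE: "z \<in> E" using V_E[OF B(1) assms(1) nz] .
      have zB: "z \<notin> B" using V_side[OF B(1) assms(1) nz] z B by auto
      have "\<not> indep (insert z J)"
        using J(3)[of "insert z J"] J(1) z zE zB B by auto
      then obtain X where X: "X \<in> C" "supp X \<subseteq> insert z J" by (auto simp: indep_def)
      then have "X z \<noteq> 0" using J(2) unfolding indep_def supp_def by blast
      moreover have Xe: "X e = 0" using X J(1) z by (auto simp: supp_def)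
      moreover have "orthogonal X (V B e)" using orth[OF X(1)] V_D[OF B(1)] B by blast
      ultimately obtain f where "f \<noteq> z" "X f \<noteq> 0" "V B e f \<noteq> 0"
        using nz orthogonal_other by metis
      then show False using V_side[OF B(1) assms(1), of f] B X Xe by (auto simp: supp_def)
    qed
    then show ?thesis using V_D[OF B(1), of e] V_self[OF B(1) assms(1)] B
      by (metis (no_types, lifting) disjoint_iff insert_subset supp_iff zero_neq_one)
  next
    case False
    then obtain X where X: "X \<in> C" "supp X \<subseteq> insert e J" by (auto simp: indep_def)
    then have "X e \<noteq> 0" using J(2) unfolding indep_def supp_def by blast
    then show ?thesis using X J(1) by blast
  qed
qed

text \<open>Induction on \<open>S\<close>, giving one element \<open>f\<close> to each of the two
  unsigned colours in turn. This is Minty's painting lemma: \<open>Z\<close> is free for circuits,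
  the elements outside \<open>Z\<close> and \<open>S\<close> are free for cocircuits, and
  \<open>S\<close> carries prescribed signs for both.\<close>

lemma painting:
  assumes "e \<in> S" "S \<subseteq> E" "Z \<inter> S = {}"
    and \<sigma>: "\<And>f. \<sigma> f \<in> {-1, 1 :: int}"
  shows "(\<exists>X\<in>C. X e \<noteq> 0 \<and> supp X \<subseteq> Z \<union> S \<and> (\<forall>f\<in>S. \<sigma> f * X f \<ge> 0)) \<or>
    (\<exists>Y\<in>D. Y e \<noteq> 0 \<and> supp Y \<inter> Z = {} \<and> (\<forall>f\<in>S. \<sigma> f * Y f \<ge> 0))"
  using assms(1-3)
proof (induction "card S" arbitrary: S Z rule: less_induct)
  case less
  have finS: "finite S" using less.prems finite_E finite_subset by blast
  have flip: "\<exists>W'. (W' = W \<or> W' = - W) \<and> \<sigma> e * W' e \<ge> 0" for W :: "'a signed_set"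
  proof (cases "\<sigma> e * W e \<ge> 0")
    case False
    then have "\<sigma> e * (- W) e \<ge> 0" by simp
    then show ?thesis by blast
  qed blast
  show ?case
  proof (cases "S = {e}")
    case True
    have "(\<exists>X\<in>C. X e \<noteq> 0 \<and> supp X \<subseteq> insert e Z) \<or> (\<exists>Y\<in>D. Y e \<noteq> 0 \<and> supp Y \<inter> (Z - {e}) = {})"
      using unsigned_painting less.prems by blast
    then show ?thesis
    proof
      assume "\<exists>X\<in>C. X e \<noteq> 0 \<and> supp X \<subseteq> insert e Z"
      then obtain X where X: "X \<in> C" "X e \<noteq> 0" "supp X \<subseteq> insert e Z" by blast
      obtain X' where X': "X' = X \<or> X' = - X" "\<sigma> e * X' e \<ge> 0" using flip by blast
      then have "X' \<in> C \<and> X' e \<noteq> 0 \<and> supp X' \<subseteq> insert e Z" using X C_uminus by auto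
      then show ?thesis using X' True by auto
    next
      assume "\<exists>Y\<in>D. Y e \<noteq> 0 \<and> supp Y \<inter> (Z - {e}) = {}"
      then obtain X where X: "X \<in> D" "X e \<noteq> 0" "supp X \<inter> (Z - {e}) = {}" by blast
      obtain X' where X': "X' = X \<or> X' = - X" "\<sigma> e * X' e \<ge> 0" using flip by blast
      then have "X' \<in> D \<and> X' e \<noteq> 0 \<and> supp X' \<inter> (Z - {e}) = {}" using X D_uminus by auto
      then show ?thesis using X' True less.prems by auto
    qed
  next
    case False
    then obtain f where f: "f \<in> S" "f \<noteq> e" using less.prems by blast
    have card: "card (S - {f}) < card S" using f finS by (meson card_Diff1_less)
    consider (C0) "\<exists>X\<in>C. X e \<noteq> 0 \<and> supp X \<subseteq> Z \<union> (S - {f}) \<and> (\<forall>g\<in>S - {f}. \<sigma> g * X g \<ge> 0)"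
      | (D0) "\<exists>Y\<in>D. Y e \<noteq> 0 \<and> supp Y \<inter> insert f Z = {} \<and> (\<forall>g\<in>S - {f}. \<sigma> g * Y g \<ge> 0)"
      | (CD) X Y where "X \<in> C" "X e \<noteq> 0" "supp X \<subseteq> insert f Z \<union> (S - {f})"
          "\<forall>g\<in>S - {f}. \<sigma> g * X g \<ge> 0"
          "Y \<in> D" "Y e \<noteq> 0" "supp Y \<inter> Z = {}" "\<forall>g\<in>S - {f}. \<sigma> g * Y g \<ge> 0"
    proof -
      have 1: "e \<in> S - {f}" "S - {f} \<subseteq> E" "Z \<inter> (S - {f}) = {}" "insert f Z \<inter> (S - {f}) = {}"
        using less.prems f by auto
      show thesis
        using less.hyps[OF card 1(1,2,3)] less.hyps[OF card 1(1,2,4)] C0 D0 CD by (elim disjE bexE conjE) metis+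
    qed
    then show ?thesis
    proof cases
      case C0
      then obtain X where X: "X \<in> C" "X e \<noteq> 0" "supp X \<subseteq> Z \<union> (S - {f})"
        "\<forall>g\<in>S - {f}. \<sigma> g * X g \<ge> 0" by blast
      have "X f = 0" using X(3) f less.prems by (auto simp: supp_def)
      then have "\<forall>g\<in>S. \<sigma> g * X g \<ge> 0" using X(4) by force
      then show ?thesis using X by blast
    next
      case D0
      then obtain X where X: "X \<in> D" "X e \<noteq> 0" "supp X \<inter> insert f Z = {}"
        "\<forall>g\<in>S - {f}. \<sigma> g * X g \<ge> 0" by blast
      have "X f = 0" using X(3) by (auto simp: supp_def)
      then have "\<forall>g\<in>S. \<sigma> g * X g \<ge> 0" using X(4) by force
      then show ?thesis using X by blast
    next
      case CD
      show ?thesis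
      proof (rule ccontr)
        assume no: "\<not> ?thesis"
        \<comment> \<open>If both \<open>X\<close> and \<open>Y\<close> have the wrong sign at
          \<open>f\<close>, their products are nonnegative everywhere and positive at
          \<open>f\<close>, which orthogonality forbids.\<close>
        have "\<not> \<sigma> f * X f \<ge> 0"
        proof
          assume "\<sigma> f * X f \<ge> 0"
          then have "\<forall>g\<in>S. \<sigma> g * X g \<ge> 0" using CD(4) by blast
          moreover have "supp X \<subseteq> Z \<union> S" using CD(3) f by blast
          ultimately show False using no CD(1,2) by blast
        qed
        moreover have "\<not> \<sigma> f * Y f \<ge> 0"
        proof
          assume "\<sigma> f * Y f \<ge> 0"
          then have "\<forall>g\<in>S. \<sigma> g * Y g \<ge> 0" using CD(8) by blast
          then show False using no CD(5-7) by blast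
        qed
        ultimately have ff: "(\<sigma> f * X f) * (\<sigma> f * Y f) > 0" by (simp add: zero_less_mult_iff)
        have \<sigma>2: "\<sigma> g * X g * (\<sigma> g * Y g) = X g * Y g" for g using \<sigma>[of g] by auto
        have "X g * Y g \<ge> 0" for g
        proof -
          consider "g = f" | "g \<in> S - {f}" | "X g = 0 \<or> Y g = 0"
            using CD(3,7) by (auto simp: supp_def)
          then show ?thesis
          proof cases
            case 1 then show ?thesis using ff \<sigma>2[of f] by simp
          next
            case 2
            then show ?thesis using CD(4,8) \<sigma>2[of g] by (metis mult_nonneg_nonneg)
          qed auto
        qed
        moreover have "X f * Y f \<noteq> 0" using ff \<sigma>2[of f] by (metis less_irrefl)
        ultimately show False using not_orthogonal orth CD(1,5) by metis
      qed
    qed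
  qed
qed

text \<open>Unsigned painting on the union of the supports without \<open>g\<close>: a cocircuit
  through \<open>e\<close> that avoids the rest would vanish at \<open>g\<close> because of
  \<open>X2\<close>, and would then meet \<open>X1\<close> in \<open>e\<close> alone.\<close>

lemma strong_elimination:
  assumes X: "X1 \<in> C" "X2 \<in> C" "X1 g \<noteq> 0" "X2 g \<noteq> 0" "X1 e \<noteq> 0" "X2 e = 0"
  shows "\<exists>X\<in>C. X e \<noteq> 0 \<and> supp X \<subseteq> supp X1 \<union> supp X2 - {g}"
proof -
  define Z where "Z = supp X1 \<union> supp X2 - {g, e}"
  have ge: "g \<noteq> e" using X by auto
  have eE: "e \<in> E" using C_supp[OF X(1)] X(5) by (auto simp: supp_def)
  consider (C) X where "X \<in> C" "X e \<noteq> 0" "supp X \<subseteq> insert e Z"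
    | (D) Y where "Y \<in> D" "Y e \<noteq> 0" "supp Y \<inter> (Z - {e}) = {}"
    using unsigned_painting[OF eE, of Z] by blast
  then show ?thesis
  proof cases
    case C
    then have "supp X \<subseteq> supp X1 \<union> supp X2 - {g}" using X(5) ge by (auto simp: Z_def supp_def)
    then show ?thesis using C by blast
  next
    case D
    have Yg: "Y g = 0"
    proof (rule ccontr)
      assume "Y g \<noteq> 0"
      then obtain f where f: "f \<noteq> g" "X2 f \<noteq> 0" "Y f \<noteq> 0"
        using orthogonal_other[OF orth[OF X(2) D(1)] X(4)] by blast
      then have "f \<noteq> e" using X(6) by auto
      then have "f \<in> supp Y \<inter> (Z - {e})" using f by (simp add: Z_def supp_def)
      then show False using D(3) by blast
    qed
    obtain f where f: "f \<noteq> e" "X1 f \<noteq> 0" "Y f \<noteq> 0"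
      using orthogonal_other[OF orth[OF X(1) D(1)] X(5) D(2)] by blast
    then have "f \<noteq> g" using Yg by auto
    then have "f \<in> supp Y \<inter> (Z - {e})" using f by (simp add: Z_def supp_def)
    then show ?thesis using D(3) by blast
  qed
qed

text \<open>Transitivity of lying on a common circuit, by induction on the size of the union.
  Eliminating \<open>g\<close> in both directions gives \<open>X3\<close> through \<open>e\<close>
  and \<open>X4\<close> through \<open>f\<close>, which turn out to meet inside a smaller
  union.\<close>

lemma common_circuit_trans:
  assumes "X1 \<in> C" "X1 e \<noteq> 0" "X2 \<in> C" "X2 f \<noteq> 0" "X1 g \<noteq> 0" "X2 g \<noteq> 0"
    and incomparable: "\<And>X X'. X \<in> C \<Longrightarrow> X' \<in> C \<Longrightarrow> supp X \<subseteq> supp X' \<Longrightarrow> supp X' \<subseteq> supp X"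
  shows "\<exists>X\<in>C. X e \<noteq> 0 \<and> X f \<noteq> 0"
  using assms(1-6)
proof (induction "card (supp X1 \<union> supp X2)" arbitrary: X1 X2 g rule: less_induct)
  case less
  note X1 = less.prems(1,2) and X2 = less.prems(3,4) and g = less.prems(5,6)
  have fin: "finite (supp X)" if "X \<in> C" for X
    using that C_supp finite_E finite_subset by blast
  show ?case
  proof (rule ccontr)
    assume no: "\<not> ?thesis"
    then have zero: "X1 f = 0" "X2 e = 0" using X1 X2 by blast+
    have shrink: "supp Z \<union> supp Z' = supp X1 \<union> supp X2"
      if "Z \<in> C" "Z' \<in> C" "Z e \<noteq> 0" "Z' f \<noteq> 0" "supp Z \<inter> supp Z' \<noteq> {}"
        "supp Z \<union> supp Z' \<subseteq> supp X1 \<union> supp X2" for Z Z'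
    proof (rule ccontr)
      assume "supp Z \<union> supp Z' \<noteq> supp X1 \<union> supp X2"
      then have "card (supp Z \<union> supp Z') < card (supp X1 \<union> supp X2)"
        using that(6) fin X1 X2 by (intro psubset_card_mono) auto
      moreover have "\<exists>h. Z h \<noteq> 0 \<and> Z' h \<noteq> 0" using that(5) by (auto simp: supp_def)
      ultimately show False using less.hyps[of Z Z'] that no by blast
    qed
    obtain X3 where X3: "X3 \<in> C" "X3 e \<noteq> 0" "supp X3 \<subseteq> supp X1 \<union> supp X2 - {g}"
      using strong_elimination[of X1 X2 g e] X1 X2 g zero by blast
    obtain X4 where X4: "X4 \<in> C" "X4 f \<noteq> 0" "supp X4 \<subseteq> supp X1 \<union> supp X2 - {g}"
      using strong_elimination[of X2 X1 g f] X1 X2 g zero by blast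
    have gX: "g \<in> supp X1" "g \<in> supp X2" using g by (simp_all add: supp_def)
    have 3: "\<not> supp X3 \<subseteq> supp X1" using incomparable[OF X3(1) X1(1)] X3(3) gX by blast
    have 4: "\<not> supp X4 \<subseteq> supp X2" using incomparable[OF X4(1) X2(1)] X4(3) gX by blast
    have "supp X1 \<inter> supp X4 \<noteq> {}" using 4 X4(3) by blast
    \<comment> \<open>So \<open>X4\<close> contains every element of \<open>X2\<close> outside
      \<open>X1\<close>, and by incomparability \<open>X3\<close> has such an element.\<close>
    then have "supp X1 \<union> supp X4 = supp X1 \<union> supp X2"
      using shrink[OF X1(1) X4(1) X1(2) X4(2)] X4(3) by blast
    then have "supp X3 \<inter> supp X4 \<noteq> {}" using 3 X3(3) by blast
    then have "supp X3 \<union> supp X4 = supp X1 \<union> supp X2"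
      using shrink[OF X3(1) X4(1) X3(2) X4(2)] X3(3) X4(3) by blast
    then show False using X3(3) X4(3) gX by blast
  qed
qed

end

section \<open>Uniqueness of fully optimal bases\<close>

text \<open>Meant for vectors with value 1 at their own element, where it is the sign condition that
  characterises fully optimal bases.\<close>

definition min_opposite :: "'a::linorder signed_set \<Rightarrow> bool" where
  "min_opposite X \<longleftrightarrow> X (Min (supp X)) = -1"

locale ordered_dual_pair = dual_pair E C D Bs
  for E :: "'a::linorder set" and C D Bs
begin

lemma ordered_dual_pair_dual: "ordered_dual_pair E D C ((\<lambda>B. E - B) ` Bs)"
  using dual_pair_dual by (simp add: ordered_dual_pair_def)

lemma V_min_opposite:
  assumes "B \<in> Bs" "x \<in> E" "min_opposite (V B x)"
  defines "m \<equiv> Min (supp (V B x))"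
  shows "m \<in> E" "m \<noteq> x" "V B x m = -1" "m \<in> B \<longleftrightarrow> x \<notin> B" "V B x y \<noteq> 0 \<Longrightarrow> m \<le> y"
    "V B m x = 1"
proof -
  show 1: "V B x m = -1" using assms by (simp add: min_opposite_def)
  then show 2: "m \<in> E" "m \<noteq> x" using V_E[OF assms(1,2), of m] V_self[OF assms(1,2)] by auto
  show "m \<in> B \<longleftrightarrow> x \<notin> B" using V_side[OF assms(1,2), of m] 1 2 by auto
  show "m \<le> y" if "V B x y \<noteq> 0"
    using that V_supp_finite[OF assms(1,2)] by (simp add: m_def supp_def)
  show "V B m x = 1" using V_skew[OF assms(1,2) 2(1)] 1 2 by auto
qed

text \<open>\<open>m1 x\<close> is the smallest element of \<open>B1\<close> whose cocircuit
  contains \<open>x\<close>, so it gives the leading weight of \<open>v1\<close> at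
  \<open>x\<close>, and \<open>\<beta>1\<close> is the leading index over all of \<open>X\<close>.
  Orthogonality at \<open>\<beta>1\<close> makes \<open>X\<close> negative there; likewise
  \<open>X\<close> is positive at \<open>\<beta>2\<close>. The smaller of the two then belongs to
  the other basis as well, and its cocircuit there contradicts the choice of the larger one.\<close>

lemma no_separating_circuit:
  assumes B: "B1 \<in> Bs" "B2 \<in> Bs"
    and opp1: "\<And>x. x \<in> B2 - B1 \<Longrightarrow> min_opposite (V B1 x)"
    and opp2: "\<And>x. x \<in> B1 - B2 \<Longrightarrow> min_opposite (V B2 x)"
    and X: "X \<in> C" "supp X \<subseteq> B1 \<union> B2"
    and nonneg: "\<And>x. x \<in> B2 - B1 \<Longrightarrow> X x \<ge> 0" and nonpos: "\<And>x. x \<in> B1 - B2 \<Longrightarrow> X x \<le> 0"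
  shows False
proof -
  define m1 where "m1 x = Min (supp (V B1 x))" for x
  define m2 where "m2 x = Min (supp (V B2 x))" for x
  have sub: "B1 \<subseteq> E" "B2 \<subseteq> E" using B bases_sub by auto
  have m1: "m1 x \<in> B1" "V B1 (m1 x) x = 1" "\<And>y. V B1 x y \<noteq> 0 \<Longrightarrow> m1 x \<le> y"
    and m1_less: "m1 x < x" if "x \<in> B2 - B1" for x
    using V_min_opposite[OF B(1), of x] opp1[OF that] that sub V_self[OF B(1), of x]
    by (auto simp: m1_def less_le)
  have m2: "m2 x \<in> B2" "V B2 (m2 x) x = 1" "\<And>y. V B2 x y \<noteq> 0 \<Longrightarrow> m2 x \<le> y"
    and m2_less: "m2 x < x" if "x \<in> B1 - B2" for x
    using V_min_opposite[OF B(2), of x] opp2[OF that] that sub V_self[OF B(2), of x]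
    by (auto simp: m2_def less_le)
  define S1 where "S1 = {x \<in> B2 - B1. X x \<noteq> 0}"
  define S2 where "S2 = {x \<in> B1 - B2. X x \<noteq> 0}"
  have fin: "finite S1" "finite S2"
    by (rule finite_subset[OF _ finite_E], use sub in \<open>auto simp: S1_def S2_def\<close>)+
  have "S1 \<noteq> {}" using bases_independent[OF B(1) X(1)] X(2) by (auto simp: S1_def supp_def)
  have "S2 \<noteq> {}" using bases_independent[OF B(2) X(1)] X(2) by (auto simp: S2_def supp_def)
  define \<beta>1 where "\<beta>1 = Min (m1 ` S1)"
  define \<beta>2 where "\<beta>2 = Min (m2 ` S2)"
  have "\<beta>1 \<in> m1 ` S1" using fin \<open>S1 \<noteq> {}\<close> by (simp add: \<beta>1_def)
  then obtain x1 where x1: "x1 \<in> S1" "\<beta>1 = m1 x1" by blast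
  have "\<beta>2 \<in> m2 ` S2" using fin \<open>S2 \<noteq> {}\<close> by (simp add: \<beta>2_def)
  then obtain x2 where x2: "x2 \<in> S2" "\<beta>2 = m2 x2" by blast
  have \<beta>1_le: "\<beta>1 \<le> m1 x" if "x \<in> S1" for x using that fin by (simp add: \<beta>1_def)
  have \<beta>2_le: "\<beta>2 \<le> m2 x" if "x \<in> S2" for x using that fin by (simp add: \<beta>2_def)
  have \<beta>1: "\<beta>1 \<in> B1" "V B1 \<beta>1 x1 = 1" using x1 m1 by (auto simp: S1_def)
  have \<beta>2: "\<beta>2 \<in> B2" "V B2 \<beta>2 x2 = 1" using x2 m2 by (auto simp: S2_def)
  have neq: "x1 \<noteq> \<beta>1" "x2 \<noteq> \<beta>2" using \<beta>1 \<beta>2 x1 x2 by (auto simp: S1_def S2_def)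
  have y1: "y \<in> S1" if "V B1 b y \<noteq> 0" "X y \<noteq> 0" "y \<noteq> b" "b \<in> B1" for b y
    using that V_side[OF B(1), of b y] sub X(2) by (auto simp: S1_def supp_def)
  have y2: "y \<in> S2" if "V B2 b y \<noteq> 0" "X y \<noteq> 0" "y \<noteq> b" "b \<in> B2" for b y
    using that V_side[OF B(2), of b y] sub X(2) by (auto simp: S2_def supp_def)
  have adj1: "m1 y \<le> b" if "V B1 b y \<noteq> 0" "y \<in> S1" "b \<in> B1" for b y
    using that m1(3)[of y b] V_adj[OF B(1), of b y] sub by (auto simp: S1_def)
  have adj2: "m2 y \<le> b" if "V B2 b y \<noteq> 0" "y \<in> S2" "b \<in> B2" for b y
    using that m2(3)[of y b] V_adj[OF B(2), of b y] sub by (auto simp: S2_def)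
  \<comment> \<open>The other elements \<open>y\<close> of \<open>X\<close> on this cocircuit
    satisfy \<open>m1 y = \<beta>1\<close>. Their value on it is 1, and \<open>X\<close> is
    nonnegative on them.\<close>
  have neg: "X \<beta>1 < 0"
  proof (rule ccontr)
    assume "\<not> X \<beta>1 < 0"
    have "X y * V B1 \<beta>1 y \<ge> 0" for y
    proof (cases "X y = 0 \<or> V B1 \<beta>1 y = 0 \<or> y = \<beta>1")
      case True
      then show ?thesis using \<open>\<not> X \<beta>1 < 0\<close> V_self[OF B(1), of \<beta>1] \<beta>1 sub by auto
    next
      case False
      then have y: "y \<in> S1" using y1 \<beta>1 by blast
      then have "m1 y = \<beta>1" using adj1[of \<beta>1 y] \<beta>1_le[of y] False \<beta>1 by auto
      then show ?thesis using m1(2)[of y] y nonneg[of y] by (auto simp: S1_def)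
    qed
    moreover have "X x1 * V B1 \<beta>1 x1 \<noteq> 0" using \<beta>1 x1 by (auto simp: S1_def)
    ultimately show False
      using not_orthogonal[of X "V B1 \<beta>1" x1] orth[OF X(1) V_D[OF B(1) \<beta>1(1)]] by blast
  qed
  have pos: "X \<beta>2 > 0"
  proof (rule ccontr)
    assume "\<not> X \<beta>2 > 0"
    have "(- X) y * V B2 \<beta>2 y \<ge> 0" for y
    proof (cases "X y = 0 \<or> V B2 \<beta>2 y = 0 \<or> y = \<beta>2")
      case True
      then show ?thesis using \<open>\<not> X \<beta>2 > 0\<close> V_self[OF B(2), of \<beta>2] \<beta>2 sub by auto
    next
      case False
      then have y: "y \<in> S2" using y2 \<beta>2 by blast
      then have "m2 y = \<beta>2" using adj2[of \<beta>2 y] \<beta>2_le[of y] False \<beta>2 by auto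
      then show ?thesis using m2(2)[of y] y nonpos[of y] by (auto simp: S2_def)
    qed
    moreover have "(- X) x2 * V B2 \<beta>2 x2 \<noteq> 0" using \<beta>2 x2 by (auto simp: S2_def)
    ultimately show False
      using not_orthogonal[of "- X" "V B2 \<beta>2" x2] orth[OF C_uminus[OF X(1)] V_D[OF B(2) \<beta>2(1)]]
      by blast
  qed
  show False
  proof (cases "\<beta>1 < \<beta>2")
    case True
    \<comment> \<open>Otherwise \<open>\<beta>1\<close> would be in \<open>S2\<close>, and
      \<open>m2 \<beta>1 < \<beta>1\<close> would put \<open>\<beta>2\<close> below it.\<close>
    have "\<beta>1 \<in> B2"
    proof (rule ccontr)
      assume "\<beta>1 \<notin> B2"
      then have "\<beta>1 \<in> S2" using neg \<beta>1 by (auto simp: S2_def)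
      then show False using \<beta>2_le[of \<beta>1] m2_less[of \<beta>1] True by (auto simp: S2_def)
    qed
    moreover have "V B2 \<beta>1 \<beta>1 = 1" using \<beta>1 sub V_self[OF B(2)] by auto
    ultimately obtain y where y: "y \<noteq> \<beta>1" "X y \<noteq> 0" "V B2 \<beta>1 y \<noteq> 0"
      using orthogonal_other[OF orth[OF X(1) V_D[OF B(2)]], of \<beta>1 \<beta>1] neg by auto
    then have "y \<in> S2" using y2 \<open>\<beta>1 \<in> B2\<close> by blast
    then have "\<beta>2 \<le> \<beta>1" using adj2[OF y(3)] \<open>\<beta>1 \<in> B2\<close> \<beta>2_le order_trans by blast
    then show False using True by simp
  next
    case False
    then have less: "\<beta>2 < \<beta>1" using neg pos by (cases "\<beta>1 = \<beta>2") auto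
    have "\<beta>2 \<in> B1"
    proof (rule ccontr)
      assume "\<beta>2 \<notin> B1"
      then have "\<beta>2 \<in> S1" using pos \<beta>2 by (auto simp: S1_def)
      then show False using \<beta>1_le[of \<beta>2] m1_less[of \<beta>2] less by (auto simp: S1_def)
    qed
    moreover have "V B1 \<beta>2 \<beta>2 = 1" using \<beta>2 sub V_self[OF B(1)] by auto
    ultimately obtain y where y: "y \<noteq> \<beta>2" "X y \<noteq> 0" "V B1 \<beta>2 y \<noteq> 0"
      using orthogonal_other[OF orth[OF X(1) V_D[OF B(1)]], of \<beta>2 \<beta>2] pos by auto
    then have "y \<in> S1" using y1 \<open>\<beta>2 \<in> B1\<close> by blast
    then have "\<beta>1 \<le> \<beta>2" using adj1[OF y(3)] \<open>\<beta>2 \<in> B1\<close> \<beta>1_le order_trans by blast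
    then show False using less by simp
  qed
qed

lemma fully_optimal_unique:
  assumes B: "B1 \<in> Bs" "B2 \<in> Bs" and p: "p \<in> B1" "p \<in> B2"
    and opp1: "\<And>x. x \<in> E - {p} \<Longrightarrow> min_opposite (V B1 x)"
    and opp2: "\<And>x. x \<in> E - {p} \<Longrightarrow> min_opposite (V B2 x)"
  shows "B1 = B2"
proof (rule ccontr)
  assume "B1 \<noteq> B2"
  then obtain e where e: "e \<in> (B1 - B2) \<union> (B2 - B1)" by blast
  define S where "S = (B1 - B2) \<union> (B2 - B1)"
  define \<sigma> :: "'a \<Rightarrow> int" where "\<sigma> x = (if x \<in> B1 then -1 else 1)" for x
  have sub: "B1 \<subseteq> E" "B2 \<subseteq> E" using B bases_sub by auto
  have SE: "S \<subseteq> E - {p}" using sub p by (auto simp: S_def)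
  consider (C) X where "X \<in> C" "supp X \<subseteq> (B1 \<inter> B2) \<union> S" "\<forall>f\<in>S. \<sigma> f * X f \<ge> 0"
    | (D) Y where "Y \<in> D" "supp Y \<inter> (B1 \<inter> B2) = {}" "\<forall>f\<in>S. \<sigma> f * Y f \<ge> 0"
  proof -
    have "e \<in> S" "S \<subseteq> E" "B1 \<inter> B2 \<inter> S = {}" "\<And>f. \<sigma> f \<in> {-1, 1}"
      using e SE by (auto simp: S_def \<sigma>_def)
    from painting[of e S "B1 \<inter> B2" \<sigma>, OF this] show thesis using that by metis
  qed
  then show False
  proof cases
    case C
    show False
    proof (rule no_separating_circuit[OF B _ _ C(1)])
      show "X x \<ge> 0" if "x \<in> B2 - B1" for x using C(3) that by (force simp: S_def \<sigma>_def)
      show "X x \<le> 0" if "x \<in> B1 - B2" for x using C(3) that by (force simp: S_def \<sigma>_def)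
      show "min_opposite (V B1 x)" if "x \<in> B2 - B1" for x
        using that SE opp1[of x] by (auto simp: S_def)
      show "min_opposite (V B2 x)" if "x \<in> B1 - B2" for x
        using that SE opp2[of x] by (auto simp: S_def)
      show "supp X \<subseteq> B1 \<union> B2" using C(2) by (auto simp: S_def)
    qed
  next
    case D
    \<comment> \<open>Complementing both bases and exchanging their roles leaves the sign pattern on
      the symmetric difference unchanged.\<close>
    show False
    proof (rule ordered_dual_pair.no_separating_circuit[OF ordered_dual_pair_dual _ _ _ _ D(1)])
      show "E - B2 \<in> (\<lambda>B. E - B) ` Bs" "E - B1 \<in> (\<lambda>B. E - B) ` Bs" using B by auto
      show "Y x \<ge> 0" if "x \<in> (E - B1) - (E - B2)" for x
        using D(3) that by (force simp: S_def \<sigma>_def)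
      show "Y x \<le> 0" if "x \<in> (E - B2) - (E - B1)" for x
        using D(3) that by (force simp: S_def \<sigma>_def)
      show "supp Y \<subseteq> (E - B2) \<union> (E - B1)" using D(2) D_supp[OF D(1)] by blast
      show "min_opposite (fund_vec E D C (E - B2) x)" if "x \<in> (E - B1) - (E - B2)" for x
        using that opp2[of x] V_dual[OF B(2), of x] p by auto
      show "min_opposite (fund_vec E D C (E - B1) x)" if "x \<in> (E - B2) - (E - B1)" for x
        using that opp1[of x] V_dual[OF B(1), of x] p by auto
    qed
  qed
qed

end

section \<open>Cocircuits of an oriented matroid\<close>

abbreviation om_dual_pair :: "'a om \<Rightarrow> bool" where
  "om_dual_pair M \<equiv> dual_pair (ground M) (circuits M) (cocircuits M) (Collect (basis M))"

lemma independent_extend: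
  assumes "finite (ground M)" and "independent M I"
  shows "\<exists>B. basis M B \<and> I \<subseteq> B"
proof -
  have "finite {J. independent M J}"
    by (rule finite_subset[of _ "Pow (ground M)"]) (auto simp: independent_def assms(1))
  then obtain B where "independent M B" "I \<subseteq> B" "\<And>J. independent M J \<Longrightarrow> B \<subseteq> J \<Longrightarrow> B = J"
    using finite_has_maximal2[of "{J. independent M J}" I] assms(2) by auto
  then show ?thesis unfolding basis_def by blast
qed

text \<open>Orthogonality is part of the definition of \<open>cocircuits\<close>, and extension
  follows from finiteness. Fundamental vectors and exchange are what has to be supplied each time:
  for \<open>M\<close>, for its dual and for its minors.\<close>

lemma om_dual_pairI:
  assumes fin: "finite (ground M)"
    and C: "\<And>X e. X \<in> circuits M \<Longrightarrow> X e \<in> {-1, 0, 1}" "\<And>X. X \<in> circuits M \<Longrightarrow> supp X \<subseteq> ground M"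
      "\<And>X. X \<in> circuits M \<Longrightarrow> supp X \<noteq> {}" "\<And>X. X \<in> circuits M \<Longrightarrow> - X \<in> circuits M"
    and fund_C: "\<And>B e. basis M B \<Longrightarrow> e \<in> ground M - B \<Longrightarrow> \<exists>X\<in>circuits M. supp X \<subseteq> insert e B \<and> X e = 1"
    and fund_D: "\<And>B b. basis M B \<Longrightarrow> b \<in> B \<Longrightarrow>
      \<exists>Y\<in>cocircuits M. supp Y \<subseteq> insert b (ground M - B) \<and> Y b = 1"
    and exchange: "\<And>B e b X. basis M B \<Longrightarrow> e \<in> ground M - B \<Longrightarrow> b \<in> B \<Longrightarrow> X \<in> circuits M \<Longrightarrow>
      supp X \<subseteq> insert e B \<Longrightarrow> X b \<noteq> 0 \<Longrightarrow> basis M (insert e (B - {b}))"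
  shows "om_dual_pair M"
proof
  show sgn: "Y e \<in> {-1, 0, 1}" if "Y \<in> cocircuits M" for Y e
    using that by (auto simp: cocircuits_def)
  show "- Y \<in> cocircuits M" if Y: "Y \<in> cocircuits M" for Y
  proof -
    have "orthogonal X (- Y)" if "orthogonal X Y" for X :: "'a signed_set"
      using that unfolding orthogonal_def by (auto simp: less_imp_neq)
    moreover have "(- Y) e \<in> {-1, 0, 1}" for e using sgn[OF Y, of e] by auto
    ultimately show ?thesis using Y by (auto simp: cocircuits_def)
  qed
  have "\<exists>B. basis M B"
    using independent_extend[OF fin, of "{}"] C(3) by (auto simp: independent_def)
  then show "supp Y \<noteq> {}" if "Y \<in> cocircuits M" for Y
    using that by (auto simp: cocircuits_def meets_bases_def)
  show "supp Y \<subseteq> ground M" if "Y \<in> cocircuits M" for Y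
    using that by (auto simp: cocircuits_def meets_bases_def)
  show "orthogonal X Y" if "X \<in> circuits M" "Y \<in> cocircuits M" for X Y
    using that by (auto simp: cocircuits_def)
  show "\<exists>B\<in>Collect (basis M). I \<subseteq> B"
    if "I \<subseteq> ground M" "\<And>X. X \<in> circuits M \<Longrightarrow> \<not> supp X \<subseteq> I" for I
    using independent_extend[OF fin, of I] that by (auto simp: independent_def)
  show "B \<subseteq> ground M" if "B \<in> Collect (basis M)" for B
    using that by (simp add: basis_def independent_def)
qed (fact fin C | use fund_C fund_D exchange in simp)+

lemma supp_subD: "supp X \<subseteq> A \<Longrightarrow> X e \<noteq> 0 \<Longrightarrow> e \<in> A"
  by (auto simp: supp_def)

text \<open>Minimality: whichever element \<open>d\<close> is removed, a basis avoids the rest,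
  namely \<open>B\<close> for \<open>d = b\<close> and \<open>insert d (B - {b})\<close>
  otherwise.\<close>

lemma om_dual_pair_cocircuitI:
  assumes B: "basis M B" "b \<in> B" and Y: "\<And>e. Y e \<in> {-1, 0, 1}"
    and sub: "supp Y \<subseteq> insert b (ground M - B)"
    and adj: "\<And>e. e \<in> supp Y \<Longrightarrow> e \<noteq> b \<Longrightarrow> basis M (insert e (B - {b}))"
    and meets: "meets_bases M (supp Y)" and orth: "\<And>X. X \<in> circuits M \<Longrightarrow> orthogonal X Y"
  shows "Y \<in> cocircuits M"
  unfolding cocircuits_def
proof (intro CollectI conjI allI impI ballI)
  show "D = supp Y" if D: "meets_bases M D \<and> D \<subseteq> supp Y" for D
  proof (rule ccontr)
    assume "D \<noteq> supp Y"
    then obtain d where d: "d \<in> supp Y" "d \<notin> D" using D by blast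
    have DB: "D \<inter> B \<subseteq> {b}" using D sub by blast
    show False
    proof (cases "d = b")
      case True
      then have "D \<inter> B = {}" using DB d by blast
      then show False using D B(1) unfolding meets_bases_def by blast
    next
      case False
      then have "basis M (insert d (B - {b}))" using adj d by blast
      moreover have "D \<inter> insert d (B - {b}) = {}" using DB d by blast
      ultimately show False using D unfolding meets_bases_def by blast
    qed
  qed
qed (use Y meets orth in auto)

section \<open>From the circuit axioms to fundamental circuits and cocircuits\<close>

context oriented_matroid
begin

lemma circuit_finite: "X \<in> circuits M \<Longrightarrow> finite (supp X)"
  using supp_subset finite_ground finite_subset by blast

lemma basis_sub: "basis M B \<Longrightarrow> B \<subseteq> ground M"
  by (simp add: basis_def independent_def)

lemma basis_independent: "basis M B \<Longrightarrow> X \<in> circuits M \<Longrightarrow> \<not> supp X \<subseteq> B"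
  by (simp add: basis_def independent_def)

lemma uminus_uminus_signed: "- (- X) = (X :: 'a signed_set)"
  by (rule ext) simp

text \<open>The sign factor selects whichever of \<open>Y\<close> and \<open>- Y\<close> is opposite
  to \<open>X\<close> at \<open>e\<close>, so weak elimination applies to any two circuits through
  \<open>e\<close> that differ up to sign.\<close>

lemma eliminate:
  assumes X: "X \<in> circuits M" and Y: "Y \<in> circuits M" and ne: "X \<noteq> Y" "X \<noteq> - Y"
    and e: "X e \<noteq> 0" "Y e \<noteq> 0"
  shows "\<exists>Z\<in>circuits M. Z e = 0 \<and>
    (\<forall>f. Z f \<noteq> 0 \<longrightarrow> Z f = X f \<or> Z f = - (X e * Y e) * Y f) \<and>
    supp Z \<subseteq> supp X \<union> supp Y - {e}"
proof -
  define Y' where "Y' = (\<lambda>f. - (X e * Y e) * Y f)"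
  have sgn: "X e = 1 \<or> X e = -1" "Y e = 1 \<or> Y e = -1"
    using e signs[OF X, of e] signs[OF Y, of e] by auto
  then have Y': "Y' = Y \<or> Y' = - Y" by (auto simp: Y'_def fun_eq_iff)
  then have Y'c: "Y' \<in> circuits M" using Y symmetric by auto
  have neg: "X \<noteq> - Y'" using Y' ne uminus_uminus_signed by metis
  then have neg': "Y' \<noteq> - X" using uminus_uminus_signed by metis
  have Y'e: "Y' e = - X e" using sgn by (auto simp: Y'_def)
  have "\<exists>Z\<in>circuits M. Z e = 0 \<and>
      (\<forall>f. Z f = 1 \<longrightarrow> X f = 1 \<or> Y' f = 1) \<and> (\<forall>f. Z f = -1 \<longrightarrow> X f = -1 \<or> Y' f = -1)"
  proof (cases "X e = 1")
    case True
    then show ?thesis using elimination[OF X Y'c neg, of e] Y'e by simp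
  next
    case False
    then have "Y' e = 1" "X e = -1" using sgn Y'e by auto
    from elimination[OF Y'c X neg' this] show ?thesis by blast
  qed
  then obtain Z where Z: "Z \<in> circuits M" "Z e = 0"
    "\<forall>f. Z f = 1 \<longrightarrow> X f = 1 \<or> Y' f = 1" "\<forall>f. Z f = -1 \<longrightarrow> X f = -1 \<or> Y' f = -1"
    by blast
  have 1: "Z f = X f \<or> Z f = Y' f" if "Z f \<noteq> 0" for f
    using Z(3,4)[rule_format, of f] signs[OF Z(1), of f] that by auto
  have "supp Z \<subseteq> supp X \<union> supp Y - {e}"
  proof
    fix f assume "f \<in> supp Z"
    then have f: "Z f \<noteq> 0" by (simp add: supp_def)
    then have "X f \<noteq> 0 \<or> Y f \<noteq> 0" using 1[OF f] by (auto simp: Y'_def)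
    then show "f \<in> supp X \<union> supp Y - {e}" using f Z(2) by (auto simp: supp_def)
  qed
  then show ?thesis using Z(1,2) 1 unfolding Y'_def by blast
qed

lemma eliminate_supp:
  assumes "X \<in> circuits M" "Y \<in> circuits M" "supp X \<noteq> supp Y" "X e \<noteq> 0" "Y e \<noteq> 0"
  shows "\<exists>Z\<in>circuits M. Z e = 0 \<and>
    (\<forall>f. Z f \<noteq> 0 \<longrightarrow> Z f = X f \<or> Z f = - (X e * Y e) * Y f) \<and>
    supp Z \<subseteq> supp X \<union> supp Y - {e}"
proof -
  have "X \<noteq> Y" "X \<noteq> - Y" using assms(3) by auto
  from eliminate[OF assms(1,2) this assms(4,5)] show ?thesis .
qed

lemma circuit_in_unique:
  assumes "basis M B" "X \<in> circuits M" "Y \<in> circuits M"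
    "supp X \<subseteq> insert e B" "supp Y \<subseteq> insert e B" "X e = Y e"
  shows "X = Y"
proof (rule ccontr)
  assume ne: "X \<noteq> Y"
  have Xe: "X e \<noteq> 0" using basis_independent[OF assms(1,2)] assms(4) by (auto simp: supp_def)
  have ne': "X \<noteq> - Y" using Xe assms(6) by auto
  have Ye: "Y e \<noteq> 0" using Xe assms(6) by simp
  from eliminate[OF assms(2,3) ne ne' Xe Ye]
  obtain Z where Z: "Z \<in> circuits M" "supp Z \<subseteq> supp X \<union> supp Y - {e}" by blast
  then have "supp Z \<subseteq> B" using assms(4,5) by blast
  then show False using basis_independent[OF assms(1) Z(1)] by blast
qed

lemma fund_circuit_ex:
  assumes "basis M B" "e \<in> ground M - B"
  shows "\<exists>X\<in>circuits M. supp X \<subseteq> insert e B \<and> X e = 1"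
proof -
  have "\<not> independent M (insert e B)" using assms unfolding basis_def by blast
  then obtain X where X: "X \<in> circuits M" "supp X \<subseteq> insert e B"
    using assms basis_sub by (auto simp: independent_def)
  then have "X e \<noteq> 0" using basis_independent[OF assms(1)] by (auto simp: supp_def)
  then have "X e = 1 \<or> (- X) e = 1" using signs[OF X(1), of e] by auto
  then show ?thesis using X symmetric by (metis supp_uminus)
qed

lemma fund_circuit:
  assumes "basis M B" "e \<in> ground M - B"
  shows "fund_circuit M B e \<in> circuits M" "supp (fund_circuit M B e) \<subseteq> insert e B"
    "fund_circuit M B e e = 1"
proof -
  obtain X where X: "X \<in> circuits M \<and> supp X \<subseteq> insert e B \<and> X e = 1"
    using fund_circuit_ex[OF assms] by blast
  have "fund_circuit M B e = X"
    unfolding fund_circuit_def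
  proof (rule the_equality)
    show "X' = X" if "X' \<in> circuits M \<and> supp X' \<subseteq> insert e B \<and> X' e = 1" for X'
      using that X circuit_in_unique[OF assms(1), of X' X e] by simp
  qed (rule X)
  then show "fund_circuit M B e \<in> circuits M" "supp (fund_circuit M B e) \<subseteq> insert e B"
    "fund_circuit M B e e = 1" using X by auto
qed

lemma fund_circuit_eq:
  assumes "basis M B" "e \<in> ground M - B" "X \<in> circuits M" "supp X \<subseteq> insert e B"
  shows "X e \<noteq> 0" "X = (if X e = 1 then fund_circuit M B e else - fund_circuit M B e)"
    "X f = X e * fund_circuit M B e f"
proof -
  show 1: "X e \<noteq> 0" using basis_independent[OF assms(1,3)] assms(4) by (auto simp: supp_def)
  show 2: "X = (if X e = 1 then fund_circuit M B e else - fund_circuit M B e)"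
  proof (cases "X e = 1")
    case True
    then show ?thesis
      using circuit_in_unique[OF assms(1,3) fund_circuit(1)[OF assms(1,2)] assms(4)]
        fund_circuit[OF assms(1,2)] by simp
  next
    case False
    then have "X e = -1" using 1 signs[OF assms(3), of e] by auto
    then show ?thesis
      using circuit_in_unique[OF assms(1,3) symmetric[OF fund_circuit(1)[OF assms(1,2)]] assms(4)]
        fund_circuit[OF assms(1,2)] by simp
  qed
  show "X f = X e * fund_circuit M B e f"
    using 1 2 signs[OF assms(3), of e] by (auto split: if_splits)
qed

text \<open>A circuit in the new set would be the fundamental circuit of \<open>e\<close> up to
  sign, but that one contains \<open>b\<close>. For maximality, \<open>b\<close> is eliminated from
  the fundamental circuit of \<open>f\<close> by means of that of \<open>e\<close>.\<close>

lemma basis_exchange: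
  assumes "basis M B" "e \<in> ground M - B" "b \<in> B" "fund_circuit M B e b \<noteq> 0"
  shows "basis M (insert e (B - {b}))"
proof -
  define F where "F = fund_circuit M B e"
  have F: "F \<in> circuits M" "supp F \<subseteq> insert e B" "F e = 1"
    using fund_circuit[OF assms(1,2)] by (auto simp: F_def)
  have "\<not> supp X \<subseteq> insert e (B - {b})" if X: "X \<in> circuits M" for X
  proof
    assume sub: "supp X \<subseteq> insert e (B - {b})"
    then have "supp X \<subseteq> insert e B" by blast
    from fund_circuit_eq(1)[OF assms(1,2) X this] fund_circuit_eq(3)[OF assms(1,2) X this, of b]
    have "X b \<noteq> 0" using assms(4) by simp
    then show False using sub assms(2,3) by (auto simp: supp_def)
  qed
  then have ind: "independent M (insert e (B - {b}))"
    using assms basis_sub[OF assms(1)] by (auto simp: independent_def)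
  have "\<exists>X\<in>circuits M. supp X \<subseteq> insert f (insert e (B - {b}))"
    if f: "f \<in> ground M - insert e (B - {b})" for f
  proof (cases "f = b")
    case True
    then show ?thesis using F by blast
  next
    case False
    then have fB: "f \<in> ground M - B" using f by blast
    define G where "G = fund_circuit M B f"
    have G: "G \<in> circuits M" "supp G \<subseteq> insert f B" "G f = 1"
      using fund_circuit[OF assms(1) fB] by (auto simp: G_def)
    show ?thesis
    proof (cases "G b = 0")
      case True
      then have "supp G \<subseteq> insert f (insert e (B - {b}))" using G(2) by (auto simp: supp_def)
      then show ?thesis using G by blast
    next
      case nz: False
      have "f \<notin> supp F" using F f False by (auto simp: supp_def)
      then have ne: "supp G \<noteq> supp F" using G by (auto simp: supp_def)
      have Fb: "F b \<noteq> 0" using assms(4) by (simp add: F_def)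
      obtain Z where Z: "Z \<in> circuits M" "supp Z \<subseteq> supp G \<union> supp F - {b}"
        using eliminate_supp[OF G(1) F(1) ne nz Fb] by blast
      then have "supp Z \<subseteq> insert f (insert e (B - {b}))" using F(2) G(2) by blast
      then show ?thesis using Z by blast
    qed
  qed
  then have dep: "\<not> independent M (insert f (insert e (B - {b})))"
    if "f \<in> ground M - insert e (B - {b})" for f
    using that unfolding independent_def by blast
  show ?thesis
    unfolding basis_def
  proof (intro conjI allI impI)
    fix I assume I: "independent M I \<and> insert e (B - {b}) \<subseteq> I"
    show "I = insert e (B - {b})"
    proof (rule ccontr)
      assume "I \<noteq> insert e (B - {b})"
      then obtain f where f: "f \<in> I" "f \<notin> insert e (B - {b})" using I by blast
      have "independent M (insert f (insert e (B - {b})))"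
        using I f unfolding independent_def by blast
      then show False using dep[of f] f I by (auto simp: independent_def)
    qed
  qed (rule ind)
qed

text \<open>The only candidate for the fundamental cocircuit of \<open>b\<close>: orthogonality to
  the fundamental circuit of \<open>e\<close> forces the entry at each \<open>e\<close> outside
  \<open>B\<close>.\<close>

definition cocirc :: "'a set \<Rightarrow> 'a \<Rightarrow> 'a signed_set" where
  "cocirc B b e =
     (if e = b then 1 else if e \<in> ground M - B then - fund_circuit M B e b else 0)"

lemma cocirc_sign: "basis M B \<Longrightarrow> cocirc B b e \<in> {-1, 0, 1}"
  using signs[OF fund_circuit(1), of B e b] by (auto simp: cocirc_def)

lemma orthogonal_neg:
  assumes "X e * Y e \<noteq> 0" "X e * Y e = - (X f * Y f)"
  shows "orthogonal X Y"
  using assms unfolding orthogonal_def by (metis linorder_neqE neg_0_less_iff_less neg_less_0_iff_less)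

text \<open>Eliminating \<open>e\<close> between \<open>X\<close> and the fundamental circuit of
  \<open>e\<close> leaves a multiple of the fundamental circuit of \<open>f\<close>. If
  \<open>v\<close> is its value at \<open>b\<close>, then the product at \<open>f\<close> is
  \<open>- v\<close>, while \<open>v\<close> is the product at \<open>b\<close> or at
  \<open>e\<close>.\<close>

lemma cocirc_orthogonal_two:
  assumes B: "basis M B" "b \<in> B" and X: "X \<in> circuits M"
    and ef: "supp X - B = {e, f}" "e \<noteq> f" and f: "cocirc B b f \<noteq> 0"
  shows "orthogonal X (cocirc B b)"
proof -
  define Y where "Y = cocirc B b"
  have eB: "e \<in> ground M - B" and fB: "f \<in> ground M - B" using ef supp_subset[OF X] by auto
  have Xe: "X e \<noteq> 0" and Xf: "X f \<noteq> 0" using ef by (auto simp: supp_def)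
  define F where "F = fund_circuit M B e"
  have F: "F \<in> circuits M" "supp F \<subseteq> insert e B" "F e = 1"
    using fund_circuit[OF B(1) eB] by (auto simp: F_def)
  have Ff: "F f = 0" using F(2) fB ef(2) by (auto simp: supp_def)
  have ne: "supp X \<noteq> supp F" using Xf Ff by (auto simp: supp_def)
  have Fe: "F e \<noteq> 0" using F by simp
  obtain Z where Z: "Z \<in> circuits M" "supp Z \<subseteq> supp X \<union> supp F - {e}"
    "\<And>g. Z g \<noteq> 0 \<Longrightarrow> Z g = X g \<or> Z g = - (X e * F e) * F g"
    using eliminate_supp[OF X F(1) ne Xe Fe] by metis
  have Zsub: "supp Z \<subseteq> insert f B" using Z(2) F(2) ef by blast
  have Zf: "Z f \<noteq> 0" "Z b = Z f * fund_circuit M B f b"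
    by (rule fund_circuit_eq[OF B(1) fB Z(1) Zsub])+
  have "Z f = X f" using Z(3)[OF Zf(1)] Ff Zf(1) by auto
  moreover have Yf: "Y f = - fund_circuit M B f b" using fB B by (auto simp: Y_def cocirc_def)
  ultimately have Zb: "Z b = - (X f * Y f)" using Zf by simp
  have Yb: "Y b = 1" by (simp add: Y_def cocirc_def)
  have Ye: "Y e = - F b" using eB B by (auto simp: Y_def cocirc_def F_def)
  have nz: "X f * Y f \<noteq> 0" using Xf f by (simp add: Y_def)
  then have "Z b = X b \<or> Z b = - X e * F b" using Z(3)[of b] Zb F(3) by simp
  then have "X f * Y f = - (X b * Y b) \<or> X f * Y f = - (X e * Y e)"
    using Zb Yb Ye by auto
  then show ?thesis using orthogonal_neg[of X f Y] nz unfolding Y_def by blast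
qed

text \<open>Induction on the number of elements of \<open>X\<close> outside the basis, for all bases
  at once, because a pivot can lower this number. A single element is settled by the definition of
  \<open>cocirc\<close>. From three elements on, either a suitable zero of \<open>X\<close> or
  \<open>Y\<close> permits a pivot, or an elimination reduces \<open>X\<close>.\<close>

lemma cocirc_orthogonal:
  assumes "basis M B" "b \<in> B" "X \<in> circuits M"
  shows "orthogonal X (cocirc B b)"
  using assms
proof (induction "card (supp X - B)" arbitrary: B b X rule: less_induct)
  case less
  note B = less.prems(1,2) and X = less.prems(3)
  define Y where "Y = cocirc B b"
  have Yb: "Y b = 1" by (simp add: Y_def cocirc_def)
  have Ye: "Y e = - fund_circuit M B e b" if "e \<in> ground M - B" for e
    using that B by (auto simp: Y_def cocirc_def)
  have Y0: "Y g = 0" if "g \<in> B - {b}" for g using that by (auto simp: Y_def cocirc_def)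
  have Ysign: "Y g \<in> {-1, 0, 1}" for g using cocirc_sign B by (auto simp: Y_def)
  have fin: "finite (supp X - B)" using circuit_finite[OF X] by simp
  have XE: "supp X \<subseteq> ground M" using supp_subset[OF X] .
  \<comment> \<open>By incomparability a fundamental circuit inside \<open>X\<close> would have the
    same support. The element \<open>b'\<close> serves as pivot: exchanging it with \<open>e\<close>
    removes \<open>e\<close> from \<open>supp X - B\<close> and adds nothing.\<close>
  have outside: "\<exists>b'\<in>B. fund_circuit M B e b' \<noteq> 0 \<and> X b' = 0"
    if e: "e \<in> supp X - B" and n: "supp X - B \<noteq> {e}" for e
  proof (rule ccontr)
    assume no: "\<not> ?thesis"
    define F where "F = fund_circuit M B e"
    have eB: "e \<in> ground M - B" using e XE by auto
    have F: "F \<in> circuits M" "supp F \<subseteq> insert e B" using fund_circuit[OF B(1) eB] by (auto simp: F_def)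
    have "supp F \<subseteq> supp X" using no F(2) e by (auto simp: F_def supp_def)
    then have "supp F = supp X" using incomparable[OF F(1) X] by auto
    then show False using n F(2) e by blast
  qed
  have "card (supp X - B) \<noteq> 0" using basis_independent[OF B(1) X] fin by auto
  then consider "card (supp X - B) = 1" | "card (supp X - B) = 2" | "card (supp X - B) \<ge> 3"
    by linarith
  then have "orthogonal X Y"
  proof cases
    case 1
    then obtain e where e: "supp X - B = {e}" using card_1_singletonE by blast
    then have eB: "e \<in> ground M - B" and sub: "supp X \<subseteq> insert e B" using XE by auto
    have Xf: "X f = X e * fund_circuit M B e f" for f
      using fund_circuit_eq(3)[OF B(1) eB X sub] .
    show ?thesis
    proof (cases "Y e = 0")
      case True
      have "X g * Y g = 0" for g
        using True Y0[of g] Xf[of b] Ye[OF eB] sub by (cases "g = b") (auto simp: supp_def)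
      then show ?thesis by (simp add: orthogonal_def)
    next
      case False
      have "X e \<noteq> 0" using e by (auto simp: supp_def)
      then show ?thesis
        using False Xf[of b] Ye[OF eB] Yb by (intro orthogonal_neg[of X e Y b]) auto
    qed
  next
    case 2
    then obtain e f where ef: "supp X - B = {e, f}" "e \<noteq> f" by (meson card_2_iff)
    have eB: "e \<in> ground M - B" and fB: "f \<in> ground M - B" using ef XE by auto
    show ?thesis
    proof (cases "Y e = 0 \<and> Y f = 0")
      case False
      then show ?thesis
        using cocirc_orthogonal_two[OF B X, of e f] cocirc_orthogonal_two[OF B X, of f e] ef
        unfolding Y_def by (metis insert_commute)
    next
      case True
      \<comment> \<open>Both entries of \<open>Y\<close> vanish, so it remains to get
        \<open>X b = 0\<close>. After the pivot, \<open>X\<close> and a circuit \<open>Z\<close>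
        that vanishes at \<open>b\<close> are multiples of one fundamental circuit.\<close>
      define F where "F = fund_circuit M B e"
      define G where "G = fund_circuit M B f"
      have F: "F \<in> circuits M" "supp F \<subseteq> insert e B" "F e = 1" "F b = 0"
        using fund_circuit[OF B(1) eB] True Ye[OF eB] by (auto simp: F_def)
      have G: "G \<in> circuits M" "supp G \<subseteq> insert f B" "G f = 1" "G b = 0"
        using fund_circuit[OF B(1) fB] True Ye[OF fB] by (auto simp: G_def)
      have Ff: "F f = 0" using F(2) ef(2) fB by (auto simp: supp_def)
      obtain b' where b': "b' \<in> B" "F b' \<noteq> 0" "X b' = 0"
        using outside[of e] ef unfolding F_def by auto
      have B1: "basis M (insert e (B - {b'}))"
        using basis_exchange[OF B(1) eB b'(1)] b'(2) by (simp add: F_def)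
      have f1: "f \<in> ground M - insert e (B - {b'})" using fB ef(2) by auto
      have Xsub: "supp X \<subseteq> insert f (insert e (B - {b'}))"
        using ef b'(3) by (auto simp: supp_def)
      have "\<exists>Z\<in>circuits M. supp Z \<subseteq> insert f (insert e (B - {b'})) \<and> Z b = 0"
      proof (cases "G b' = 0")
        case True
        then have "supp G \<subseteq> insert f (insert e (B - {b'}))" using G(2) by (auto simp: supp_def)
        then show ?thesis using G by blast
      next
        case nz: False
        have "f \<in> supp G" "f \<notin> supp F" using G(3) Ff by (simp_all add: supp_def)
        then have ne: "supp G \<noteq> supp F" by blast
        obtain Z where Z: "Z \<in> circuits M" "supp Z \<subseteq> supp G \<union> supp F - {b'}"
          using eliminate_supp[OF G(1) F(1) ne nz b'(2)] by blast
        have "supp Z \<subseteq> insert f (insert e (B - {b'}))" using Z(2) F(2) G(2) by blast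
        moreover have "Z b = 0" using Z(2) F(4) G(4) by (auto simp: supp_def)
        ultimately show ?thesis using Z by blast
      qed
      then obtain Z where Z: "Z \<in> circuits M" "supp Z \<subseteq> insert f (insert e (B - {b'}))" "Z b = 0"
        by blast
      have "X b = 0"
        using fund_circuit_eq(1,3)[OF B1 f1 Z(1,2)] fund_circuit_eq(3)[OF B1 f1 X Xsub] Z(3)
        by (metis mult_eq_0_iff)
      have "X g * Y g = 0" for g
      proof -
        consider "g = e \<or> g = f" | "g \<in> B - {b}" | "g = b" | "X g = 0"
          using ef(1) by (auto simp: supp_def)
        then show ?thesis using True Y0[of g] \<open>X b = 0\<close> by cases auto
      qed
      then show ?thesis by (simp add: orthogonal_def)
    qed
  next
    case 3
    have small: "orthogonal Z Y" if "Z \<in> circuits M" "card (supp Z - B) < card (supp X - B)" for Z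
      using less.hyps[OF that(2) B that(1)] by (simp add: Y_def)
    have smaller: "card (supp X - insert e (B - {b'})) < card (supp X - B)"
      if "e \<in> supp X - B" "X b' = 0" for e b'
    proof -
      have "supp X - insert e (B - {b'}) = (supp X - B) - {e}" using that by (auto simp: supp_def)
      then show ?thesis using that fin card_Diff1_less by metis
    qed
    have not_single: "supp X - B \<noteq> {e}" for e using 3 by auto
    text \<open>The signed set \<open>Y\<close> is, up to sign, a fundamental cocircuit of each adjacent basis that
      spans the same hyperplane.\<close>
    have same: "cocirc (insert e (B - {b'})) c g = Y c * Y g"
      if e: "e \<in> supp X - B" and b': "b' \<in> B" "fund_circuit M B e b' \<noteq> 0"
        and c: "(c = b \<and> b' \<noteq> b \<and> Y e = 0) \<or> (c = e \<and> b' = b)" for e b' c g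
    proof -
      define B1 where "B1 = insert e (B - {b'})"
      have eB: "e \<in> ground M - B" using e XE by auto
      have B1: "basis M B1" using basis_exchange[OF B(1) eB b'] by (simp add: B1_def)
      have cB1: "c \<in> B1" using c B(2) by (auto simp: B1_def)
      have Yc: "Y c \<noteq> 0" using c Yb Ye[OF eB] b' by auto
      have Yc2: "Y c * Y c = 1" using Yc Ysign[of c] by auto
      have Y1: "Y h = 0" if "h \<in> B1 - {c}" for h using that c Y0[of h] by (auto simp: B1_def)
      consider "g = c" | "g \<in> ground M - B1" | "g \<in> B1 - {c}" | "g \<notin> ground M" by blast
      then have "cocirc B1 c g = Y c * Y g"
      proof cases
        case 2
        define G where "G = fund_circuit M B1 g"
        have G: "G \<in> circuits M" "supp G \<subseteq> insert g B1" "G g = 1"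
          using fund_circuit[OF B1 2] by (auto simp: G_def)
        have "supp G - B \<subseteq> {g, e}" using G(2) by (auto simp: B1_def)
        then have "card (supp G - B) \<le> card {g, e}" by (intro card_mono) auto
        also have "\<dots> \<le> 2" by (simp add: card_insert_if)
        finally have "card (supp G - B) \<le> 2" .
        then have orth: "orthogonal G Y" using small[OF G(1)] 3 by linarith
        have gc: "g \<noteq> c" using 2 cB1 by auto
        have "G g * Y g = - (G c * Y c)"
        proof (rule orthogonal_pair[OF orth gc])
          show "G h = 0 \<or> Y h = 0" if "h \<noteq> g" "h \<noteq> c" for h
            using that G(2) Y1[of h] by (auto simp: supp_def)
        qed (use signs[OF G(1)] Ysign in auto)
        then have "Y g * Y c = - G c * (Y c * Y c)" using G(3) by (simp add: algebra_simps)
        then have "Y g * Y c = - G c" using Yc2 by simp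
        then show ?thesis using 2 cB1 gc by (auto simp: cocirc_def G_def mult.commute)
      next
        case 3
        then show ?thesis using Y1[of g] by (auto simp: cocirc_def)
      next
        case 4
        then have "g \<noteq> c" using cB1 basis_sub[OF B1] by auto
        moreover have "Y g = 0"
          using 4 B basis_sub[OF B(1)] by (auto simp: Y_def cocirc_def)
        ultimately show ?thesis using 4 by (auto simp: cocirc_def)
      qed (use Yc2 in \<open>auto simp: cocirc_def\<close>)
      then show ?thesis by (simp add: B1_def)
    qed
    \<comment> \<open>The pivot lowers the number of elements of \<open>X\<close> outside the basis,
      while \<open>Y\<close> remains, up to sign, a fundamental cocircuit, now of
      \<open>c\<close>.\<close>
    have via: "orthogonal X Y"
      if e: "e \<in> supp X - B" and b': "b' \<in> B" "fund_circuit M B e b' \<noteq> 0" "X b' = 0"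
        and c: "(c = b \<and> b' \<noteq> b \<and> Y e = 0) \<or> (c = e \<and> b' = b)" for e b' c
    proof -
      have eB: "e \<in> ground M - B" using e XE by auto
      have B1: "basis M (insert e (B - {b'}))" using basis_exchange[OF B(1) eB b'(1,2)] .
      have "c \<in> insert e (B - {b'})" using c B(2) by auto
      then have "orthogonal X (cocirc (insert e (B - {b'})) c)"
        using less.hyps[OF smaller[OF e b'(3)] B1 _ X] by blast
      moreover have "cocirc (insert e (B - {b'})) c = (\<lambda>g. Y c * Y g)"
        using same[OF e b'(1,2) c] by blast
      ultimately have o: "orthogonal X (\<lambda>g. Y c * Y g)" by simp
      have "Y c \<noteq> 0" using c Yb Ye[OF eB] b' by auto
      then have "Y c = 1 \<or> Y c = -1" using Ysign[of c] by auto
      then show ?thesis using o by (auto simp: orthogonal_def)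
    qed
    obtain e where e: "e \<in> supp X - B" using 3 by (metis card.empty ex_in_conv not_numeral_le_zero)
    have eB: "e \<in> ground M - B" using e XE by auto
    show ?thesis
    proof (cases "(\<exists>e\<in>supp X - B. Y e = 0) \<or> X b = 0")
      case True
      then show ?thesis
      proof
        assume "\<exists>e\<in>supp X - B. Y e = 0"
        then obtain e where e: "e \<in> supp X - B" "Y e = 0" by blast
        obtain b' where b': "b' \<in> B" "fund_circuit M B e b' \<noteq> 0" "X b' = 0"
          using outside[OF e(1) not_single] by blast
        have "b' \<noteq> b" using b'(2) Ye[of e] e XE by auto
        then show ?thesis using via[OF e(1) b'] e(2) by blast
      next
        assume Xb: "X b = 0"
        show ?thesis
        proof (cases "fund_circuit M B e b = 0")
          case True
          then have "Y e = 0" using Ye[OF eB] by simp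
          obtain b' where b': "b' \<in> B" "fund_circuit M B e b' \<noteq> 0" "X b' = 0"
            using outside[OF e not_single] by blast
          then show ?thesis using via[OF e b'] True \<open>Y e = 0\<close> by blast
        next
          case False
          then show ?thesis using via[OF e B(2) False Xb] by blast
        qed
      qed
    next
      case False
      show ?thesis
      proof (rule ccontr)
        assume not: "\<not> orthogonal X Y"
        \<comment> \<open>If orthogonality fails, no two products have opposite signs. Elimination
          of \<open>e\<close> preserves this: outside \<open>B\<close> the values of
          \<open>Z\<close> are those of \<open>X\<close>, and a value taken from \<open>F\<close> at
          \<open>b\<close> yields the product \<open>X e * Y e\<close>. Induction applies to
          \<open>Z\<close>.\<close>
        obtain \<tau> :: int where \<tau>: "\<tau> = 1 \<or> \<tau> = -1" "\<And>g. \<tau> * X g * Y g \<ge> 0"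
        proof (cases "\<exists>g. X g * Y g > 0")
          case True
          then have "\<forall>g. 1 * X g * Y g \<ge> 0" using not by (auto simp: orthogonal_def not_less)
          then show thesis using that[of 1] by blast
        next
          case False
          then have "\<forall>g. (-1) * X g * Y g \<ge> 0" by (auto simp: not_less)
          then show thesis using that[of "-1"] by blast
        qed
        define F where "F = fund_circuit M B e"
        have F: "F \<in> circuits M" "supp F \<subseteq> insert e B" "F e = 1"
          using fund_circuit[OF B(1) eB] by (auto simp: F_def)
        have Xe: "X e \<noteq> 0" using e by (auto simp: supp_def)
        have ne: "supp X \<noteq> supp F" using not_single[of e] e F(2) by blast
        have Fe: "F e \<noteq> 0" using F by simp
        obtain Z where Z: "Z \<in> circuits M" "Z e = 0" "\<And>g. Z g \<noteq> 0 \<Longrightarrow> Z g = X g \<or> Z g = - (X e * F e) * F g"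
          using eliminate_supp[OF X F(1) ne Xe Fe] by metis
        have Zout: "Z g = X g" if "Z g \<noteq> 0" "g \<notin> B" for g
        proof -
          have "g \<noteq> e" using Z(2) that by auto
          then have "F g = 0" using F(2) that by (auto simp: supp_def)
          then show ?thesis using Z(3)[OF that(1)] that(1) by auto
        qed
        have "supp Z - B \<subseteq> (supp X - B) - {e}"
          using Zout Z(2) by (auto simp: supp_def)
        moreover have "card ((supp X - B) - {e}) < card (supp X - B)"
          using e fin card_Diff1_less by metis
        ultimately have "card (supp Z - B) < card (supp X - B)"
          using fin by (meson card_mono finite_Diff le_less_trans)
        then have orth: "orthogonal Z Y" using small[OF Z(1)] by blast
        have nonneg: "(\<tau> * Z g) * Y g \<ge> 0" for g
        proof (cases "Z g = 0 \<or> Z g = X g")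
          case True
          then show ?thesis using \<tau>(2)[of g] by auto
        next
          case False
          then have "g \<in> B" using Zout[of g] by blast
          have Zg: "Z g = - X e * F g" using False Z(3)[of g] F(3) by simp
          show ?thesis
          proof (cases "g = b")
            case True
            then have "Z g * Y g = X e * Y e"
              using Zg Yb Ye[OF eB] by (simp add: F_def)
            then show ?thesis using \<tau>(2)[of e] by (simp add: mult.assoc)
          qed (use Y0[of g] \<open>g \<in> B\<close> in simp)
        qed
        obtain g where g: "g \<in> supp Z" "g \<notin> B" using basis_independent[OF B(1) Z(1)] by blast
        have "Z g = X g" "Z g \<noteq> 0" using Zout[of g] g by (auto simp: supp_def)
        moreover from this have "Y g \<noteq> 0" using \<open>\<not> (_ \<or> _)\<close> g by (auto simp: supp_def)
        ultimately have "(\<tau> * Z g) * Y g \<noteq> 0" using \<tau>(1) by auto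
        then have "\<not> orthogonal (\<lambda>g. \<tau> * Z g) Y" using not_orthogonal[of "\<lambda>g. \<tau> * Z g" Y] nonneg by blast
        then show False using orth \<tau>(1) by (auto simp: orthogonal_def)
      qed
    qed
  qed
  then show ?case by (simp add: Y_def)
qed

lemma cocirc_supp:
  assumes "basis M B" "b \<in> B"
  shows "supp (cocirc B b) \<subseteq> insert b (ground M - B)" "supp (cocirc B b) \<subseteq> ground M"
    "cocirc B b b = 1"
  using assms basis_sub[OF assms(1)] by (auto simp: cocirc_def supp_def split: if_splits)

lemma cocirc_cocircuit:
  assumes B: "basis M B" "b \<in> B"
  shows "cocirc B b \<in> cocircuits M"
proof (rule om_dual_pair_cocircuitI[OF B cocirc_sign[OF B(1)] cocirc_supp(1)[OF B]])
  let ?Y = "cocirc B b"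
  show "orthogonal X ?Y" if "X \<in> circuits M" for X using cocirc_orthogonal[OF B that] .
  show "meets_bases M (supp ?Y)"
    unfolding meets_bases_def
  proof (intro conjI allI impI notI)
    fix B1 assume B1: "basis M B1" "supp ?Y \<inter> B1 = {}"
    have "b \<in> supp ?Y" using cocirc_supp(3)[OF B] by (simp add: supp_def)
    then have b: "b \<in> ground M - B1" using B1(2) basis_sub[OF B(1)] B(2) by blast
    obtain f where f: "f \<noteq> b" "fund_circuit M B1 b f \<noteq> 0" "?Y f \<noteq> 0"
      using orthogonal_other[OF cocirc_orthogonal[OF B fund_circuit(1)[OF B1(1) b]], of b]
        fund_circuit(3)[OF B1(1) b] cocirc_supp(3)[OF B] by auto
    then show False using fund_circuit(2)[OF B1(1) b] B1(2) by (auto simp: supp_def)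
  qed (rule cocirc_supp(2)[OF B])
  show "basis M (insert e (B - {b}))" if "e \<in> supp ?Y" "e \<noteq> b" for e
    using that basis_exchange[OF B(1) _ B(2), of e] by (auto simp: cocirc_def supp_def split: if_splits)
qed

theorem om_dual_pair: "om_dual_pair M"
proof (rule om_dual_pairI)
  show "\<exists>Y\<in>cocircuits M. supp Y \<subseteq> insert b (ground M - B) \<and> Y b = 1"
    if "basis M B" "b \<in> B" for B b
    using cocirc_cocircuit cocirc_supp(1,3) that by blast
  have "insert e (B - {b}) \<in> Collect (basis M)"
    if "basis M B" "e \<in> ground M - B" "b \<in> B" "X \<in> circuits M" "supp X \<subseteq> insert e B"
      "X b \<noteq> 0" for B e b X
    using that basis_exchange[of B e b] fund_circuit_eq(3)[of B e X b] by auto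
  then show "basis M (insert e (B - {b}))"
    if "basis M B" "e \<in> ground M - B" "b \<in> B" "X \<in> circuits M" "supp X \<subseteq> insert e B"
      "X b \<noteq> 0" for B e b X
    using that by blast
qed (use finite_ground signs supp_subset supp_nonempty symmetric fund_circuit_ex in blast)+

end

section \<open>Duals and minors\<close>

lemma fund_circuit_fund: "fund_circuit M B e = fund (circuits M) B e"
  by (simp add: fund_circuit_def fund_def)

lemma fund_cocircuit_fund: "fund_cocircuit M B b = fund (cocircuits M) (ground M - B) b"
  by (simp add: fund_cocircuit_def fund_def)

abbreviation om_vec :: "'a om \<Rightarrow> 'a set \<Rightarrow> 'a \<Rightarrow> 'a signed_set" where
  "om_vec M \<equiv> fund_vec (ground M) (circuits M) (cocircuits M)"

lemma fund_circuit_om_vec: "e \<notin> B \<Longrightarrow> fund_circuit M B e = om_vec M B e"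
  by (simp add: fund_circuit_fund fund_vec_def)

lemma fund_cocircuit_om_vec: "b \<in> B \<Longrightarrow> fund_cocircuit M B b = om_vec M B b"
  by (simp add: fund_cocircuit_fund fund_vec_def)

section \<open>Bases and fundamental vectors of the dual\<close>

context
  fixes M :: "'a om"
  assumes M: "om_dual_pair M"
begin

interpretation M: dual_pair "ground M" "circuits M" "cocircuits M" "Collect (basis M)"
  by (rule M)

text \<open>Independence in \<open>dual M\<close> means containing no cocircuit, and the extension
  axiom of the swapped pair puts such sets inside complements of bases.\<close>

lemma basis_dual_iff: "basis (dual M) J \<longleftrightarrow> J \<subseteq> ground M \<and> basis M (ground M - J)"
proof -
  interpret D: dual_pair "ground M" "cocircuits M" "circuits M" "(\<lambda>B. ground M - B) ` Collect (basis M)"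
    by (rule M.dual_pair_dual)
  have sub: "B \<subseteq> ground M" if "basis M B" for B using M.bases_sub that by blast
  have dd: "ground M - (ground M - B) = B" if "basis M B" for B using sub[OF that] by blast
  have ind: "independent (dual M) J \<longleftrightarrow> J \<subseteq> ground M \<and> (\<forall>Y\<in>cocircuits M. \<not> supp Y \<subseteq> J)" for J
    by (simp add: independent_def dual_def)
  show ?thesis
  proof
    assume J: "basis (dual M) J"
    then have "independent (dual M) J" by (simp add: basis_def)
    then obtain B where B: "basis M B" "J \<subseteq> ground M - B"
      using D.extend[of J] ind by auto
    have "independent (dual M) (ground M - B)"
      using D.bases_independent[of "ground M - B"] B by (auto simp: ind)
    then have "ground M - B = J" using J B by (auto simp: basis_def)
    then show "J \<subseteq> ground M \<and> basis M (ground M - J)" using B dd by auto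
  next
    assume J: "J \<subseteq> ground M \<and> basis M (ground M - J)"
    then have JB: "J \<in> (\<lambda>B. ground M - B) ` Collect (basis M)"
      by (metis (mono_tags, lifting) double_diff image_eqI mem_Collect_eq order_refl)
    show "basis (dual M) J"
      unfolding basis_def
    proof (intro conjI allI impI)
      show "independent (dual M) J"
        using D.bases_independent[OF JB] J by (auto simp: ind)
      fix I assume I: "independent (dual M) I \<and> J \<subseteq> I"
      show "I = J"
      proof (rule ccontr)
        assume "I \<noteq> J"
        then obtain b where b: "b \<in> I" "b \<in> ground M - J" using I ind by blast
        obtain Y where "Y \<in> cocircuits M" "supp Y \<subseteq> insert b J"
          using D.fund_C_ex[OF JB b(2)] by blast
        then show False using I b(1) ind by blast
      qed
    qed
  qed
qed

text \<open>One half of double duality. If \<open>d\<close> is removed from the support, the rest is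
  avoided by the complement of \<open>B\<close> or of the basis obtained by exchanging
  \<open>d\<close> with \<open>e\<close>.\<close>

lemma circuit_cocircuit_dual:
  assumes B: "basis M B" "e \<in> ground M - B" and X: "X \<in> circuits M" "supp X \<subseteq> insert e B"
  shows "X \<in> cocircuits (dual M)"
proof -
  have sub: "B \<subseteq> ground M" if "basis M B" for B using M.bases_sub that by blast
  have gd: "ground (dual M) = ground M" by (simp add: dual_def)
  have Xe: "e \<in> supp X" using M.bases_independent[of B X] B X by auto
  show ?thesis
    unfolding cocircuits_def
  proof (intro CollectI conjI allI impI ballI)
    show "X f \<in> {-1, 0, 1}" for f using M.C_sign X by blast
    show "orthogonal Y X" if "Y \<in> circuits (dual M)" for Y
      using that M.orth[OF X(1)] orthogonal_commute by (auto simp: dual_def)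
    show "meets_bases (dual M) (supp X)"
      unfolding meets_bases_def gd
    proof (intro conjI allI impI notI)
      show "supp X \<subseteq> ground M" using M.C_supp X by blast
      fix J assume J: "basis (dual M) J" "supp X \<inter> J = {}"
      then have "basis M (ground M - J)" "supp X \<subseteq> ground M - J"
        using basis_dual_iff M.C_supp X by blast+
      then show False using M.bases_independent X by blast
    qed
    show "D = supp X" if D: "meets_bases (dual M) D \<and> D \<subseteq> supp X" for D
    proof (rule ccontr)
      assume "D \<noteq> supp X"
      then obtain d where d: "d \<in> supp X" "d \<notin> D" using D by blast
      show False
      proof (cases "d = e")
        case True
        then have "D \<inter> (ground M - B) = {}" using D X d by blast
        moreover have "basis (dual M) (ground M - B)"
          using B sub basis_dual_iff by (simp add: double_diff)
        ultimately show False using D unfolding meets_bases_def by blast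
      next
        case False
        then have dB: "d \<in> B" using d X by blast
        then have "basis M (insert e (B - {d}))"
          using M.exchange[of B e d X] B X d by (auto simp: supp_def)
        then have "basis (dual M) (ground M - insert e (B - {d}))"
          using sub[of "insert e (B - {d})"] basis_dual_iff by (simp add: double_diff)
        moreover have "D \<inter> (ground M - insert e (B - {d})) = {}" using D X d by blast
        ultimately show False using D unfolding meets_bases_def by blast
      qed
    qed
  qed
qed

lemma om_dual_pair_dual: "om_dual_pair (dual M)"
proof -
  interpret D: dual_pair "ground M" "cocircuits M" "circuits M" "(\<lambda>B. ground M - B) ` Collect (basis M)"
    by (rule M.dual_pair_dual)
  have [simp]: "ground (dual M) = ground M" "circuits (dual M) = cocircuits M"
    by (simp_all add: dual_def)
  have sub: "B \<subseteq> ground M" if "basis M B" for B using M.bases_sub that by blast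
  have bases: "Collect (basis (dual M)) = (\<lambda>B. ground M - B) ` Collect (basis M)"
  proof (intro set_eqI iffI)
    fix J assume "J \<in> Collect (basis (dual M))"
    then have "basis M (ground M - J)" "J = ground M - (ground M - J)"
      using basis_dual_iff by auto
    then show "J \<in> (\<lambda>B. ground M - B) ` Collect (basis M)" by blast
  next
    fix J assume "J \<in> (\<lambda>B. ground M - B) ` Collect (basis M)"
    then show "J \<in> Collect (basis (dual M))" using sub basis_dual_iff by (auto simp: double_diff)
  qed
  show ?thesis
  proof (rule om_dual_pairI)
    fix J assume "basis (dual M) J"
    then have J: "J \<in> (\<lambda>B. ground M - B) ` Collect (basis M)" and J': "basis M (ground M - J)"
      using bases basis_dual_iff by blast+
    show "\<exists>X\<in>circuits (dual M). supp X \<subseteq> insert e J \<and> X e = 1" if "e \<in> ground (dual M) - J" for e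
      using D.fund_C_ex[OF J] that by simp
    show "\<exists>Y\<in>cocircuits (dual M). supp Y \<subseteq> insert e (ground (dual M) - J) \<and> Y e = 1" if "e \<in> J" for e
    proof -
      obtain Y where Y: "Y \<in> circuits M" "supp Y \<subseteq> insert e (ground M - J)" "Y e = 1"
        using D.fund_D_ex[OF J \<open>e \<in> J\<close>] by blast
      have "Y \<in> cocircuits (dual M)"
        using circuit_cocircuit_dual[OF J' _ Y(1,2)] \<open>e \<in> J\<close> D.bases_sub[OF J] by blast
      then show ?thesis using Y by auto
    qed
    show "basis (dual M) (insert e (J - {b}))"
      if "e \<in> ground (dual M) - J" "b \<in> J" "X \<in> circuits (dual M)" "supp X \<subseteq> insert e J" "X b \<noteq> 0"
      for e b X
      using D.exchange[OF J, of e b X] that bases by auto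
  qed (unfold \<open>ground (dual M) = ground M\<close> \<open>circuits (dual M) = cocircuits M\<close>,
      (fact M.finite_E | erule D.C_sign D.C_supp D.C_nonempty D.C_uminus)+)
qed

lemma om_vec_dual:
  assumes "basis M B" "x \<in> ground M"
  shows "om_vec (dual M) (ground M - B) x = om_vec M B x"
proof -
  have sub: "B \<subseteq> ground M" using M.bases_sub assms by blast
  interpret D: dual_pair "ground (dual M)" "circuits (dual M)" "cocircuits (dual M)"
    "Collect (basis (dual M))"
    by (rule om_dual_pair_dual)
  have [simp]: "ground (dual M) = ground M" "circuits (dual M) = cocircuits M"
    by (simp_all add: dual_def)
  have J: "ground M - B \<in> Collect (basis (dual M))"
    using assms sub basis_dual_iff by (simp add: double_diff)
  show ?thesis
  proof (cases "x \<in> B")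
    case True
    then show ?thesis using assms sub by (simp add: fund_vec_def)
  next
    case False
    then have xB: "x \<in> ground M - B" using assms by blast
    have V: "om_vec M B x \<in> circuits M" "supp (om_vec M B x) \<subseteq> insert x B" "om_vec M B x x = 1"
      using M.fund_C(1)[of B x] xB assms by (auto simp: fund_vec_def)
    show ?thesis
      by (rule D.V_D_eq[OF J xB])
        (use V sub circuit_cocircuit_dual[OF assms(1) xB V(1,2)] in \<open>auto simp: double_diff\<close>)
  qed
qed

end

section \<open>Circuits, bases and fundamental vectors of a minor\<close>

lemma supp_delete_signs: "supp (delete_signs G X) = supp X - G"
  by (auto simp: delete_signs_def supp_def)

locale om_trace =
  fixes M :: "'a om" and F G :: "'a set"
  assumes M: "om_dual_pair M" and GF: "G \<subseteq> F" and F: "F \<subseteq> ground M"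
begin

sublocale M: dual_pair "ground M" "circuits M" "cocircuits M" "Collect (basis M)"
  by (rule M)

abbreviation "V \<equiv> om_vec M"
abbreviation "K \<equiv> minor M F G"

text \<open>The circuits with a nonempty trace on \<open>F - G\<close>, before minimality is
  imposed. Since each trace contains a minimal one, independence in the minor can be tested on all
  of them.\<close>

definition trace :: "'a signed_set \<Rightarrow> bool" where
  "trace X \<longleftrightarrow> X \<in> circuits M \<and> supp X \<subseteq> F \<and> \<not> supp X \<subseteq> G"

lemma ground_minor: "ground K = F - G"
  by (simp add: minor_def contraction_def restriction_def Let_def)

lemma circuits_minor:
  "circuits K = {delete_signs G X | X. trace X \<and> (\<forall>Y. trace Y \<longrightarrow> supp Y - G \<subseteq> supp X - G \<longrightarrow>
      supp Y - G = supp X - G)}"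
proof -
  define T where "T = {X \<in> delete_signs G ` circuits (restriction M F). supp X \<noteq> {}}"
  have T: "Z \<in> T \<longleftrightarrow> (\<exists>X. trace X \<and> Z = delete_signs G X)" for Z
  proof -
    have "Z \<in> T \<longleftrightarrow> (\<exists>X. X \<in> circuits M \<and> supp X \<subseteq> F \<and> Z = delete_signs G X \<and> supp Z \<noteq> {})"
      by (auto simp: T_def restriction_def)
    also have "\<dots> \<longleftrightarrow> (\<exists>X. trace X \<and> Z = delete_signs G X)"
    proof -
      have "supp (delete_signs G X) \<noteq> {} \<longleftrightarrow> \<not> supp X \<subseteq> G" for X
        by (simp add: supp_delete_signs)
      then show ?thesis unfolding trace_def by blast
    qed
    finally show ?thesis .
  qed
  have K: "circuits K = {Z \<in> T. \<forall>Y\<in>T. supp Y \<subseteq> supp Z \<longrightarrow> supp Y = supp Z}"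
    by (simp add: minor_def contraction_def Let_def T_def)
  show ?thesis
  proof (intro set_eqI iffI)
    fix Z assume Z: "Z \<in> circuits K"
    then obtain X where X: "trace X" "Z = delete_signs G X" using K T by blast
    have "supp Y - G = supp X - G" if "trace Y" "supp Y - G \<subseteq> supp X - G" for Y
    proof -
      have "delete_signs G Y \<in> T" using T that(1) by blast
      then have "supp (delete_signs G Y) \<subseteq> supp Z \<longrightarrow> supp (delete_signs G Y) = supp Z"
        using Z K by blast
      then show ?thesis using that(2) X(2) by (simp add: supp_delete_signs)
    qed
    then show "Z \<in> {delete_signs G X | X. trace X \<and> (\<forall>Y. trace Y \<longrightarrow>
        supp Y - G \<subseteq> supp X - G \<longrightarrow> supp Y - G = supp X - G)}" using X by blast
  next
    fix Z assume "Z \<in> {delete_signs G X | X. trace X \<and> (\<forall>Y. trace Y \<longrightarrow>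
        supp Y - G \<subseteq> supp X - G \<longrightarrow> supp Y - G = supp X - G)}"
    then obtain X where X: "trace X" "Z = delete_signs G X"
      "\<And>Y. trace Y \<Longrightarrow> supp Y - G \<subseteq> supp X - G \<Longrightarrow> supp Y - G = supp X - G" by blast
    have "supp Y = supp Z" if "Y \<in> T" "supp Y \<subseteq> supp Z" for Y
      using that X T supp_delete_signs by metis
    moreover have "Z \<in> T" using T X(1,2) by blast
    ultimately show "Z \<in> circuits K" using K by simp
  qed
qed

lemma trace_contains_circuit:
  assumes "trace X"
  shows "\<exists>Z\<in>circuits K. supp Z \<subseteq> supp X - G"
  using assms
proof (induction "card (supp X - G)" arbitrary: X rule: less_induct)
  case less
  have "supp X \<subseteq> ground M" using less.prems M.C_supp by (simp add: trace_def)
  then have fin: "finite (supp X - G)" using finite_subset[OF _ M.finite_E] by blast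
  show ?case
  proof (cases "\<exists>Y. trace Y \<and> supp Y - G \<subset> supp X - G")
    case True
    then obtain Y where Y: "trace Y" "supp Y - G \<subset> supp X - G" by blast
    then show ?thesis using less.hyps[OF psubset_card_mono[OF fin Y(2)] Y(1)] by blast
  next
    case False
    then have "supp Y - G = supp X - G" if "trace Y" "supp Y - G \<subseteq> supp X - G" for Y
      using that by (metis psubsetI)
    then have "delete_signs G X \<in> circuits K" using less.prems unfolding circuits_minor by blast
    then show ?thesis using supp_delete_signs[of G X] by (intro bexI[of _ "delete_signs G X"]) simp_all
  qed
qed

lemma independent_minor:
  "independent K I \<longleftrightarrow> I \<subseteq> F - G \<and> (\<forall>X. trace X \<longrightarrow> \<not> supp X \<subseteq> I \<union> G)"
proof
  assume I: "independent K I"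
  then have "\<not> supp X \<subseteq> I \<union> G" if "trace X" for X
    using trace_contains_circuit[OF that] unfolding independent_def by blast
  then show "I \<subseteq> F - G \<and> (\<forall>X. trace X \<longrightarrow> \<not> supp X \<subseteq> I \<union> G)"
    using I ground_minor by (simp add: independent_def)
next
  assume I: "I \<subseteq> F - G \<and> (\<forall>X. trace X \<longrightarrow> \<not> supp X \<subseteq> I \<union> G)"
  have "\<not> supp Z \<subseteq> I" if Z: "Z \<in> circuits K" for Z
  proof -
    obtain X where "trace X" "Z = delete_signs G X" using Z unfolding circuits_minor by blast
    then show ?thesis using I supp_delete_signs[of G X] by blast
  qed
  then show "independent K I" using I ground_minor by (simp add: independent_def)
qed

lemma trace_orthogonal:
  assumes "trace X" "X e \<noteq> 0" "Y \<in> cocircuits M" "Y e \<noteq> 0"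
  shows "\<exists>f. f \<noteq> e \<and> X f \<noteq> 0 \<and> Y f \<noteq> 0"
  using orthogonal_other[OF M.orth[of X Y]] assms by (auto simp: trace_def)

lemma minor_incomparable:
  assumes "Z \<in> circuits K" "Z' \<in> circuits K" "supp Z \<subseteq> supp Z'"
  shows "supp Z' \<subseteq> supp Z"
proof -
  obtain X where X: "trace X" "Z = delete_signs G X"
    using assms(1) unfolding circuits_minor by blast
  obtain X' where X': "Z' = delete_signs G X'"
    "\<forall>Y. trace Y \<longrightarrow> supp Y - G \<subseteq> supp X' - G \<longrightarrow> supp Y - G = supp X' - G"
    using assms(2) unfolding circuits_minor by blast
  show ?thesis using X X' assms(3) supp_delete_signs by metis
qed

text \<open>Carries closure from \<open>G\<close> to \<open>F\<close> when only the basis of the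
  minor is given, as in an arbitrary active filtration. If \<open>b\<close> on the fundamental
  circuit of \<open>e\<close> were outside \<open>F\<close>, its cocircuit would meet a trace
  through \<open>e\<close> in \<open>e\<close> and, \<open>G\<close> being closed, nowhere
  else.\<close>

lemma fund_supp_subset_if_basis_minor:
  assumes B: "basis M B" and KB: "basis K (B \<inter> (F - G))"
    and closed_G: "\<And>e. e \<in> G - B \<Longrightarrow> supp (V B e) \<subseteq> G"
    and e: "e \<in> F - B"
  shows "supp (V B e) \<subseteq> F"
proof (cases "e \<in> G")
  case True
  then show ?thesis using closed_G e GF by blast
next
  case False
  let ?I = "B \<inter> (F - G)"
  have BE: "B \<subseteq> ground M" using M.bases_sub B by blast
  have eE: "e \<in> ground M" using e F by blast
  have ind: "independent K ?I" using KB by (simp add: basis_def)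
  have "\<not> independent K (insert e ?I)" using KB e unfolding basis_def by blast
  then obtain X where X: "trace X" "supp X \<subseteq> insert e ?I \<union> G"
    using False e independent_minor[of "insert e ?I"] by auto
  have Xe: "X e \<noteq> 0"
  proof
    assume "X e = 0"
    then have "supp X \<subseteq> ?I \<union> G" using X(2) by (auto simp: supp_def)
    then show False using X(1) ind independent_minor by blast
  qed
  show ?thesis
  proof
    fix b assume b: "b \<in> supp (V B e)"
    show "b \<in> F"
    proof (rule ccontr)
      assume bF: "b \<notin> F"
      have nz: "V B e b \<noteq> 0" using b by (simp add: supp_def)
      have bE: "b \<in> ground M" using M.V_E[of B e b] B eE nz by blast
      have bB: "b \<in> B" using M.V_side[of B e b] B eE nz bF e by blast
      have be: "V B b e \<noteq> 0" using M.V_adj[of B e b] B eE bE nz by blast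
      obtain y where y: "y \<noteq> e" "X y \<noteq> 0" "V B b y \<noteq> 0"
        using trace_orthogonal[OF X(1) Xe M.V_D[of B b] be] B bB by blast
      have yI: "y \<in> insert e ?I \<union> G" using supp_subD[OF X(2) y(2)] .
      then have yF: "y \<in> F" using e GF by blast
      then have "y \<noteq> b" "y \<in> ground M" using bF F by auto
      then have "y \<notin> B" using M.V_side[of B b y] B bE y bB by blast
      then have "y \<in> G - B" using yI y(1) by blast
      then have "V B y b = 0" using closed_G bF GF by (auto simp: supp_def)
      then show False using M.V_adj[of B b y] B bE \<open>y \<in> ground M\<close> y(3) by blast
    qed
  qed
qed

end

text \<open>The closure conditions say that \<open>B\<close> spans both \<open>F\<close> and
  \<open>G\<close> from inside. This makes \<open>B \<inter> (F - G)\<close> a basis of the minor,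
  with the restricted fundamental vectors.\<close>

locale om_minor = om_trace M F G for M :: "'a om" and F G :: "'a set" +
  fixes B :: "'a set"
  assumes B: "basis M B"
    and closed_F: "\<And>e. e \<in> F - B \<Longrightarrow> supp (om_vec M B e) \<subseteq> F"
    and closed_G: "\<And>e. e \<in> G - B \<Longrightarrow> supp (om_vec M B e) \<subseteq> G"
begin

text \<open>Bases of the minor are compared with bases of \<open>M\<close> by adding fixed parts of
  \<open>B\<close>: a basis of \<open>G\<close> and a basis of the contraction of
  \<open>F\<close>.\<close>

definition lift :: "'a set \<Rightarrow> 'a set" where
  "lift I = I \<union> (B \<inter> G) \<union> (B - F)"

lemma B_sub: "B \<subseteq> ground M"
  using M.bases_sub B by blast

text \<open>\<open>B \<inter> G\<close> spans \<open>G\<close>, so an element of \<open>G\<close>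
  outside \<open>B1\<close> keeps the fundamental circuit it has for \<open>B\<close>, which stays
  inside \<open>G\<close>.\<close>

lemma V_avoids_G:
  assumes B1: "basis M B1" "B \<inter> G \<subseteq> B1" and b: "b \<in> B1 - G" and g: "g \<in> G"
  shows "V B1 b g = 0"
proof (rule ccontr)
  assume nz: "V B1 b g \<noteq> 0"
  have B1E: "B1 \<subseteq> ground M" using M.bases_sub B1 by blast
  have gE: "g \<in> ground M" using g GF F by blast
  have gB1: "g \<notin> B1" using M.V_side[of B1 b g] nz B1 B1E b g by auto
  then have gB: "g \<in> ground M - B" using B1(2) g gE by blast
  have X: "V B g \<in> circuits M" "V B g g = 1"
    using M.V_C[of B g] M.V_self[of B g] B gB by auto
  have sub: "supp (V B g) \<subseteq> G" using closed_G g gB by blast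
  have "supp (V B g) \<subseteq> insert g B" using M.fund_C(1)[of B g] B gB by (auto simp: fund_vec_def)
  then have "supp (V B g) \<subseteq> insert g B1" using sub B1(2) by blast
  then have "V B1 g = V B g" using M.V_C_eq[of B1 g "V B g"] B1 gB1 gE X by simp
  then have "V B1 g b = 0" using sub b by (auto simp: supp_def)
  then show False using nz M.V_adj[of B1 b g] B1 B1E b gE by auto
qed

lemma V_avoids_F:
  assumes "u \<in> B - F" "f \<in> F"
  shows "V B u f = 0"
proof (rule ccontr)
  assume nz: "V B u f \<noteq> 0"
  have uE: "u \<in> ground M" and fE: "f \<in> ground M" using assms B_sub F by auto
  have fB: "f \<notin> B" using M.V_side[of B u f] nz B uE assms by auto
  then have "u \<notin> supp (V B f)" using closed_F[of f] assms by auto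
  then show False using nz M.V_adj[of B u f] B uE fE by (auto simp: supp_def)
qed

text \<open>\<open>B\<close> and \<open>lift I\<close> differ only inside \<open>F\<close>, which
  the cocircuit of \<open>u\<close> avoids; so \<open>u\<close> has the same fundamental cocircuit
  in both.\<close>

lemma V_lift_avoids_F:
  assumes "basis M (lift I)" "I \<subseteq> F - G" "u \<in> B - F" "f \<in> F"
  shows "V (lift I) u f = 0"
proof -
  have Y: "V B u \<in> cocircuits M" "V B u u = 1" "supp (V B u) \<subseteq> insert u (ground M - B)"
    using M.fund_D(1)[of B u] B assms(3) by (auto simp: fund_vec_def)
  have avoid: "x \<notin> F" if "x \<in> supp (V B u)" for x
    using V_avoids_F[OF assms(3), of x] that by (auto simp: supp_def)
  have "supp (V B u) \<subseteq> insert u (ground M - lift I)"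
  proof
    fix x assume x: "x \<in> supp (V B u)"
    then show "x \<in> insert u (ground M - lift I)"
      using avoid[OF x] Y(3) assms(2) GF by (auto simp: lift_def)
  qed
  then have "V (lift I) u = V B u"
    using M.V_D_eq[of "lift I" u "V B u"] assms Y by (auto simp: lift_def)
  then show ?thesis using V_avoids_F assms by simp
qed

lemma lift_mem:
  assumes "I \<subseteq> F - G"
  shows "x \<in> F - G \<Longrightarrow> x \<in> lift I \<longleftrightarrow> x \<in> I"
  using GF assms by (auto simp: lift_def)

text \<open>Independence: the fundamental cocircuit of an element of \<open>I\<close> avoids
  \<open>G\<close>, so a trace inside \<open>I \<union> G\<close> would meet it in that element
  alone. Maximality: the fundamental circuits of \<open>lift I\<close> supply the traces.\<close>

lemma basis_minor_if:
  assumes I: "I \<subseteq> F - G" and B1: "basis M (lift I)"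
  shows "basis K I" "e \<in> F - G - I \<Longrightarrow> supp (V (lift I) e) \<subseteq> insert e (I \<union> (B \<inter> G))"
proof -
  have B1E: "lift I \<subseteq> ground M" using M.bases_sub B1 by blast
  have T: "B \<inter> G \<subseteq> lift I" by (auto simp: lift_def)
  show *: "supp (V (lift I) e) \<subseteq> insert e (I \<union> (B \<inter> G))" if e: "e \<in> F - G - I" for e
  proof
    fix u assume u: "u \<in> supp (V (lift I) e)"
    have eE: "e \<in> ground M - lift I" using e F lift_mem[OF I, of e] by blast
    have "u \<in> insert e (lift I)"
      using M.fund_C(1)[of "lift I" e] B1 eE u by (auto simp: fund_vec_def)
    moreover have "u \<notin> B - F"
    proof
      assume uU: "u \<in> B - F"
      have "V (lift I) u e = 0" using V_lift_avoids_F[OF B1 I uU] e by blast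
      then show False
        using u M.V_adj[of "lift I" e u] B1 eE uU B_sub by (auto simp: supp_def)
    qed
    ultimately show "u \<in> insert e (I \<union> (B \<inter> G))" by (auto simp: lift_def)
  qed
  have ind: "independent K I"
    unfolding independent_minor
  proof (intro conjI allI impI notI)
    fix X assume X: "trace X" "supp X \<subseteq> I \<union> G"
    then obtain x where "x \<in> supp X" and x: "x \<in> I" "x \<notin> G" unfolding trace_def by blast
    then have x: "X x \<noteq> 0" "x \<in> I" "x \<notin> G" by (simp_all add: supp_def)
    have xB1: "x \<in> lift I" using x by (simp add: lift_def)
    then have xE: "x \<in> ground M" using B1E by blast
    obtain y where y: "y \<noteq> x" "X y \<noteq> 0" "V (lift I) x y \<noteq> 0"
      using trace_orthogonal[OF X(1) x(1), of "V (lift I) x"] M.V_D[of "lift I" x]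
        M.V_self[of "lift I" x] B1 xB1 xE by auto
    have "y \<in> I \<union> G" using supp_subD[OF X(2) y(2)] .
    then consider "y \<in> G" | "y \<in> lift I" by (auto simp: lift_def)
    then show False
      using V_avoids_G[OF B1 T, of x y] M.V_side[of "lift I" x y] B1 xB1 xE x y by cases auto
  qed (rule I)
  show "basis K I"
    unfolding basis_def
  proof (intro conjI allI impI)
    fix J assume J: "independent K J \<and> I \<subseteq> J"
    show "J = I"
    proof (rule ccontr)
      assume "J \<noteq> I"
      then obtain i where i: "i \<in> J" "i \<notin> I" "i \<in> F - G" using J independent_minor by blast
      have iE: "i \<in> ground M - lift I" using i F lift_mem[OF I, of i] by blast
      have sub: "supp (V (lift I) i) \<subseteq> insert i (I \<union> (B \<inter> G))" using * i by blast
      have "i \<in> supp (V (lift I) i)" using M.V_self[of "lift I" i] B1 iE by (simp add: supp_def)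
      then have "trace (V (lift I) i)"
        using M.V_C[of "lift I" i] B1 iE i sub I GF unfolding trace_def by blast
      moreover have "supp (V (lift I) i) \<subseteq> J \<union> G" using sub J i by blast
      ultimately show False using J independent_minor by blast
    qed
  qed (rule ind)
qed

text \<open>\<open>lift I\<close> contains no circuit and extends to a basis \<open>B2\<close>. Any
  further element \<open>j\<close> of \<open>B2\<close> is excluded according to its position
  relative to \<open>G\<close> and \<open>F\<close>.\<close>

lemma basis_minor_only_if:
  assumes "basis K I"
  shows "I \<subseteq> F - G" "basis M (lift I)"
proof -
  have ind: "independent K I" using assms by (simp add: basis_def)
  then show I: "I \<subseteq> F - G" using independent_minor by blast
  have max: "\<exists>X. trace X \<and> supp X \<subseteq> insert f I \<union> G" if "f \<in> F - G - I" for f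
  proof -
    have "\<not> independent K (insert f I)" using assms that unfolding basis_def by blast
    then show ?thesis using that I independent_minor by auto
  qed
  have "\<not> supp X \<subseteq> lift I" if X: "X \<in> circuits M" for X
  proof
    assume sub: "supp X \<subseteq> lift I"
    have U: "u \<notin> supp X" if u: "u \<in> B - F" for u
    proof
      assume "u \<in> supp X"
      then have "X u \<noteq> 0" by (simp add: supp_def)
      moreover have "orthogonal X (V B u)" using M.orth[OF X M.V_D[of B u]] B u by blast
      moreover have "V B u u \<noteq> 0" using M.V_self[of B u] B u B_sub by auto
      ultimately obtain y where y: "y \<noteq> u" "X y \<noteq> 0" "V B u y \<noteq> 0"
        using orthogonal_other by metis
      have "y \<in> lift I" using supp_subD[OF sub y(2)] .
      then consider "y \<in> F" | "y \<in> B" using I GF by (auto simp: lift_def)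
      then show False
        using V_avoids_F[OF u, of y] M.V_side[of B u y] y B u B_sub by cases auto
    qed
    then have sub': "supp X \<subseteq> I \<union> (B \<inter> G)" using sub by (auto simp: lift_def)
    show False
    proof (cases "supp X \<subseteq> G")
      case True
      then have "supp X \<subseteq> B" using sub' I by blast
      then show False using M.bases_independent[of B X] B X by blast
    next
      case False
      then have "trace X" using X sub' I GF by (auto simp: trace_def)
      then show False using ind independent_minor sub' by blast
    qed
  qed
  moreover have "lift I \<subseteq> ground M" using I F B_sub by (auto simp: lift_def)
  ultimately obtain B2 where B2: "basis M B2" "lift I \<subseteq> B2" using M.extend[of "lift I"] by auto
  have B2E: "B2 \<subseteq> ground M" using M.bases_sub B2 by blast
  have T: "B \<inter> G \<subseteq> B2" using B2(2) by (auto simp: lift_def)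
  have I2: "I \<subseteq> B2" using B2(2) by (auto simp: lift_def)
  have "j \<in> lift I" if j: "j \<in> B2" for j
  proof (rule ccontr)
    assume nj: "j \<notin> lift I"
    have jE: "j \<in> ground M" using j B2E by blast
    consider "j \<in> G" | "j \<in> F - G" | "j \<notin> F" by blast
    then show False
    proof cases
      case 1
      then have jB: "j \<in> ground M - B" using nj jE by (auto simp: lift_def)
      have X: "V B j \<in> circuits M" "supp (V B j) \<subseteq> insert j B"
        using M.fund_C(1)[of B j] B jB by (auto simp: fund_vec_def)
      moreover have "supp (V B j) \<subseteq> G" using closed_G 1 jB by blast
      ultimately have "supp (V B j) \<subseteq> B2" using T j by blast
      then show False using M.bases_independent[of B2] B2 X by blast
    next
      case 2
      then have "j \<in> F - G - I" using nj by (auto simp: lift_def)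
      then obtain X where X: "trace X" "supp X \<subseteq> insert j I \<union> G" using max by blast
      then obtain x where "x \<in> supp X" "x \<notin> G" "x \<in> B2"
        using I2 j unfolding trace_def by blast
      then have x: "X x \<noteq> 0" "x \<notin> G" "x \<in> B2" by (simp_all add: supp_def)
      then have xE: "x \<in> ground M" using B2E by blast
      obtain y where y: "y \<noteq> x" "X y \<noteq> 0" "V B2 x y \<noteq> 0"
        using trace_orthogonal[OF X(1) x(1), of "V B2 x"] M.V_D[of B2 x]
          M.V_self[of B2 x] B2 x xE by auto
      have "y \<in> insert j I \<union> G" using supp_subD[OF X(2) y(2)] .
      then consider "y \<in> G" | "y \<in> B2" using I2 j by auto
      then show False
        using V_avoids_G[OF B2(1) T, of x y] M.V_side[of B2 x y] B2 xE x y by cases auto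
    next
      case 3
      then have jB: "j \<in> ground M - B" using nj jE by (auto simp: lift_def)
      \<comment> \<open>The fundamental cocircuit of \<open>j\<close> in \<open>B2\<close> avoids
        \<open>F\<close>. It therefore meets the fundamental circuit of \<open>j\<close> in
        \<open>B\<close> at another element of \<open>B - F\<close>, but \<open>B2\<close> contains
        that element.\<close>
      have avoid: "V B2 j f = 0" if f: "f \<in> F" for f
      proof (rule ccontr)
        assume nz: "V B2 j f \<noteq> 0"
        have fB2: "f \<notin> B2" using M.V_side[of B2 j f] nz B2 j jE 3 f by auto
        have fG: "f \<notin> G" using V_avoids_G[OF B2(1) T, of j f] j 3 GF nz by auto
        obtain X where X: "trace X" "supp X \<subseteq> insert f I \<union> G" using max[of f] f fG fB2 I2 by blast
        have "X f \<noteq> 0"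
        proof
          assume "X f = 0"
          then have "supp X \<subseteq> I \<union> G" using X(2) by (auto simp: supp_def)
          then show False using X(1) ind independent_minor by blast
        qed
        then obtain y where y: "y \<noteq> f" "X y \<noteq> 0" "V B2 j y \<noteq> 0"
          using trace_orthogonal[OF X(1) _ M.V_D[of B2 j] nz] B2 j by auto
        have "y \<in> insert f I \<union> G" using supp_subD[OF X(2) y(2)] .
        then consider "y \<in> G" | "y \<in> I" using y(1) by blast
        then show False
          using V_avoids_G[OF B2(1) T, of j y] M.V_side[of B2 j y] B2 j jE 3 y I2 I GF by cases auto
      qed
      have X: "V B j \<in> circuits M" "supp (V B j) \<subseteq> insert j B" "V B j j = 1"
        using M.fund_C(1)[of B j] B jB by (auto simp: fund_vec_def)
      obtain y where y: "y \<noteq> j" "V B j y \<noteq> 0" "V B2 j y \<noteq> 0"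
        using orthogonal_other[OF M.orth[OF X(1) M.V_D[of B2 j]], of j] X(3) M.V_self[of B2 j] B2 j jE
        by auto
      have "y \<in> B" using supp_subD[OF X(2) y(2)] y(1) by blast
      moreover have "y \<notin> F" using avoid[of y] y by blast
      ultimately have "y \<in> B2" using B2(2) by (auto simp: lift_def)
      then show False using M.V_side[of B2 j y] B2 j jE y by auto
    qed
  qed
  then have "B2 = lift I" using B2(2) by blast
  then show "basis M (lift I)" using B2 by simp
qed

text \<open>The cocircuit of \<open>b\<close> avoids \<open>G\<close>, so it meets such a trace at
  most in \<open>e\<close> and \<open>b\<close>, and orthogonality links the two values.\<close>

lemma minor_circuit_adjacent:
  assumes I: "I \<subseteq> F - G" and B1: "basis M (lift I)" and X: "trace X" "supp X \<subseteq> insert e I \<union> G"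
    and b: "b \<in> I" and e: "e \<in> F - G - I"
  shows "X b \<noteq> 0 \<Longrightarrow> V (lift I) b e \<noteq> 0" "X e \<noteq> 0 \<Longrightarrow> V (lift I) b e \<noteq> 0 \<Longrightarrow> X b \<noteq> 0"
proof -
  have B1E: "lift I \<subseteq> ground M" using M.bases_sub B1 by blast
  have T: "B \<inter> G \<subseteq> lift I" by (auto simp: lift_def)
  have bB1: "b \<in> lift I" "b \<in> ground M" "b \<notin> G" using b B1E I by (auto simp: lift_def)
  have only: "y = e \<or> y = b" if "X y \<noteq> 0" "V (lift I) b y \<noteq> 0" for y
  proof (rule ccontr)
    assume ne: "\<not> ?thesis"
    have "y \<in> insert e I \<union> G" using supp_subD[OF X(2) that(1)] .
    then consider "y \<in> G" | "y \<in> lift I" using ne by (auto simp: lift_def)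
    then show False
      using V_avoids_G[OF B1 T, of b y] M.V_side[of "lift I" b y] B1 bB1 that ne by cases auto
  qed
  have D: "V (lift I) b \<in> cocircuits M" using M.V_D[of "lift I" b] B1 bB1 by simp
  show "V (lift I) b e \<noteq> 0" if Xb: "X b \<noteq> 0"
  proof -
    have "V (lift I) b b \<noteq> 0" using M.V_self[of "lift I" b] B1 bB1 by simp
    then obtain y where "y \<noteq> b" "X y \<noteq> 0" "V (lift I) b y \<noteq> 0"
      using trace_orthogonal[OF X(1) Xb D] by blast
    then show ?thesis using only by blast
  qed
  show "X b \<noteq> 0" if "X e \<noteq> 0" "V (lift I) b e \<noteq> 0"
    using trace_orthogonal[OF X(1) that(1) D that(2)] only by blast
qed

text \<open>Minimality of this trace: a trace inside it contains \<open>e\<close>, since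
  \<open>I\<close> is independent, and then every other element by
  \<open>minor_circuit_adjacent\<close>.\<close>

lemma minor_fund_circuit:
  assumes I: "I \<subseteq> F - G" and B1: "basis M (lift I)" and e: "e \<in> F - G - I"
  shows "delete_signs G (V (lift I) e) \<in> circuits K"
    "supp (delete_signs G (V (lift I) e)) \<subseteq> insert e I" "delete_signs G (V (lift I) e) e = 1"
proof -
  have B1E: "lift I \<subseteq> ground M" using M.bases_sub B1 by blast
  have eE: "e \<in> ground M - lift I" using e F lift_mem[OF I, of e] by blast
  have sub: "supp (V (lift I) e) \<subseteq> insert e (I \<union> (B \<inter> G))" using basis_minor_if(2)[OF I B1 e] .
  have self: "V (lift I) e e = 1" using M.V_self[of "lift I" e] B1 eE by auto
  have "e \<in> supp (V (lift I) e)" using self by (simp add: supp_def)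
  then have tr: "trace (V (lift I) e)"
    using M.V_C[of "lift I" e] B1 eE e sub I GF unfolding trace_def by blast
  show "supp (delete_signs G (V (lift I) e)) \<subseteq> insert e I"
    using sub supp_delete_signs[of G] by blast
  show "delete_signs G (V (lift I) e) e = 1" using self e by (simp add: delete_signs_def)
  have "supp X - G = supp (V (lift I) e) - G"
    if X: "trace X" "supp X - G \<subseteq> supp (V (lift I) e) - G" for X
  proof -
    have Xsub: "supp X \<subseteq> insert e I \<union> G" using X(2) sub by blast
    have Xe: "X e \<noteq> 0"
    proof
      assume "X e = 0"
      then have "supp X \<subseteq> I \<union> G" using Xsub by (auto simp: supp_def)
      then show False
        using basis_minor_if(1)[OF I B1] independent_minor X(1) unfolding basis_def by blast
    qed
    have "b \<in> supp X" if b: "b \<in> supp (V (lift I) e) - G" for b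
    proof (cases "b = e")
      case False
      then have bI: "b \<in> I" using b sub by blast
      then have "V (lift I) b e \<noteq> 0"
        using b M.V_adj[of "lift I" e b] B1 B1E eE by (auto simp: supp_def lift_def)
      then show ?thesis
        using minor_circuit_adjacent(2)[OF I B1 X(1) Xsub bI e Xe] by (simp add: supp_def)
    qed (use Xe in \<open>simp add: supp_def\<close>)
    then show ?thesis using X(2) by blast
  qed
  then show "delete_signs G (V (lift I) e) \<in> circuits K"
    unfolding circuits_minor using tr by blast
qed

definition restr :: "'a signed_set \<Rightarrow> 'a signed_set" where
  "restr Y = (\<lambda>x. if x \<in> F - G then Y x else 0)"

lemma minor_exchange:
  assumes I: "I \<subseteq> F - G" and B1: "basis M (lift I)" and e: "e \<in> F - G - I" and b: "b \<in> I"
    and adj: "V (lift I) b e \<noteq> 0"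
  shows "basis K (insert e (I - {b}))"
proof -
  have B1E: "lift I \<subseteq> ground M" using M.bases_sub B1 by blast
  have eE: "e \<in> ground M - lift I" using e F lift_mem[OF I, of e] by blast
  have bB1: "b \<in> lift I" using b by (simp add: lift_def)
  have "V (lift I) e b \<noteq> 0" using adj M.V_adj[of "lift I" b e] B1 B1E eE bB1 by auto
  then have "basis M (insert e (lift I - {b}))" using M.exchange_V[of "lift I" e b] B1 eE bB1 by simp
  moreover have "insert e (lift I - {b}) = lift (insert e (I - {b}))"
    using b I GF by (auto simp: lift_def)
  ultimately show ?thesis using basis_minor_if(1)[of "insert e (I - {b})"] I e by auto
qed

text \<open>The cocircuit vanishes on \<open>G\<close> and traces lie in \<open>F\<close>, so
  restriction does not change the products with traces and orthogonality is inherited.\<close>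

lemma minor_fund_cocircuit:
  assumes I: "I \<subseteq> F - G" and B1: "basis M (lift I)" and b: "b \<in> I"
  shows "restr (V (lift I) b) \<in> cocircuits K"
    "supp (restr (V (lift I) b)) \<subseteq> insert b (F - G - I)" "restr (V (lift I) b) b = 1"
proof -
  let ?Y = "restr (V (lift I) b)"
  have B1E: "lift I \<subseteq> ground M" using M.bases_sub B1 by blast
  have T: "B \<inter> G \<subseteq> lift I" by (auto simp: lift_def)
  have bB1: "b \<in> lift I" "b \<in> ground M" "b \<in> F - G" using b B1E I by (auto simp: lift_def)
  show 3: "?Y b = 1" using M.V_self[of "lift I" b] B1 bB1 by (simp add: restr_def)
  show 2: "supp ?Y \<subseteq> insert b (F - G - I)"
  proof
    fix y assume y: "y \<in> supp ?Y"
    then have "y \<in> F - G" "V (lift I) b y \<noteq> 0" by (auto simp: supp_def restr_def split: if_splits)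
    then show "y \<in> insert b (F - G - I)"
      using M.V_side[of "lift I" b y] B1 bB1 by (auto simp: lift_def)
  qed
  have D: "V (lift I) b \<in> cocircuits M" using M.V_D[of "lift I" b] B1 bB1 by simp
  show "?Y \<in> cocircuits K"
  proof (rule om_dual_pair_cocircuitI[OF basis_minor_if(1)[OF I B1] b])
    show "?Y e \<in> {-1, 0, 1}" for e using M.D_sign[OF D] by (auto simp: restr_def)
    show "supp ?Y \<subseteq> insert b (ground K - I)" using 2 ground_minor by simp
    show "basis K (insert e (I - {b}))" if "e \<in> supp ?Y" "e \<noteq> b" for e
    proof (rule minor_exchange[OF I B1 _ b])
      show "e \<in> F - G - I" using that 2 by blast
      show "V (lift I) b e \<noteq> 0" using that by (auto simp: supp_def restr_def split: if_splits)
    qed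
    show "meets_bases K (supp ?Y)"
      unfolding meets_bases_def
    proof (intro conjI allI impI notI)
      fix J assume J: "basis K J" "supp ?Y \<inter> J = {}"
      have J': "J \<subseteq> F - G" "basis M (lift J)" using basis_minor_only_if[OF J(1)] by auto
      then have "supp (V (lift I) b) \<inter> lift J \<noteq> {}"
        using D unfolding cocircuits_def meets_bases_def by blast
      then obtain y where y: "V (lift I) b y \<noteq> 0" "y \<in> lift J" by (auto simp: supp_def)
      then have "y \<notin> G" using V_avoids_G[OF B1 T, of b y] bB1 by auto
      moreover have "y \<notin> B - F"
        using M.V_side[of "lift I" b y] B1 bB1 y by (auto simp: lift_def)
      ultimately have "y \<in> J" using y(2) by (auto simp: lift_def)
      moreover have "y \<in> supp ?Y" using y J'(1) \<open>y \<in> J\<close> by (auto simp: supp_def restr_def)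
      ultimately show False using J(2) by blast
    qed (use 2 bB1 ground_minor in auto)
    show "orthogonal Z ?Y" if Z: "Z \<in> circuits K" for Z
    proof -
      obtain X where X: "trace X" "Z = delete_signs G X" using Z unfolding circuits_minor by blast
      have "Z x * ?Y x = X x * V (lift I) b x" for x
        using X V_avoids_G[OF B1 T, of b x] bB1
        by (auto simp: delete_signs_def restr_def trace_def supp_def)
      moreover have "orthogonal X (V (lift I) b)" using M.orth[OF _ D] X(1) by (auto simp: trace_def)
      ultimately show ?thesis by (simp add: orthogonal_def)
    qed
  qed
qed

text \<open>The correspondence through \<open>lift\<close> carries fundamental vectors and exchange
  to the minor, so its dual pair comes directly from that of \<open>M\<close>.\<close>

theorem om_dual_pair_minor: "om_dual_pair K"
proof (rule om_dual_pairI)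
  show "finite (ground K)" using ground_minor finite_subset[OF F M.finite_E] by simp
  fix Z assume "Z \<in> circuits K"
  then obtain X where X: "trace X" "Z = delete_signs G X"
    "\<forall>Y. trace Y \<longrightarrow> supp Y - G \<subseteq> supp X - G \<longrightarrow> supp Y - G = supp X - G"
    unfolding circuits_minor by blast
  show "Z e \<in> {-1, 0, 1}" for e
    using M.C_sign[of X e] X by (auto simp: trace_def delete_signs_def)
  show "supp Z \<subseteq> ground K" "supp Z \<noteq> {}"
    using X ground_minor by (auto simp: trace_def supp_delete_signs)
  have "trace (- X)" using X(1) M.C_uminus by (simp add: trace_def)
  moreover have "- Z = delete_signs G (- X)" using X(2) by (simp add: delete_signs_def fun_eq_iff)
  moreover have "\<forall>Y. trace Y \<longrightarrow> supp Y - G \<subseteq> supp (- X) - G \<longrightarrow> supp Y - G = supp (- X) - G"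
    using X(3) by simp
  ultimately show "- Z \<in> circuits K" unfolding circuits_minor by blast
next
  fix I assume "basis K I"
  then have I: "I \<subseteq> F - G" and B1: "basis M (lift I)" using basis_minor_only_if by auto
  show "\<exists>X\<in>circuits K. supp X \<subseteq> insert e I \<and> X e = 1" if "e \<in> ground K - I" for e
    using minor_fund_circuit[OF I B1, of e] that ground_minor by auto
  show "\<exists>Y\<in>cocircuits K. supp Y \<subseteq> insert b (ground K - I) \<and> Y b = 1" if "b \<in> I" for b
    using minor_fund_cocircuit[OF I B1 that] ground_minor by auto
  show "basis K (insert e (I - {b}))"
    if prems: "e \<in> ground K - I" "b \<in> I" "Z \<in> circuits K" "supp Z \<subseteq> insert e I" "Z b \<noteq> 0" for e b Z
  proof -
    obtain X where X: "trace X" "Z = delete_signs G X"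
      using prems(3) unfolding circuits_minor by blast
    have e: "e \<in> F - G - I" using prems ground_minor by simp
    have "supp Z = supp X - G" using X(2) supp_delete_signs by simp
    then have "supp X \<subseteq> insert e I \<union> G" using prems(4) by blast
    moreover have "X b \<noteq> 0" using prems(5) X(2) by (auto simp: delete_signs_def split: if_splits)
    ultimately show ?thesis
      using minor_exchange[OF I B1 e prems(2)] minor_circuit_adjacent(1)[OF I B1 X(1) _ prems(2) e]
      by blast
  qed
qed

lemma lift_B: "lift (B \<inter> (F - G)) = B"
  using GF by (auto simp: lift_def)

lemma basis_minor_B: "basis K (B \<inter> (F - G))"
  using basis_minor_if(1)[of "B \<inter> (F - G)"] B lift_B by auto

lemma om_vec_minor:
  assumes x: "x \<in> F - G"
  shows "om_vec K (B \<inter> (F - G)) x = restr (V B x)"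
proof -
  interpret K: dual_pair "ground K" "circuits K" "cocircuits K" "Collect (basis K)"
    by (rule om_dual_pair_minor)
  let ?I = "B \<inter> (F - G)"
  have I: "?I \<subseteq> F - G" and B1: "basis M (lift ?I)" using B lift_B by auto
  have KI: "?I \<in> Collect (basis K)" using basis_minor_B by simp
  show ?thesis
  proof (cases "x \<in> B")
    case True
    then have "x \<in> ?I" using x by blast
    then show ?thesis
      using K.V_D_eq[OF KI] minor_fund_cocircuit[OF I B1] lift_B ground_minor by auto
  next
    case False
    then have xI: "x \<in> F - G - ?I" using x by blast
    have "om_vec K ?I x = delete_signs G (V B x)"
      using K.V_C_eq[OF KI] minor_fund_circuit[OF I B1 xI] xI lift_B ground_minor by auto
    moreover have "V B x y = 0" if "y \<notin> F" for y
      using closed_F[of x] False x that by (auto simp: supp_def)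
    ultimately show ?thesis by (auto simp: delete_signs_def restr_def fun_eq_iff)
  qed
qed

end

section \<open>Partitions attached to a basis\<close>

lemma finite_less_induct [consumes 2, case_names less]:
  fixes x :: "'a::linorder"
  assumes "finite E" "x \<in> E" and step: "\<And>x. x \<in> E \<Longrightarrow> (\<And>y. y \<in> E \<Longrightarrow> y < x \<Longrightarrow> P y) \<Longrightarrow> P x"
  shows "P x"
  using assms(2)
proof (induction "card {y \<in> E. y < x}" arbitrary: x rule: less_induct)
  case less
  show ?case
  proof (rule step[OF less.prems])
    fix y assume y: "y \<in> E" "y < x"
    then have "{z \<in> E. z < y} \<subset> {z \<in> E. z < x}" by auto
    then show "P y" using less.hyps[of y] y assms(1) by (simp add: psubset_card_mono)
  qed
qed

text \<open>In the following two definitions \<open>W x\<close> is the fundamental cocircuit of \<open>x\<close> if \<open>x\<close> is in the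
  basis \<open>B\<close>, and its fundamental circuit otherwise. The map \<open>h\<close> sends each element to the smallest
  element of its part and \<open>I\<close> is the set of internal elements.\<close>

definition valid_part ::
    "'a::linorder set \<Rightarrow> 'a set \<Rightarrow> ('a \<Rightarrow> 'a signed_set) \<Rightarrow> ('a \<Rightarrow> 'a) \<Rightarrow> 'a set \<Rightarrow> bool" where
  "valid_part E B W h I \<longleftrightarrow> I \<subseteq> E \<and>
     (\<forall>x\<in>E. (x \<in> B \<longleftrightarrow> x \<in> I) \<longrightarrow> (\<forall>y. W x y \<noteq> 0 \<longrightarrow> (y \<in> I \<longleftrightarrow> x \<in> I) \<and> h x \<le> h y)) \<and>
     (\<forall>x\<in>E. x \<noteq> Min (supp (W x)) \<longrightarrow>
        (\<exists>y<x. W x y \<noteq> 0 \<and> h y = h x \<and> (y \<in> I \<longleftrightarrow> x \<in> I))) \<and>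
     (\<forall>x\<in>E. x = Min (supp (W x)) \<longrightarrow> h x = x \<and> (x \<in> I \<longleftrightarrow> x \<in> B))"

definition opposite_signs :: "'a::linorder set \<Rightarrow> ('a \<Rightarrow> 'a signed_set) \<Rightarrow> ('a \<Rightarrow> 'a) \<Rightarrow> bool" where
  "opposite_signs E W h \<longleftrightarrow>
     (\<forall>x\<in>E. x \<noteq> Min (supp (W x)) \<longrightarrow> W x (Min {y. W x y \<noteq> 0 \<and> h y = h x}) = -1)"

text \<open>Only the zero pattern of \<open>W\<close> enters, so a valid partition survives every
  reorientation.\<close>

lemma valid_part_cong:
  assumes "valid_part E B W h I" and "\<And>x y. x \<in> E \<Longrightarrow> W' x y = 0 \<longleftrightarrow> W x y = 0"
  shows "valid_part E B W' h I"
proof -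
  have e: "W' x y \<noteq> 0 \<longleftrightarrow> W x y \<noteq> 0" "Min (supp (W' x)) = Min (supp (W x))" if "x \<in> E" for x y
    using assms(2)[OF that] by (simp_all add: supp_def)
  have "valid_part E B W' h I \<longleftrightarrow> valid_part E B W h I"
    unfolding valid_part_def by (intro conj_cong ball_cong refl) (simp_all only: e)
  then show ?thesis using assms(1) by simp
qed

lemma positive_nonneg: "positive X \<Longrightarrow> X e \<ge> 0"
  by (cases "X e = 0") (auto simp: positive_def supp_def)

locale valid_partition = ordered_dual_pair E C D Bs
  for E :: "'a::linorder set" and C D Bs +
  fixes B :: "'a set" and h :: "'a \<Rightarrow> 'a" and I :: "'a set"
  assumes B: "B \<in> Bs" and valid: "valid_part E B (V B) h I"
begin

abbreviation "W \<equiv> V B"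

definition active :: "'a \<Rightarrow> bool" where
  "active x \<longleftrightarrow> x = Min (supp (W x))"

lemma I_sub: "I \<subseteq> E"
  using valid by (simp add: valid_part_def)

lemma closed:
  assumes "x \<in> E" "x \<in> B \<longleftrightarrow> x \<in> I" "W x y \<noteq> 0"
  shows "y \<in> I \<longleftrightarrow> x \<in> I" "h x \<le> h y"
proof -
  have "\<forall>x\<in>E. (x \<in> B \<longleftrightarrow> x \<in> I) \<longrightarrow> (\<forall>y. W x y \<noteq> 0 \<longrightarrow> (y \<in> I \<longleftrightarrow> x \<in> I) \<and> h x \<le> h y)"
    using valid unfolding valid_part_def by (elim conjE)
  then show "y \<in> I \<longleftrightarrow> x \<in> I" "h x \<le> h y" using assms by blast+
qed

lemma inactive:
  assumes "x \<in> E" "\<not> active x"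
  obtains y where "y \<in> E" "y < x" "W x y \<noteq> 0" "h y = h x" "y \<in> I \<longleftrightarrow> x \<in> I" "y \<in> B \<longleftrightarrow> x \<notin> B"
proof -
  obtain y where y: "y < x" "W x y \<noteq> 0" "h y = h x" "y \<in> I \<longleftrightarrow> x \<in> I"
  proof -
    have "\<forall>x\<in>E. x \<noteq> Min (supp (W x)) \<longrightarrow>
        (\<exists>y<x. W x y \<noteq> 0 \<and> h y = h x \<and> (y \<in> I \<longleftrightarrow> x \<in> I))"
      using valid unfolding valid_part_def by (elim conjE)
    then have "\<exists>y<x. W x y \<noteq> 0 \<and> h y = h x \<and> (y \<in> I \<longleftrightarrow> x \<in> I)"
      using assms by (simp add: active_def)
    then show thesis using that by blast
  qed
  moreover have "y \<in> E" "y \<in> B \<longleftrightarrow> x \<notin> B"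
    using V_E[OF B assms(1) y(2)] V_side[OF B assms(1) y(2)] y(1) by auto
  ultimately show thesis using that by blast
qed

lemma active:
  assumes "x \<in> E" "active x"
  shows "h x = x" "x \<in> I \<longleftrightarrow> x \<in> B"
proof -
  have "\<forall>x\<in>E. x = Min (supp (W x)) \<longrightarrow> h x = x \<and> (x \<in> I \<longleftrightarrow> x \<in> B)"
    using valid unfolding valid_part_def by (elim conjE)
  then show "h x = x" "x \<in> I \<longleftrightarrow> x \<in> B" using assms unfolding active_def by blast+
qed

lemma active_iff:
  assumes "x \<in> E"
  shows "active x \<longleftrightarrow> (\<forall>y. W x y \<noteq> 0 \<longrightarrow> x \<le> y)"
proof -
  have "finite (supp (W x))" "x \<in> supp (W x)"
    using V_supp_finite[OF B assms] V_self[OF B assms] by (auto simp: supp_def)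
  then have "Min (supp (W x)) = x \<longleftrightarrow> (\<forall>y\<in>supp (W x). x \<le> y)"
    by (metis Min_eqI Min_le)
  then show ?thesis unfolding active_def by (auto simp: supp_def)
qed

text \<open>Smaller neighbours within a part lead down to an active element, which is its own image
  under \<open>h\<close>; so each part has exactly one active element, its minimum.\<close>

lemma h_props:
  assumes "x \<in> E"
  shows "h x \<le> x \<and> h x \<in> E \<and> active (h x) \<and> (h x \<in> I \<longleftrightarrow> x \<in> I) \<and> h (h x) = h x"
  using finite_E assms
proof (induction x rule: finite_less_induct)
  case (less x)
  show ?case
  proof (cases "active x")
    case True
    then show ?thesis using active[OF less(1) True] less(1) by simp
  next
    case False
    obtain y where "y \<in> E" "y < x" "h y = h x" "y \<in> I \<longleftrightarrow> x \<in> I"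
      using inactive[OF less(1) False] by metis
    then show ?thesis using less(2)[of y] by auto
  qed
qed

lemma h_label: "x \<in> E \<Longrightarrow> y \<in> E \<Longrightarrow> h x = h y \<Longrightarrow> x \<in> I \<longleftrightarrow> y \<in> I"
  using h_props by metis

lemma h_label_B: "x \<in> E \<Longrightarrow> h x \<in> B \<longleftrightarrow> x \<in> I"
  using h_props active by metis

lemma h_image_E: "h ` (E - I) = {x \<in> E - B. active x}"
proof (intro set_eqI iffI)
  fix a assume "a \<in> h ` (E - I)"
  then obtain x where x: "x \<in> E - I" "a = h x" by blast
  then show "a \<in> {x \<in> E - B. active x}" using h_props[of x] h_label_B[of x] by blast
next
  fix a assume a: "a \<in> {x \<in> E - B. active x}"
  then have "h a = a" "a \<notin> I" using active by auto
  then show "a \<in> h ` (E - I)" using a by force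
qed

lemma valid_partition_dual:
  "valid_partition E D C ((\<lambda>B. E - B) ` Bs) (E - B) h (E - I)"
proof -
  have W: "fund_vec E D C (E - B) x = W x" if "x \<in> E" for x using V_dual[OF B that] .
  have "valid_part E (E - B) (fund_vec E D C (E - B)) h (E - I)"
    unfolding valid_part_def
  proof (intro conjI ballI impI allI)
    fix x y assume "x \<in> E" "x \<in> E - B \<longleftrightarrow> x \<in> E - I" "fund_vec E D C (E - B) x y \<noteq> 0"
    then show "y \<in> E - I \<longleftrightarrow> x \<in> E - I" "h x \<le> h y"
      using closed[of x y] W[of x] V_E[OF B, of x y] by auto
  next
    fix x assume x: "x \<in> E" "x \<noteq> Min (supp (fund_vec E D C (E - B) x))"
    then have "\<not> active x" using W by (simp add: active_def)
    then show "\<exists>y<x. fund_vec E D C (E - B) x y \<noteq> 0 \<and> h y = h x \<and> (y \<in> E - I \<longleftrightarrow> x \<in> E - I)"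
      using inactive[OF x(1)] W[OF x(1)] x(1) by (metis Diff_iff)
  next
    fix x assume x: "x \<in> E" "x = Min (supp (fund_vec E D C (E - B) x))"
    then have "active x" using W by (simp add: active_def)
    then show "h x = x" "x \<in> E - I \<longleftrightarrow> x \<in> E - B" using active[OF x(1)] x by auto
  qed auto
  then show ?thesis
    using ordered_dual_pair_dual B
    by (simp add: valid_partition_def valid_partition_axioms_def)
qed

text \<open>The link between different runs of the procedure and arbitrary active filtrations: each
  yields a valid partition of the same \<open>B\<close>. For an inactive \<open>x\<close> the
  induction compares the smaller neighbours \<open>y\<close> and \<open>y'\<close> that the two maps
  provide.\<close>

lemma valid_partition_unique:
  assumes "valid_part E B W h' I'" "x \<in> E"
  shows "h x = h' x \<and> (x \<in> I \<longleftrightarrow> x \<in> I')"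
proof -
  interpret P: valid_partition E C D Bs B h' I'
    by unfold_locales (rule B, rule assms(1))
  show ?thesis
    using finite_E assms(2)
  proof (induction x rule: finite_less_induct)
    case (less x)
    have act: "active x \<longleftrightarrow> P.active x" by (simp add: active_def P.active_def)
    show ?case
    proof (cases "active x")
      case True
      then show ?thesis using active[OF less(1)] P.active[OF less(1)] act by simp
    next
      case False
      obtain y where y: "y \<in> E" "y < x" "W x y \<noteq> 0" "h y = h x" "y \<in> I \<longleftrightarrow> x \<in> I" "y \<in> B \<longleftrightarrow> x \<notin> B"
        using inactive[OF less(1) False] by metis
      obtain y' where y': "y' \<in> E" "y' < x" "W x y' \<noteq> 0" "h' y' = h' x" "y' \<in> I' \<longleftrightarrow> x \<in> I'"
        "y' \<in> B \<longleftrightarrow> x \<notin> B"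
        using P.inactive[OF less(1)] act False by metis
      note IH = less(2)[OF y(1,2)] less(2)[OF y'(1,2)]
      \<comment> \<open>If the labels differed, one of the maps would satisfy the closure condition
        at \<open>x\<close>; the neighbour provided by the other map contradicts it.\<close>
      have lab: "x \<in> I \<longleftrightarrow> x \<in> I'"
        using IH closed(1)[OF less(1) _ y'(3)] P.closed(1)[OF less(1) _ y(3)] y(5) y'(5)
        by blast
      have "h x = h' x"
      proof (cases "x \<in> B \<longleftrightarrow> x \<in> I")
        case True
        then show ?thesis
          using closed(2)[OF less(1) True y'(3)] P.closed(2)[OF less(1) _ y(3)] IH y y' lab
          by (metis order_antisym)
      next
        case False
        \<comment> \<open>Here closure is applied at \<open>y\<close> and \<open>y'\<close> instead,
          which lie on the other side of \<open>B\<close>.\<close>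
        have "W y x \<noteq> 0" "W y' x \<noteq> 0" using V_adj[OF B less(1)] y y' by blast+
        then have "h y' \<le> h x" "h' y \<le> h' x"
          using closed(2)[OF y'(1), of x] P.closed(2)[OF y(1), of x] y y' IH lab False by blast+
        then show ?thesis using IH y y' by (metis order_antisym)
      qed
      then show ?thesis using lab by blast
    qed
  qed
qed

end

section \<open>Positive circuits under the sign condition\<close>

locale optimal_partition = valid_partition +
  assumes opposite: "opposite_signs E (fund_vec E C D B) h"
begin

lemma optimal_partition_dual:
  "optimal_partition E D C ((\<lambda>B. E - B) ` Bs) (E - B) h (E - I)"
proof -
  have "opposite_signs E (fund_vec E D C (E - B)) h"
    using opposite V_dual[OF B] by (simp add: opposite_signs_def)
  then show ?thesis
    using valid_partition_dual by (simp add: optimal_partition_def optimal_partition_axioms_def)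
qed

text \<open>The element \<open>a\<close> of the procedure, with which the sign of \<open>x\<close>
  is compared.\<close>

definition part_min :: "'a \<Rightarrow> 'a" where
  "part_min x = Min {y. W x y \<noteq> 0 \<and> h y = h x}"

lemma part_min:
  assumes "x \<in> E" "\<not> active x"
  shows "W x (part_min x) = -1" "h (part_min x) = h x" "part_min x \<in> E" "part_min x \<in> B \<longleftrightarrow> x \<notin> B" "W (part_min x) x = 1"
    "W x y \<noteq> 0 \<Longrightarrow> h y = h x \<Longrightarrow> part_min x \<le> y"
proof -
  have fin: "finite {y. W x y \<noteq> 0 \<and> h y = h x}"
    by (rule finite_subset[OF _ V_supp_finite[OF B assms(1)]]) auto
  have "x \<in> {y. W x y \<noteq> 0 \<and> h y = h x}" using V_self[OF B assms(1)] by simp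
  then have "part_min x \<in> {y. W x y \<noteq> 0 \<and> h y = h x}" unfolding part_min_def using fin by (intro Min_in) auto
  then show 2: "h (part_min x) = h x" by simp
  show 1: "W x (part_min x) = -1"
    using opposite assms by (simp add: opposite_signs_def active_def part_min_def)
  show 3: "part_min x \<in> E" using V_E[OF B assms(1), of "part_min x"] 1 by simp
  have ne: "part_min x \<noteq> x" using 1 V_self[OF B assms(1)] by auto
  then show "part_min x \<in> B \<longleftrightarrow> x \<notin> B" using V_side[OF B assms(1), of "part_min x"] 1 by simp
  show "W (part_min x) x = 1" using V_skew[OF B assms(1) 3] 1 ne by simp
  show "part_min x \<le> y" if "W x y \<noteq> 0" "h y = h x" using that fin unfolding part_min_def by simp
qed

text \<open>In the minor of the part of \<open>a\<close>, an element \<open>b\<close> of the basis that is smallest among those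
  whose fundamental cocircuit meets \<open>X\<close> is the minimum of the fundamental circuits of all other
  elements of \<open>X\<close> on that cocircuit. The sign condition then contradicts orthogonality, unless
  \<open>a\<close> itself is an element of \<open>X\<close> outside the basis.\<close>

lemma nonneg_circuit_top_part:
  assumes X: "X \<in> C" and ne: "x \<in> E" "h x = a" "X x \<noteq> 0"
    and nonneg: "\<And>y. y \<in> E \<Longrightarrow> h y = a \<Longrightarrow> X y \<ge> 0"
    and local: "\<And>b y. b \<in> B \<Longrightarrow> h b = a \<Longrightarrow> W b y \<noteq> 0 \<Longrightarrow> X y \<noteq> 0 \<Longrightarrow> h y = a"
  shows "X a \<noteq> 0 \<and> a \<notin> B"
proof (rule ccontr)
  assume no: "\<not> ?thesis"
  have BE: "B \<subseteq> E" using bases_sub[OF B] .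
  have out: "\<not> active y" if "y \<in> E - B" "h y = a" "X y \<noteq> 0" for y
    using active(1)[of y] that no by auto
  define Q where "Q = {b \<in> B. h b = a \<and> (\<exists>y. W b y \<noteq> 0 \<and> X y \<noteq> 0)}"
  have fin: "finite Q" by (rule finite_subset[OF _ finite_E]) (use BE in \<open>auto simp: Q_def\<close>)
  have mQ: "part_min y \<in> Q" if "y \<in> E - B" "h y = a" "X y \<noteq> 0" for y
  proof -
    have "y \<in> E" "\<not> active y" using that out by auto
    from part_min[OF this] have "part_min y \<in> B" "h (part_min y) = a" "W (part_min y) y \<noteq> 0" using that by auto
    then show ?thesis using that(3) by (auto simp: Q_def)
  qed
  have "Q \<noteq> {}"
  proof (cases "x \<in> B")
    case True
    then have "x \<in> Q" using V_self[OF B ne(1)] ne by (auto simp: Q_def intro!: exI[of _ x])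
    then show ?thesis by blast
  qed (use mQ ne in blast)
  define b where "b = Min Q"
  have bQ: "b \<in> Q" using \<open>Q \<noteq> {}\<close> fin by (simp add: b_def)
  have b_le: "b \<le> c" if "c \<in> Q" for c using that fin by (simp add: b_def)
  have bB: "b \<in> B" "b \<in> E" "h b = a" using bQ BE by (auto simp: Q_def)
  have "X y * W b y \<ge> 0" for y
  proof (cases "X y = 0 \<or> W b y = 0")
    case False
    then have yE: "y \<in> E" using V_E[OF B bB(2)] by blast
    have hy: "h y = a" using local[OF bB(1,3)] False by blast
    have "W b y = 1"
    proof (cases "y = b")
      case True
      then show ?thesis using V_self[OF B bB(2)] by simp
    next
      case neq: False
      then have yB: "y \<in> E - B" using V_side[OF B bB(2), of y] False bB yE by auto
      have na: "\<not> active y" using out[OF yB hy] False by blast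
      have "W y b \<noteq> 0" using V_adj[OF B bB(2) yE] False by blast
      then have "part_min y \<le> b" using part_min(6)[OF yE na, of b] hy bB by simp
      moreover have "b \<le> part_min y" using b_le mQ[OF yB hy] False by blast
      ultimately show ?thesis using part_min(5)[OF yE na] by simp
    qed
    then show ?thesis using nonneg[OF yE hy] by simp
  qed auto
  moreover obtain y where "X y * W b y \<noteq> 0" using bQ by (auto simp: Q_def)
  ultimately show False using not_orthogonal orth[OF X V_D[OF B bB(1)]] by metis
qed

text \<open>Otherwise take the internal part with the largest \<open>h\<close> that \<open>X\<close>
  meets. Cocircuits of internal elements of \<open>B\<close> only reach internal parts with at least
  the same \<open>h\<close>, so the local argument applies and puts the minimum of an internal part
  outside \<open>B\<close>.\<close>

lemma positive_circuit_external:
  assumes X: "X \<in> C" "positive X"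
  shows "supp X \<inter> I = {}"
proof (rule ccontr)
  assume "supp X \<inter> I \<noteq> {}"
  define S where "S = h ` (supp X \<inter> I)"
  have XE: "supp X \<subseteq> E" using C_supp[OF X(1)] .
  have fin: "finite S" using finite_subset[OF XE finite_E] by (simp add: S_def)
  have "Max S \<in> S" using fin \<open>supp X \<inter> I \<noteq> {}\<close> by (auto simp: S_def intro!: Max_in)
  then obtain x where x: "x \<in> supp X" "x \<in> I" "Max S = h x" by (auto simp: S_def)
  have xE: "x \<in> E" using x XE by blast
  have "X (h x) \<noteq> 0 \<and> h x \<notin> B"
  proof (rule nonneg_circuit_top_part[OF X(1) xE refl])
    show "X x \<noteq> 0" using x by (simp add: supp_def)
    show "X y \<ge> 0" for y using positive_nonneg[OF X(2)] .
    fix b y assume b: "b \<in> B" "h b = h x" "W b y \<noteq> 0" "X y \<noteq> 0"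
    have bE: "b \<in> E" using b bases_sub[OF B] by blast
    then have "b \<in> I" using h_label[OF bE xE] b(2) x by simp
    then have "y \<in> I" "h x \<le> h y" using closed[OF bE _ b(3)] b by auto
    moreover have "h y \<in> S" using \<open>y \<in> I\<close> b(4) by (auto simp: S_def supp_def)
    ultimately show "h y = h x" using x(3) fin by (metis Max_ge order_antisym)
  qed
  then show False using h_label_B[OF xE] x by blast
qed

text \<open>Now the part with the smallest \<open>h\<close> is used: a circuit of an external
  element outside \<open>B\<close> only reaches parts with at least the same \<open>h\<close>. So
  the minimum of this part belongs to \<open>X\<close>, and \<open>h x \<le> x\<close> makes it the
  smallest element of \<open>X\<close>.\<close>

lemma positive_circuit_min:
  assumes X: "X \<in> C" "positive X"
  defines "a \<equiv> Min (supp X)"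
  shows "a \<in> h ` (E - I)" "supp X \<subseteq> {x \<in> E - I. a \<le> h x}"
proof -
  have XE: "supp X \<subseteq> E - I" using C_supp[OF X(1)] positive_circuit_external[OF X] by blast
  have fin: "finite (supp X)" using finite_subset[OF _ finite_E, of "supp X"] XE by blast
  define c where "c = Min (h ` supp X)"
  have "c \<in> h ` supp X" using C_nonempty[OF X(1)] fin by (simp add: c_def)
  then obtain x where x: "x \<in> supp X" "h x = c" by auto
  have c_le: "c \<le> h y" if "y \<in> supp X" for y using that fin by (simp add: c_def)
  have xE: "x \<in> E" "x \<notin> I" using x XE by auto
  have "X c \<noteq> 0 \<and> c \<notin> B"
  proof (rule nonneg_circuit_top_part[OF X(1) xE(1) x(2)])
    show "X x \<noteq> 0" using x by (simp add: supp_def)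
    show "X y \<ge> 0" for y using positive_nonneg[OF X(2)] .
    fix b y assume b: "b \<in> B" "h b = c" "W b y \<noteq> 0" "X y \<noteq> 0"
    have bE: "b \<in> E" using b bases_sub[OF B] by blast
    have y: "y \<in> supp X" "y \<in> E" "y \<notin> I" using b(4) XE by (auto simp: supp_def)
    have bI: "b \<notin> I" using h_label[OF bE xE(1)] b(2) x(2) xE(2) by simp
    show "h y = c"
    proof (cases "y = b")
      case False
      then have "y \<notin> B" using V_side[OF B bE b(3)] b by blast
      moreover have "W y b \<noteq> 0" using V_adj[OF B bE y(2)] b by blast
      ultimately have "h y \<le> h b" using closed(2)[OF y(2)] y(3) by blast
      then show ?thesis using c_le[OF y(1)] b by simp
    qed (use b in simp)
  qed
  then have cX: "c \<in> supp X" by (simp add: supp_def)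
  have "c \<le> y" if "y \<in> supp X" for y
    using c_le[OF that] h_props[of y] that XE by force
  then have "a = c" unfolding a_def using cX fin by (intro Min_eqI) auto
  then show "a \<in> h ` (E - I)" "supp X \<subseteq> {x \<in> E - I. a \<le> h x}"
    using x xE c_le XE by auto
qed

text \<open>Painting with sign 1 on the external parts from that of \<open>e\<close> upwards. Were
  the outcome a cocircuit, the dual of the local argument in the last of these parts that it meets
  would put the minimum of an external part into \<open>B\<close>.\<close>

lemma external_positive_circuit:
  assumes e: "e \<in> E - I"
  shows "\<exists>X\<in>C. positive X \<and> e \<in> supp X \<and> supp X \<subseteq> {x \<in> E - I. h e \<le> h x}"
proof -
  define S where "S = {x \<in> E - I. h e \<le> h x}"
  interpret P: optimal_partition E D C "(\<lambda>B. E - B) ` Bs" "E - B" h "E - I"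
    by (rule optimal_partition_dual)
  have S: "e \<in> S" "S \<subseteq> E" "{} \<inter> S = {}" using e by (auto simp: S_def)
  have \<sigma>: "1 \<in> {-1, 1 :: int}" for f :: 'a by simp
  consider (C) X where "X \<in> C" "X e \<noteq> 0" "supp X \<subseteq> S" "\<forall>f\<in>S. X f \<ge> 0"
    | (D) Y where "Y \<in> D" "Y e \<noteq> 0" "\<forall>f\<in>S. Y f \<ge> 0"
    using painting[of e S "{}" "\<lambda>_. 1", OF S \<sigma>] by auto
  then show ?thesis
  proof cases
    case C
    have "X f = 1" if "f \<in> supp X" for f
    proof -
      have "X f \<ge> 0" using C(3,4) that by blast
      then show ?thesis using that C_sign[OF C(1), of f] by (auto simp: supp_def)
    qed
    then show ?thesis using C by (auto simp: positive_def S_def supp_def)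
  next
    case D
    define T where "T = h ` (supp Y \<inter> S)"
    have fin: "finite T"
      using finite_subset[OF S(2) finite_E] by (auto simp: T_def)
    have "T \<noteq> {}" using D S(1) by (auto simp: T_def supp_def)
    then have "Max T \<in> T" using fin by simp
    then obtain x where x: "x \<in> supp Y" "x \<in> S" "Max T = h x" by (auto simp: T_def)
    have xE: "x \<in> E" "x \<notin> I" "h e \<le> h x" using x by (auto simp: S_def)
    have "Y (h x) \<noteq> 0 \<and> h x \<notin> E - B"
    proof (rule P.nonneg_circuit_top_part[OF D(1) xE(1) refl])
      show "Y x \<noteq> 0" using x by (simp add: supp_def)
      show "Y y \<ge> 0" if "y \<in> E" "h y = h x" for y
        using D(3) that xE h_label[OF that(1) xE(1)] by (auto simp: S_def)
      fix c y assume c: "c \<in> E - B" "h c = h x" "fund_vec E D C (E - B) c y \<noteq> 0" "Y y \<noteq> 0"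
      then have W: "W c y \<noteq> 0" using V_dual[OF B] by auto
      have cE: "c \<in> E" "c \<notin> I" using c h_label[of c x] xE by auto
      then have "y \<notin> I" "h x \<le> h y" using closed[OF cE(1) _ W] c by auto
      moreover have "y \<in> E" using V_E[OF B cE(1) W] .
      ultimately have "h y \<in> T" using c(4) xE by (auto simp: T_def S_def supp_def)
      then show "h y = h x" using x(3) fin \<open>h x \<le> h y\<close> by (metis Max_ge order_antisym)
    qed
    then show ?thesis using h_label_B[OF xE(1)] h_props[OF xE(1)] xE by blast
  qed
qed

definition pos :: "'a set set" where
  "pos = {supp X | X. X \<in> C \<and> positive X}"

text \<open>Together with \<open>pos_union\<close> this evaluates \<open>om_ext\<close> and, applied
  to the dual, \<open>om_int\<close>.\<close>

lemma pos_min: "Min ` pos = h ` (E - I)"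
proof
  show "Min ` pos \<subseteq> h ` (E - I)" using positive_circuit_min by (auto simp: pos_def)
  show "h ` (E - I) \<subseteq> Min ` pos"
  proof
    fix a assume "a \<in> h ` (E - I)"
    then have a: "a \<in> E - I" "h a = a" using h_image_E active(1) active(2) by auto
    obtain X where X: "X \<in> C" "positive X" "a \<in> supp X" "supp X \<subseteq> {x \<in> E - I. h a \<le> h x}"
      using external_positive_circuit[OF a(1)] by blast
    have "a \<le> y" if "y \<in> supp X" for y
      using X(4) that a(2) h_props[of y] by force
    moreover have "finite (supp X)" using C_supp[OF X(1)] finite_E finite_subset by blast
    ultimately have "Min (supp X) = a" using X(3) by (intro Min_eqI) auto
    then show "a \<in> Min ` pos" using X by (auto simp: pos_def)
  qed
qed

lemma pos_union:
  shows "\<Union> {Z \<in> pos. Min Z \<ge> a} = {x \<in> E - I. a \<le> h x}"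
proof
  show "\<Union> {Z \<in> pos. Min Z \<ge> a} \<subseteq> {x \<in> E - I. a \<le> h x}"
    using positive_circuit_min(2) by (fastforce simp: pos_def)
  show "{x \<in> E - I. a \<le> h x} \<subseteq> \<Union> {Z \<in> pos. Min Z \<ge> a}"
  proof
    fix e assume e: "e \<in> {x \<in> E - I. a \<le> h x}"
    obtain X where X: "X \<in> C" "positive X" "e \<in> supp X" "supp X \<subseteq> {x \<in> E - I. h e \<le> h x}"
      using external_positive_circuit[of e] e by blast
    have fin: "finite (supp X)" using C_supp[OF X(1)] finite_E finite_subset by blast
    have "Min (supp X) \<in> supp X" using fin X(3) by (intro Min_in) auto
    then have "h e \<le> Min (supp X)" using X(4) h_props[of "Min (supp X)"] by force
    then show "e \<in> \<Union> {Z \<in> pos. Min Z \<ge> a}" using X e by (auto simp: pos_def intro!: exI[of _ "supp X"])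
  qed
qed

end

section \<open>Decreasing lists of sets\<close>

lemma sorted_nth_iff:
  fixes as :: "'a::linorder list"
  assumes "sorted_wrt (<) as" "i < length as" "j < length as"
  shows "as ! i \<le> as ! j \<longleftrightarrow> i \<le> j" "as ! i = as ! j \<longleftrightarrow> i = j"
  using assms sorted_wrt_nth_less[OF assms(1), of i j] sorted_wrt_nth_less[OF assms(1), of j i]
  by (cases i j rule: linorder_cases; auto)+

text \<open>The external half of a filtration as a function of Part, closed by its last set
  \<open>{}\<close>. The internal half is the list of complements of the same construction on the
  internal elements.\<close>

definition up_sets :: "'a set \<Rightarrow> ('a \<Rightarrow> 'b::linorder) \<Rightarrow> 'a set list" where
  "up_sets S h = map (\<lambda>a. {x \<in> S. a \<le> h x}) (sorted_list_of_set (h ` S)) @ [{}]"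

lemma length_up_sets: "length (up_sets S h) = Suc (card (h ` S))"
  by (simp add: up_sets_def)

context
  fixes S :: "'a set" and h :: "'a \<Rightarrow> 'b::linorder" and as
  assumes S: "finite S"
  defines "as \<equiv> sorted_list_of_set (h ` S)"
begin

lemma as: "sorted_wrt (<) as" "set as = h ` S" "length as = card (h ` S)"
  using S by (simp_all add: as_def)

lemma up_sets_nth:
  "k < length as \<Longrightarrow> up_sets S h ! k = {x \<in> S. as ! k \<le> h x}" "up_sets S h ! length as = {}"
  by (simp_all add: up_sets_def as_def nth_append)

lemma h_nth: "x \<in> S \<Longrightarrow> \<exists>j<length as. h x = as ! j"
  using as(2) by (metis image_eqI in_set_conv_nth)

lemma up_sets_diff:
  assumes "k \<in> {1..<length (up_sets S h)}"
  shows "up_sets S h ! (k - 1) - up_sets S h ! k = {x \<in> S. h x = as ! (k - 1)}"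
proof -
  have k: "1 \<le> k" "k \<le> length as" using assms by (simp_all add: length_up_sets as(3))
  have "x \<in> up_sets S h ! (k - 1) - up_sets S h ! k \<longleftrightarrow> h x = as ! (k - 1)" if x: "x \<in> S" for x
  proof -
    obtain j where j: "j < length as" "h x = as ! j" using h_nth[OF x] by blast
    have 1: "x \<in> up_sets S h ! (k - 1) \<longleftrightarrow> k - 1 \<le> j"
      using up_sets_nth(1)[of "k - 1"] k j x sorted_nth_iff(1)[OF as(1), of "k - 1" j] by auto
    have 2: "x \<in> up_sets S h ! k \<longleftrightarrow> k \<le> j"
    proof (cases "k < length as")
      case True
      then show ?thesis using up_sets_nth(1)[OF True] j x sorted_nth_iff(1)[OF as(1) True j(1)] by auto
    next
      case False
      then have "k = length as" using k by simp
      then show ?thesis using up_sets_nth(2) j by simp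
    qed
    have "h x = as ! (k - 1) \<longleftrightarrow> j = k - 1"
      using sorted_nth_iff(2)[OF as(1) j(1), of "k - 1"] k j by auto
    then show ?thesis using 1 2 k by auto
  qed
  moreover have "up_sets S h ! (k - 1) \<subseteq> S" using up_sets_nth(1)[of "k - 1"] k by auto
  ultimately show ?thesis by blast
qed

lemma ext_parts_up_sets: "ext_parts (up_sets S h) = map (\<lambda>a. {x \<in> S. h x = a}) as"
proof (rule nth_equalityI)
  show "length (ext_parts (up_sets S h)) = length (map (\<lambda>a. {x \<in> S. h x = a}) as)"
    by (simp add: ext_parts_def length_up_sets as(3))
  fix i assume "i < length (ext_parts (up_sets S h))"
  then have i: "i < length as" by (simp add: ext_parts_def length_up_sets as(3) del: upt_Suc)
  then show "ext_parts (up_sets S h) ! i = map (\<lambda>a. {x \<in> S. h x = a}) as ! i"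
    using up_sets_diff[of "Suc i"] by (simp add: ext_parts_def length_up_sets as(3) del: upt_Suc)
qed

lemma up_sets_decreasing: "sorted_wrt (\<supset>) (up_sets S h)"
  unfolding sorted_wrt_iff_nth_less
proof (intro allI impI)
  fix i j assume ij: "i < j" "j < length (up_sets S h)"
  then have i: "i < length as" and j: "j \<le> length as" by (simp_all add: length_up_sets as(3))
  have "as ! i \<in> h ` S" using as(2) i by (metis nth_mem)
  then obtain x where x: "x \<in> S" "h x = as ! i" by auto
  show "up_sets S h ! j \<subset> up_sets S h ! i"
  proof (cases "j = length as")
    case True
    then show ?thesis using up_sets_nth(2) up_sets_nth(1)[OF i] x by auto
  next
    case False
    then have j': "j < length as" using j by simp
    have "as ! i < as ! j" using sorted_wrt_nth_less[OF as(1) ij(1) j'] .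
    then have "up_sets S h ! j \<subseteq> up_sets S h ! i" "x \<in> up_sets S h ! i" "x \<notin> up_sets S h ! j"
      using up_sets_nth(1)[OF i] up_sets_nth(1)[OF j'] x by auto
    then show ?thesis by blast
  qed
qed

lemma hd_up_sets: "hd (up_sets S h) = S"
proof (cases "S = {}")
  case False
  then have "h ` S \<noteq> {}" "finite (h ` S)" using S by auto
  then have n: "0 < length as" using as(3) by (simp add: card_gt_0_iff)
  have "as ! 0 \<le> h x" if "x \<in> S" for x
    using h_nth[OF that] sorted_nth_iff(1)[OF as(1) n] by auto
  then have "up_sets S h ! 0 = S" using up_sets_nth(1)[OF n] by auto
  then show ?thesis by (simp add: hd_conv_nth up_sets_def)
qed (simp add: up_sets_def)

end

lemma last_up_sets: "last (up_sets S h) = {}"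
  by (simp add: up_sets_def)

lemma up_sets_cong:
  assumes "\<And>x. x \<in> S \<Longrightarrow> h x = h' x"
  shows "up_sets S h = up_sets S h'"
proof -
  have "h ` S = h' ` S" using assms by auto
  moreover have "{x \<in> S. a \<le> h x} = {x \<in> S. a \<le> h' x}" for a using assms by auto
  ultimately show ?thesis by (simp add: up_sets_def)
qed

lemma ext_parts_Cons: "ext_parts (A # A' # L) = (A - A') # ext_parts (A' # L)"
proof -
  have "[1..<length (A # A' # L)] = 1 # map Suc [1..<length (A' # L)]"
    by (simp add: upt_conv_Cons map_Suc_upt del: upt_Suc)
  then show ?thesis by (simp add: ext_parts_def o_def del: upt_Suc)
qed

section \<open>Recovering a filtration from its parts\<close>

definition decreasing :: "'a set list \<Rightarrow> bool" where
  "decreasing L \<longleftrightarrow> L \<noteq> [] \<and> last L = {} \<and> sorted_wrt (\<supset>) L"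

text \<open>Mind the shift: \<open>x\<close> drops out at this index, so its part is the difference
  between the preceding entry and this one.\<close>

definition level :: "'a set list \<Rightarrow> 'a \<Rightarrow> nat" where
  "level L x = (LEAST k. x \<notin> L ! k)"

lemma decreasing_nth_mono:
  assumes "decreasing L" "i \<le> j" "j < length L"
  shows "L ! j \<subseteq> L ! i"
  using assms sorted_wrt_nth_less[of "(\<supset>)" L i j] unfolding decreasing_def
  by (cases "i = j") (auto simp: less_le)

lemma level:
  assumes L: "decreasing L" and x: "x \<in> hd L"
  shows "level L x \<in> {1..<length L}" "x \<in> L ! (level L x - 1) - L ! level L x"
    "j < length L \<Longrightarrow> x \<in> L ! j \<longleftrightarrow> j < level L x"
proof -
  have ne: "L \<noteq> []" "last L = {}" using L by (auto simp: decreasing_def)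
  then have n: "x \<notin> L ! (length L - 1)" by (simp add: last_conv_nth)
  have 0: "x \<in> L ! 0" using x ne by (simp add: hd_conv_nth)
  have out: "x \<notin> L ! level L x" unfolding level_def by (rule LeastI[of _ "length L - 1"]) (rule n)
  have le: "level L x \<le> length L - 1" unfolding level_def by (rule Least_le) (rule n)
  have pos: "level L x \<noteq> 0" using out 0 by metis
  show lev: "level L x \<in> {1..<length L}" using le pos ne by (cases L) auto
  have below: "x \<in> L ! j" if "j < level L x" for j
    using not_less_Least[of j "\<lambda>k. x \<notin> L ! k"] that by (simp add: level_def)
  show "x \<in> L ! (level L x - 1) - L ! level L x" using out below pos by simp
  show "x \<in> L ! j \<longleftrightarrow> j < level L x" if "j < length L"
  proof
    assume "x \<in> L ! j"
    then show "j < level L x"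
      using decreasing_nth_mono[OF L, of "level L x" j] out that by (meson not_le subsetD)
  qed (rule below)
qed

lemma level_unique:
  assumes L: "decreasing L" and k: "k \<in> {1..<length L}" and x: "x \<in> L ! (k - 1) - L ! k"
  shows "x \<in> hd L" "level L x = k"
proof -
  have "k - 1 < length L" using k by (metis atLeastLessThan_iff less_imp_diff_less)
  then have "L ! (k - 1) \<subseteq> L ! 0" using decreasing_nth_mono[OF L, of 0 "k - 1"] by simp
  then show hd: "x \<in> hd L" using x L by (auto simp: decreasing_def hd_conv_nth)
  have "k - 1 < level L x" "\<not> k < level L x"
    using level(3)[OF L hd, of "k - 1"] level(3)[OF L hd, of k] k x by auto
  then show "level L x = k" using k by simp
qed

text \<open>The minima of the differences increase, so passing to the second set removes exactly the
  elements on which \<open>h\<close> takes its least value.\<close>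

lemma up_sets_unique:
  fixes h :: "'a::linorder \<Rightarrow> 'a"
  assumes "decreasing L" "finite (hd L)" "sorted_wrt (<) (map Min (ext_parts L))"
    and "\<And>k x. k \<in> {1..<length L} \<Longrightarrow> x \<in> L ! (k - 1) - L ! k \<Longrightarrow> h x = Min (L ! (k - 1) - L ! k)"
  shows "L = up_sets (hd L) h"
  using assms
proof (induction L)
  case Nil
  then show ?case by (simp add: decreasing_def)
next
  case (Cons A L)
  show ?case
  proof (cases L)
    case Nil
    then show ?thesis using Cons.prems(1) by (simp add: decreasing_def up_sets_def)
  next
    case L: (Cons A' L')
    have dec: "decreasing L" using Cons.prems(1) L by (simp add: decreasing_def)
    have sub: "A' \<subset> A" using Cons.prems(1) L by (simp add: decreasing_def)
    have finA: "finite A" using Cons.prems(2) by simp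
    have fin: "finite (hd L)" using sub finA finite_subset L by auto
    have mins: "sorted_wrt (<) (map Min (ext_parts L))" "\<forall>m\<in>Min ` set (ext_parts L). Min (A - A') < m"
      using Cons.prems(3) L by (simp_all add: ext_parts_Cons)
    have hL: "h x = Min (L ! (k - 1) - L ! k)" if "k \<in> {1..<length L}" "x \<in> L ! (k - 1) - L ! k" for k x
      using Cons.prems(4)[of "Suc k" x] that by (auto simp: nth_Cons')
    have IH: "L = up_sets A' h" using Cons.IH[OF dec fin mins(1) hL] L by simp
    define a where "a = Min (A - A')"
    have hA: "h x = a" if "x \<in> A - A'" for x
      using Cons.prems(4)[of 1 x] that L by (simp add: a_def)
    have less: "a < h x" if "x \<in> A'" for x
    proof -
      have x: "x \<in> hd L" using that L by simp
      have k: "level L x \<in> {1..<length L}" using level(1)[OF dec x] .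
      have "h x = Min (L ! (level L x - 1) - L ! level L x)" using hL[OF k level(2)[OF dec x]] .
      moreover have "L ! (level L x - 1) - L ! level L x \<in> set (ext_parts L)"
        using k by (auto simp: ext_parts_def)
      ultimately show ?thesis using mins(2) by (auto simp: a_def)
    qed
    obtain x0 where "x0 \<in> A - A'" using sub by blast
    then have img: "h ` A = insert a (h ` A')" using hA sub by force
    have fin': "finite A'" using fin L by simp
    have fins: "finite (h ` A')" "finite (h ` A)" using fin' finA by auto
    have "sorted_list_of_set (h ` A) = a # sorted_list_of_set (h ` A')"
    proof (rule sorted_distinct_set_unique)
      show "sorted (a # sorted_list_of_set (h ` A'))" "distinct (a # sorted_list_of_set (h ` A'))"
        using less fins(1) by (auto intro: less_imp_le)
      show "set (sorted_list_of_set (h ` A)) = set (a # sorted_list_of_set (h ` A'))"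
        using fins img by (simp only: set_sorted_list_of_set list.set)
    qed (simp_all only: sorted_list_of_set.sorted_sorted_key_list_of_set sorted_sorted_list_of_set distinct_sorted_list_of_set)
    moreover have "{x \<in> A. a \<le> h x} = A" 
    proof -
      have "a \<le> h x" if "x \<in> A" for x
        using hA[of x] less[of x] that by (cases "x \<in> A'") auto
      then show ?thesis by blast
    qed
    moreover have "{x \<in> A. c \<le> h x} = {x \<in> A'. c \<le> h x}" if c: "c \<in> h ` A'" for c
    proof -
      have "a < c" using less c by auto
      then have "x \<in> A'" if "x \<in> A" "c \<le> h x" for x
        using hA[of x] that by (cases "x \<in> A'") auto
      then show ?thesis using sub by blast
    qed
    ultimately have "up_sets A h = A # up_sets A' h"
      using fin' by (simp add: up_sets_def)
    then show ?thesis using IH by simp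
  qed
qed

lemma int_parts_map:
  assumes "\<And>A. A \<in> set L \<Longrightarrow> A \<subseteq> E"
  shows "int_parts (map ((-) E) L) = ext_parts L"
proof -
  have "map ((-) E) L ! k - map ((-) E) L ! (k - 1) = L ! (k - 1) - L ! k"
    if "k \<in> {1..<length L}" for k
    using assms[of "L ! (k - 1)"] that by auto
  then show ?thesis by (simp add: int_parts_def ext_parts_def)
qed

section \<open>The active filtration and the active basis\<close>

text \<open>The definition exempts \<open>p\<close> from the sign condition only if \<open>p\<close>
  is in the basis. In a competitor without \<open>p\<close>, the fundamental circuit of
  \<open>p\<close> would have \<open>p\<close> itself as minimum, with value 1; so every competitor
  contains \<open>p\<close> and uniqueness applies.\<close>

lemma alpha_bounded_eq:
  assumes K: "om_dual_pair K" and B: "basis K B" and ne: "ground K \<noteq> {}"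
  defines "p \<equiv> Min (ground K)"
  assumes p: "p \<in> B" and opp: "\<And>x. x \<in> ground K - {p} \<Longrightarrow> min_opposite (om_vec K B x)"
  shows "alpha_bounded K = B"
proof -
  interpret ordered_dual_pair "ground K" "circuits K" "cocircuits K" "Collect (basis K)"
    using K by (simp add: ordered_dual_pair_def)
  let ?P = "\<lambda>B. basis K B \<and>
      (\<forall>b\<in>B - {p}. let Y = fund_cocircuit K B b in Y b = - Y (Min (supp Y))) \<and>
      (\<forall>e\<in>ground K - B. let X = fund_circuit K B e in X e = - X (Min (supp X)))"
  have P_iff: "?P B1 \<longleftrightarrow> basis K B1 \<and> (\<forall>x\<in>ground K - (B1 \<inter> {p}). min_opposite (V B1 x))" for B1
  proof (cases "basis K B1")
    case True
    have sub: "B1 \<subseteq> ground K" using bases_sub True by simp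
    have "V B1 x x = - V B1 x (Min (supp (V B1 x))) \<longleftrightarrow> min_opposite (V B1 x)" if "x \<in> ground K" for x
      using V_self[of B1 x] True that by (auto simp: min_opposite_def)
    then show ?thesis
      using True sub by (auto simp: Let_def fund_circuit_om_vec fund_cocircuit_om_vec)
  qed simp
  have PB: "?P B" using P_iff B opp p by auto
  have "B1 = B" if "?P B1" for B1
  proof -
    have B1: "basis K B1" "\<And>x. x \<in> ground K - (B1 \<inter> {p}) \<Longrightarrow> min_opposite (V B1 x)"
      using that P_iff by blast+
    have pg: "p \<in> ground K" using finite_E ne by (simp add: p_def)
    have "p \<in> B1"
    proof (rule ccontr)
      assume "p \<notin> B1"
      then have "min_opposite (V B1 p)" using B1 pg by blast
      moreover have "Min (supp (V B1 p)) = p"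
      proof (rule Min_eqI)
        show "finite (supp (V B1 p))" using V_supp_finite[of B1 p] B1 pg by (simp add: supp_def)
        show "p \<in> supp (V B1 p)" using V_self[of B1 p] B1 pg by (simp add: supp_def)
        show "p \<le> y" if "y \<in> supp (V B1 p)" for y
          using V_E[of B1 p y] B1 pg that finite_E by (simp add: supp_def p_def)
      qed
      ultimately show False using V_self[of B1 p] B1 pg by (simp add: min_opposite_def)
    qed
    then show ?thesis
      using fully_optimal_unique[of B1 B p] B1 B p opp by auto
  qed
  then show ?thesis
    unfolding alpha_bounded_def p_def[symmetric] using PB by (intro the_equality) blast+
qed

lemma up_sets_mem_sub: "A \<in> set (up_sets S h) \<Longrightarrow> A \<subseteq> S"
  by (auto simp: up_sets_def)

lemma up_sets_not_Nil: "up_sets S h \<noteq> []"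
  by (simp add: up_sets_def)

section \<open>Activities and active bases of a single minor\<close>

locale ordered_om_minor = om_minor M F G B for M :: "'a::linorder om" and F G B
begin

abbreviation "B0 \<equiv> B \<inter> (F - G)"
abbreviation "W \<equiv> om_vec M B"

lemma finite_minor: "finite (F - G)"
  using finite_subset[OF F M.finite_E] by simp

lemma finite_nbrs: "finite {y \<in> F - G. W x y \<noteq> 0}"
  by (rule finite_subset[OF _ finite_minor]) blast

lemma supp_om_vec_minor: "x \<in> F - G \<Longrightarrow> supp (om_vec K B0 x) = {y \<in> F - G. W x y \<noteq> 0}"
  by (auto simp: om_vec_minor supp_def restr_def)

lemma W_self: "x \<in> F - G \<Longrightarrow> W x x = 1"
  using M.V_self[of B x] B F by auto

lemma minor_active_iff:
  assumes "x \<in> F - G"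
  shows "x = Min (supp (om_vec K B0 x)) \<longleftrightarrow> (\<forall>y\<in>F - G. W x y \<noteq> 0 \<longrightarrow> x \<le> y)"
proof -
  note fin = finite_nbrs[of x]
  have x: "x \<in> {y \<in> F - G. W x y \<noteq> 0}" using W_self[OF assms] assms by simp
  show ?thesis
    unfolding supp_om_vec_minor[OF assms]
  proof
    assume "x = Min {y \<in> F - G. W x y \<noteq> 0}"
    then show "\<forall>y\<in>F - G. W x y \<noteq> 0 \<longrightarrow> x \<le> y" using Min_le[OF fin] by auto
  next
    assume "\<forall>y\<in>F - G. W x y \<noteq> 0 \<longrightarrow> x \<le> y"
    then show "x = Min {y \<in> F - G. W x y \<noteq> 0}"
      using fin x by (intro Min_eqI[symmetric]) auto
  qed
qed

lemma minor_activities: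
  "Int_act K B0 = {x \<in> F - G. x \<in> B \<and> (\<forall>y\<in>F - G. W x y \<noteq> 0 \<longrightarrow> x \<le> y)}"
  "Ext_act K B0 = {x \<in> F - G. x \<notin> B \<and> (\<forall>y\<in>F - G. W x y \<noteq> 0 \<longrightarrow> x \<le> y)}"
proof -
  have "b = Min (supp (fund_cocircuit K B0 b)) \<longleftrightarrow> (\<forall>y\<in>F - G. W b y \<noteq> 0 \<longrightarrow> b \<le> y)"
    if "b \<in> B0" for b
    using minor_active_iff[of b] fund_cocircuit_om_vec[OF that] that by simp
  then show "Int_act K B0 = {x \<in> F - G. x \<in> B \<and> (\<forall>y\<in>F - G. W x y \<noteq> 0 \<longrightarrow> x \<le> y)}"
    unfolding Int_act_def by blast
  have "e = Min (supp (fund_circuit K B0 e)) \<longleftrightarrow> (\<forall>y\<in>F - G. W e y \<noteq> 0 \<longrightarrow> e \<le> y)"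
    if "e \<in> F - G" "e \<notin> B0" for e
    using minor_active_iff[OF that(1)] fund_circuit_om_vec[OF that(2)] by simp
  then show "Ext_act K B0 = {x \<in> F - G. x \<notin> B \<and> (\<forall>y\<in>F - G. W x y \<noteq> 0 \<longrightarrow> x \<le> y)}"
    unfolding Ext_act_def ground_minor by blast
qed

text \<open>Covers uniactive internal and external bases at once, told apart by whether
  \<open>a\<close> is in \<open>B\<close>. The minimum of the minor is always active, so it has to
  be the unique active element.\<close>

definition uniactive :: "'a \<Rightarrow> bool" where
  "uniactive a \<longleftrightarrow> a \<in> F - G \<and> (\<forall>x\<in>F - G. a \<le> x) \<and>
     (\<forall>x\<in>F - G. x \<noteq> a \<longrightarrow> (\<exists>y\<in>F - G. y < x \<and> W x y \<noteq> 0))"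

lemma uniactiveD:
  assumes "F - G \<noteq> {}"
  shows "uniactive_internal K B0 \<Longrightarrow> Min (F - G) \<in> B \<and> uniactive (Min (F - G))"
    and "uniactive_external K B0 \<Longrightarrow> Min (F - G) \<notin> B \<and> uniactive (Min (F - G))"
proof -
  let ?a = "Min (F - G)"
  let ?act = "\<lambda>x. \<forall>y\<in>F - G. W x y \<noteq> 0 \<longrightarrow> x \<le> y"
  have a: "?a \<in> F - G" using Min_in[OF finite_minor assms] .
  have le: "\<forall>x\<in>F - G. ?a \<le> x" using finite_minor by simp
  have uni: "uniactive ?a" if "\<And>x. x \<in> F - G \<Longrightarrow> x \<noteq> ?a \<Longrightarrow> \<not> ?act x"
    unfolding uniactive_def using a le that by (auto simp: not_le)
  show "?a \<in> B \<and> uniactive ?a" if "uniactive_internal K B0"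
  proof -
    have E: "Ext_act K B0 = {}" and c: "card (Int_act K B0) = 1"
      using that by (simp_all add: uniactive_internal_def)
    have aB: "?a \<in> B" using E a le unfolding minor_activities by blast
    then have "?a \<in> Int_act K B0" using a le unfolding minor_activities by blast
    then have "Int_act K B0 = {?a}" using c by (auto simp: card_1_singleton_iff)
    then have "\<not> ?act x" if "x \<in> F - G" "x \<noteq> ?a" for x
      using E that unfolding minor_activities by blast
    then show ?thesis using aB uni by blast
  qed
  show "?a \<notin> B \<and> uniactive ?a" if "uniactive_external K B0"
  proof -
    have E: "Int_act K B0 = {}" and c: "card (Ext_act K B0) = 1"
      using that by (simp_all add: uniactive_external_def)
    have aB: "?a \<notin> B" using E a le unfolding minor_activities by blast
    then have "?a \<in> Ext_act K B0" using a le unfolding minor_activities by blast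
    then have "Ext_act K B0 = {?a}" using c by (auto simp: card_1_singleton_iff)
    then have "\<not> ?act x" if "x \<in> F - G" "x \<noteq> ?a" for x
      using E that unfolding minor_activities by blast
    then show ?thesis using aB uni by blast
  qed
qed

context
  fixes a
  assumes uniactive: "uniactive a"
begin

lemma uniactive_props: "a \<in> F - G" "x \<in> F - G \<Longrightarrow> a \<le> x"
  "x \<in> F - G \<Longrightarrow> x \<noteq> a \<Longrightarrow> \<exists>y\<in>F - G. y < x \<and> W x y \<noteq> 0"
  using uniactive by (simp_all add: uniactive_def)

lemma Min_minor: "Min (F - G) = a"
  using uniactive_props finite_minor by (intro Min_eqI) auto

lemma uniactive_act_iff: "x \<in> F - G \<Longrightarrow> (\<forall>y\<in>F - G. W x y \<noteq> 0 \<longrightarrow> x \<le> y) \<longleftrightarrow> x = a"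
  using uniactive_props by (metis not_le)

lemma uniactive_internalI: "a \<in> B \<Longrightarrow> uniactive_internal K B0"
proof -
  assume "a \<in> B"
  then have "Int_act K B0 = {a}" "Ext_act K B0 = {}"
    unfolding minor_activities using uniactive_act_iff uniactive_props(1) by blast+
  then show ?thesis by (simp add: uniactive_internal_def)
qed

lemma uniactive_externalI: "a \<notin> B \<Longrightarrow> uniactive_external K B0"
proof -
  assume "a \<notin> B"
  then have "Ext_act K B0 = {a}" "Int_act K B0 = {}"
    unfolding minor_activities using uniactive_act_iff uniactive_props(1) by blast+
  then show ?thesis by (simp add: uniactive_external_def)
qed

lemma not_single_loop: "a \<in> B \<Longrightarrow> \<not> single_loop K"
proof
  assume aB: "a \<in> B" and "single_loop K"
  then obtain e where e: "F - G = {e}" "{e} \<in> supp ` circuits K"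
    by (auto simp: single_loop_def ground_minor)
  then have "a = e" using uniactive_props(1) by blast
  then have "{e} \<subseteq> B0" using e aB by blast
  then show False using basis_minor_B e(2) by (auto simp: basis_def independent_def)
qed

lemma not_single_isthmus: "a \<notin> B \<Longrightarrow> \<not> single_isthmus K"
proof
  assume aB: "a \<notin> B" and "single_isthmus K"
  then obtain e where e: "F - G = {e}" "{e} \<in> supp ` cocircuits K"
    by (auto simp: single_isthmus_def ground_minor)
  then have "a = e" using uniactive_props(1) by blast
  then have "{e} \<inter> B0 = {}" using aB by blast
  moreover have "meets_bases K {e}" using e(2) by (auto simp: cocircuits_def)
  ultimately show False using basis_minor_B by (auto simp: meets_bases_def)
qed

text \<open>Smaller neighbours lead every element to \<open>a\<close>, neighbours lie on a common
  circuit, and this relation is transitive.\<close>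

lemma connected_minor: "connected_om K"
proof -
  interpret K: dual_pair "ground K" "circuits K" "cocircuits K" "Collect (basis K)"
    by (rule om_dual_pair_minor)
  have KB: "B0 \<in> Collect (basis K)" using basis_minor_B by simp
  define R where "R x y \<longleftrightarrow> x = y \<or> (\<exists>X\<in>circuits K. X x \<noteq> 0 \<and> X y \<noteq> 0)" for x y
  have sym: "R x y \<Longrightarrow> R y x" for x y by (auto simp: R_def)
  have trans: "R x z" if "R x y" "R y z" for x y z
    using that K.common_circuit_trans[OF _ _ _ _ _ _ minor_incomparable] unfolding R_def by metis
  have adj: "R x y" if "x \<in> F - G" "y \<in> F - G" "W x y \<noteq> 0" "x \<noteq> y" for x y
  proof -
    have V: "om_vec K B0 x y \<noteq> 0" using that by (simp add: om_vec_minor restr_def)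
    have xy: "x \<in> ground K" "y \<in> ground K" using that ground_minor by auto
    have side: "y \<in> B0 \<longleftrightarrow> x \<notin> B0" using K.V_side[OF KB xy(1) V] that(4) by simp
    have self: "om_vec K B0 x x \<noteq> 0" "om_vec K B0 y y \<noteq> 0"
      using K.V_self[OF KB] xy by simp_all
    show ?thesis
    proof (cases "x \<in> B0")
      case True
      then have "om_vec K B0 y \<in> circuits K" using K.V_C[OF KB] xy side by blast
      moreover have "om_vec K B0 y x \<noteq> 0" using K.V_adj[OF KB xy] V by blast
      ultimately show ?thesis using self unfolding R_def by blast
    next
      case False
      then have "om_vec K B0 x \<in> circuits K" using K.V_C[OF KB] xy by blast
      then show ?thesis using self V unfolding R_def by blast
    qed
  qed
  have R: "R a x" if "x \<in> F - G" for x
    using finite_minor that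
  proof (induction x rule: finite_less_induct)
    case (less x)
    show ?case
    proof (cases "x = a")
      case False
      then obtain y where y: "y \<in> F - G" "y < x" "W x y \<noteq> 0" using uniactive_props(3)[OF less(1)] by blast
      then show ?thesis using trans[OF less(2)[OF y(1,2)] sym[OF adj[OF less(1) y(1,3)]]] by blast
    qed (simp add: R_def)
  qed
  have "R e f" if "e \<in> F - G" "f \<in> F - G" for e f
    using trans[OF sym[OF R] R] that by blast
  then show ?thesis unfolding connected_om_def ground_minor R_def by (auto simp: supp_def)
qed

context
  assumes opposite: "\<And>x. x \<in> F - G \<Longrightarrow> x \<noteq> a \<Longrightarrow> W x (Min {y \<in> F - G. W x y \<noteq> 0}) = -1"
begin

lemma min_opposite_minor:
  assumes "x \<in> F - G" "x \<noteq> a"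
  shows "min_opposite (om_vec K B0 x)"
proof -
  let ?S = "{y \<in> F - G. W x y \<noteq> 0}"
  have "x \<in> ?S" using assms(1) W_self[OF assms(1)] by simp
  then have "Min ?S \<in> ?S" using finite_nbrs by (intro Min_in) blast+
  then have "om_vec K B0 x (Min ?S) = W x (Min ?S)"
    using om_vec_minor[OF assms(1)] by (simp add: restr_def)
  then show ?thesis
    unfolding min_opposite_def supp_om_vec_minor[OF assms(1)] using opposite[OF assms] by simp
qed

lemma alpha_bounded_minor:
  assumes "a \<in> B"
  shows "alpha_bounded K = B0"
  by (rule alpha_bounded_eq[OF om_dual_pair_minor basis_minor_B])
    (use uniactive_props(1) assms min_opposite_minor Min_minor ground_minor in auto)

lemma alpha_dual_bounded_minor:
  assumes "a \<notin> B"
  shows "alpha_dual_bounded K = B0"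
proof -
  interpret K: dual_pair "ground K" "circuits K" "cocircuits K" "Collect (basis K)"
    by (rule om_dual_pair_minor)
  have g: "ground (dual K) = F - G" by (simp add: dual_def ground_minor)
  have cc: "(F - G) - ((F - G) - B0) = B0" by blast
  have "alpha_bounded (dual K) = (F - G) - B0"
  proof (rule alpha_bounded_eq[OF om_dual_pair_dual[OF om_dual_pair_minor]])
    show "basis (dual K) ((F - G) - B0)"
      using basis_dual_iff[OF om_dual_pair_minor] basis_minor_B cc by (auto simp: ground_minor)
    show "ground (dual K) \<noteq> {}" "Min (ground (dual K)) \<in> (F - G) - B0"
      using g uniactive_props(1) assms Min_minor by auto
    show "min_opposite (om_vec (dual K) ((F - G) - B0) x)"
      if "x \<in> ground (dual K) - {Min (ground (dual K))}" for x
      using om_vec_dual[OF om_dual_pair_minor basis_minor_B, of x] min_opposite_minor[of x] that g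
        Min_minor ground_minor by auto
  qed
  then show ?thesis unfolding alpha_dual_bounded_def ground_minor using cc by simp
qed

end

end

end

section \<open>The filtration cut out by a valid partition\<close>

locale om_partition =
  valid_partition "ground N" "circuits N" "cocircuits N" "Collect (basis N)" B h I
  for N :: "'a::linorder om" and B h I
begin

abbreviation "E \<equiv> ground N"
abbreviation "ext_chain \<equiv> up_sets (E - I) h"
abbreviation "int_chain \<equiv> map ((-) E) (up_sets I h)"

lemma om_dual_pair: "om_dual_pair N"
  by unfold_locales

lemma fin: "finite (E - I)" "finite I"
  using finite_E I_sub finite_subset by auto

lemma chain_decreasing: "decreasing (up_sets (E - I) h)" "decreasing (up_sets I h)"
  unfolding decreasing_def
  by (simp_all add: last_up_sets up_sets_not_Nil up_sets_decreasing[OF fin(1)] up_sets_decreasing[OF fin(2)])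

lemma closed_external: "x \<in> {x \<in> E - I. a \<le> h x} - B \<Longrightarrow> supp (W x) \<subseteq> {x \<in> E - I. a \<le> h x}"
  using closed[of x] V_E[OF B, of x] by (fastforce simp: supp_def)

text \<open>The transpose of closure for internal elements of \<open>B\<close>: a neighbour
  \<open>y\<close> in the removed up-set would be in \<open>B\<close>, and its cocircuit would draw
  \<open>x\<close> into the up-set.\<close>

lemma closed_internal:
  assumes x: "x \<in> E - {x \<in> I. a \<le> h x} - B"
  shows "supp (W x) \<subseteq> E - {x \<in> I. a \<le> h x}"
proof
  fix y assume "y \<in> supp (W x)"
  then have nz: "W x y \<noteq> 0" by (simp add: supp_def)
  have xE: "x \<in> E" and yE: "y \<in> E" using x V_E[OF B _ nz] by auto
  have "\<not> (y \<in> I \<and> a \<le> h y)"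
  proof
    assume y: "y \<in> I \<and> a \<le> h y"
    then have "y \<noteq> x" using x by blast
    then have "y \<in> B" using V_side[OF B xE nz] x by blast
    moreover have "W y x \<noteq> 0" using V_adj[OF B xE yE] nz by blast
    ultimately have "x \<in> I" "h y \<le> h x" using closed[OF yE] y by blast+
    then show False using x y by auto
  qed
  then show "y \<in> E - {x \<in> I. a \<le> h x}" using yE by blast
qed

lemma up_sets_cases:
  assumes "k < length (up_sets S h)"
  shows "up_sets S h ! k = {} \<or> (\<exists>a. up_sets S h ! k = {x \<in> S. a \<le> h x})"
  using nth_mem[OF assms] by (auto simp: up_sets_def)

lemma part_cases:
  assumes "A = h ` S" "S = I \<or> S = E - I" "k \<in> {1..<length (up_sets S h)}"
  shows "\<exists>a\<in>A. up_sets S h ! (k - 1) - up_sets S h ! k = {x \<in> E. h x = a}"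
proof -
  have finS: "finite S" using fin assms(2) by blast
  define a where "a = sorted_list_of_set (h ` S) ! (k - 1)"
  have "k - 1 < length (sorted_list_of_set (h ` S))"
    using assms(3) finS by (auto simp: length_up_sets)
  then have "a \<in> set (sorted_list_of_set (h ` S))" unfolding a_def by (rule nth_mem)
  then have "a \<in> h ` S" using finS by simp
  moreover from this have "{x \<in> S. h x = a} = {x \<in> E. h x = a}"
    using assms(2) h_label I_sub by auto
  ultimately show ?thesis using up_sets_diff[OF finS assms(3)] assms(1) by (auto simp: a_def)
qed

lemma external_minor:
  assumes "k \<in> {1..<length ext_chain}"
  shows "ordered_om_minor N (ext_chain ! (k - 1)) (ext_chain ! k) B"
proof -
  have k: "k < length ext_chain" "k - 1 < length ext_chain" using assms by auto
  have sub: "A \<in> set ext_chain \<Longrightarrow> A \<subseteq> E" for A by (auto simp: up_sets_def)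
  have cl: "supp (W x) \<subseteq> ext_chain ! j" if "j < length ext_chain" "x \<in> ext_chain ! j - B" for j x
    using up_sets_cases[OF that(1)] that(2) closed_external by auto
  show ?thesis
    using om_dual_pair B decreasing_nth_mono[OF chain_decreasing(1), of "k - 1" k] k cl sub nth_mem[OF k(2)]
    by (simp add: ordered_om_minor_def om_minor_def om_trace_def om_minor_axioms_def)
qed

lemma internal_minor:
  assumes "k \<in> {1..<length int_chain}"
  shows "ordered_om_minor N (int_chain ! k) (int_chain ! (k - 1)) B"
proof -
  have k: "k < length (up_sets I h)" "k - 1 < length (up_sets I h)" using assms by auto
  have cl: "supp (W x) \<subseteq> E - up_sets I h ! j"
    if "j < length (up_sets I h)" "x \<in> E - up_sets I h ! j - B" for j x
    using up_sets_cases[OF that(1)]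
  proof
    assume "up_sets I h ! j = {}"
    then show ?thesis using V_E[OF B, of x] that(2) by (auto simp: supp_def)
  next
    assume "\<exists>a. up_sets I h ! j = {x \<in> I. a \<le> h x}"
    then show ?thesis using closed_internal that(2) by auto
  qed
  show ?thesis
    using om_dual_pair B decreasing_nth_mono[OF chain_decreasing(2), of "k - 1" k] k cl
    by (auto simp: ordered_om_minor_def om_minor_def om_trace_def om_minor_axioms_def)
qed

lemma uniactive_part:
  assumes "ordered_om_minor N F G B" "F - G = {x \<in> E. h x = a}" "a \<in> h ` E"
  shows "ordered_om_minor.uniactive N F G B a"
proof -
  interpret P: ordered_om_minor N F G B by (rule assms(1))
  show ?thesis
    unfolding P.uniactive_def assms(2)
  proof (intro conjI ballI impI)
    have "a \<in> E" "h a = a" using assms(3) h_props by auto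
    then show "a \<in> {x \<in> E. h x = a}" by simp
    show "a \<le> x" if "x \<in> {x \<in> E. h x = a}" for x using that h_props[of x] by auto
    show "\<exists>y\<in>{x \<in> E. h x = a}. y < x \<and> W x y \<noteq> 0" if "x \<in> {x \<in> E. h x = a}" "x \<noteq> a" for x
    proof -
      have "x \<in> E" "\<not> active x" using that active(1)[of x] by auto
      then obtain y where "y \<in> E" "y < x" "W x y \<noteq> 0" "h y = h x" using inactive by metis
      then show ?thesis using that by auto
    qed
  qed
qed

lemma external_part:
  assumes k: "k \<in> {1..<length ext_chain}"
  obtains a where "a \<in> h ` E" "a \<notin> B" "ext_chain ! (k - 1) - ext_chain ! k = {x \<in> E. h x = a}"
    "ordered_om_minor.uniactive N (ext_chain ! (k - 1)) (ext_chain ! k) B a"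
proof -
  obtain a where a: "a \<in> h ` (E - I)" "ext_chain ! (k - 1) - ext_chain ! k = {x \<in> E. h x = a}"
    using part_cases[OF refl _ k] by blast
  then have "a \<in> h ` E" "a \<notin> B" using h_label_B by auto
  then show thesis using that uniactive_part[OF external_minor[OF k] a(2)] a by blast
qed

lemma int_chain_diff:
  assumes "k \<in> {1..<length int_chain}"
  shows "int_chain ! k - int_chain ! (k - 1) = up_sets I h ! (k - 1) - up_sets I h ! k"
proof -
  have "k - 1 < length (up_sets I h)" using assms by auto
  then have "up_sets I h ! (k - 1) \<subseteq> E" using up_sets_mem_sub[OF nth_mem] I_sub by blast
  then show ?thesis using assms by auto
qed

lemma internal_part:
  assumes k: "k \<in> {1..<length int_chain}"
  obtains a where "a \<in> h ` E" "a \<in> B" "int_chain ! k - int_chain ! (k - 1) = {x \<in> E. h x = a}"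
    "ordered_om_minor.uniactive N (int_chain ! k) (int_chain ! (k - 1)) B a"
proof -
  have k': "k \<in> {1..<length (up_sets I h)}" using k by simp
  obtain a where a: "a \<in> h ` I" "up_sets I h ! (k - 1) - up_sets I h ! k = {x \<in> E. h x = a}"
    using part_cases[OF refl _ k'] by blast
  then have "a \<in> h ` E" "a \<in> B" using h_label_B I_sub by auto
  moreover have diff: "int_chain ! k - int_chain ! (k - 1) = {x \<in> E. h x = a}"
    unfolding int_chain_diff[OF k] by (rule a(2))
  ultimately show thesis
    using that uniactive_part[OF internal_minor[OF k] diff] by blast
qed

lemma Min_part:
  assumes "S = I \<or> S = E - I"
  shows "map Min (map (\<lambda>a. {x \<in> S. h x = a}) (sorted_list_of_set (h ` S))) =
    sorted_list_of_set (h ` S)"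
proof -
  have finS: "finite S" using fin assms by blast
  have "Min {x \<in> S. h x = a} = a" if "a \<in> h ` S" for a
  proof (rule Min_eqI)
    obtain y where y: "y \<in> S" "h y = a" using \<open>a \<in> h ` S\<close> by auto
    then have "y \<in> E" using assms I_sub by auto
    then show "a \<in> {x \<in> S. h x = a}" using h_props[of y] y assms by auto
    show "a \<le> x" if "x \<in> {x \<in> S. h x = a}" for x
      using h_props[of x] that assms I_sub by auto
  qed (use finS in simp)
  then have "map (\<lambda>a. Min {x \<in> S. h x = a}) (sorted_list_of_set (h ` S)) = sorted_list_of_set (h ` S)"
    using finS by (intro map_idI) simp
  then show ?thesis by (simp add: o_def)
qed

lemma ext_parts_chain: "ext_parts ext_chain = map (\<lambda>a. {x \<in> E - I. h x = a}) (sorted_list_of_set (h ` (E - I)))"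
  using ext_parts_up_sets[OF fin(1)] .

lemma int_parts_chain: "int_parts int_chain = map (\<lambda>a. {x \<in> I. h x = a}) (sorted_list_of_set (h ` I))"
proof -
  have "A \<subseteq> E" if "A \<in> set (up_sets I h)" for A using that I_sub by (auto simp: up_sets_def)
  then show ?thesis using int_parts_map[of "up_sets I h" E] ext_parts_up_sets[OF fin(2)] by simp
qed

lemma is_active_filtration: "is_active_filtration N B (ext_chain, int_chain)"
proof -
  have "sorted_wrt (\<subset>) int_chain"
  proof -
    have "sorted_wrt (\<lambda>A A'. E - A \<subset> E - A') (up_sets I h)"
    proof (rule sorted_wrt_mono_rel[OF _ up_sets_decreasing[OF fin(2)]])
      fix A A' assume "A \<in> set (up_sets I h)" "A' \<in> set (up_sets I h)" "A' \<subset> A"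
      moreover from this have "A \<subseteq> E" using I_sub by (auto simp: up_sets_def)
      ultimately show "E - A \<subset> E - A'" by blast
    qed
    then show ?thesis by (simp add: sorted_wrt_map)
  qed
  moreover have "hd ext_chain = hd int_chain"
    using hd_up_sets[OF fin(1), of h] hd_up_sets[OF fin(2), of h] hd_map[OF up_sets_not_Nil] by metis
  moreover have "last int_chain = E" by (simp add: up_sets_def)
  moreover have "sorted_wrt (<) (map Min (ext_parts ext_chain))"
    "sorted_wrt (<) (map Min (int_parts int_chain))"
    unfolding ext_parts_chain int_parts_chain
    using Min_part[of "E - I"] Min_part[of I] by simp_all
  moreover have "connected_om (minor N (int_chain ! k) (int_chain ! (k - 1))) \<and>
      \<not> single_loop (minor N (int_chain ! k) (int_chain ! (k - 1))) \<and>
      basis (minor N (int_chain ! k) (int_chain ! (k - 1))) (B \<inter> (int_chain ! k - int_chain ! (k - 1))) \<and>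
      uniactive_internal (minor N (int_chain ! k) (int_chain ! (k - 1)))
        (B \<inter> (int_chain ! k - int_chain ! (k - 1)))"
    if k: "k \<in> {1..<length int_chain}" for k
  proof -
    interpret P: ordered_om_minor N "int_chain ! k" "int_chain ! (k - 1)" B
      by (rule internal_minor[OF k])
    obtain a where "a \<in> B" "P.uniactive a" using internal_part[OF k] by metis
    then show ?thesis
      using P.connected_minor P.not_single_loop P.basis_minor_B P.uniactive_internalI by blast
  qed
  moreover have "connected_om (minor N (ext_chain ! (k - 1)) (ext_chain ! k)) \<and>
      \<not> single_isthmus (minor N (ext_chain ! (k - 1)) (ext_chain ! k)) \<and>
      basis (minor N (ext_chain ! (k - 1)) (ext_chain ! k)) (B \<inter> (ext_chain ! (k - 1) - ext_chain ! k)) \<and>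
      uniactive_external (minor N (ext_chain ! (k - 1)) (ext_chain ! k))
        (B \<inter> (ext_chain ! (k - 1) - ext_chain ! k))"
    if k: "k \<in> {1..<length ext_chain}" for k
  proof -
    interpret P: ordered_om_minor N "ext_chain ! (k - 1)" "ext_chain ! k" B
      by (rule external_minor[OF k])
    obtain a where "a \<notin> B" "P.uniactive a" using external_part[OF k] by metis
    then show ?thesis
      using P.connected_minor P.not_single_isthmus P.basis_minor_B P.uniactive_externalI by blast
  qed
  ultimately show ?thesis
    unfolding is_active_filtration_def connected_filtration_def
    using last_up_sets up_sets_decreasing[OF fin(1)] by (auto simp: up_sets_def)
qed

lemma Min_class:
  assumes "a \<in> h ` E"
  shows "Min {x \<in> E. h x = a} = a"
proof (rule Min_eqI)
  show "finite {x \<in> E. h x = a}" using finite_E by simp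
  show "a \<in> {x \<in> E. h x = a}" using h_props assms by auto
  show "a \<le> x" if "x \<in> {x \<in> E. h x = a}" for x using that h_props[of x] by auto
qed

text \<open>An arbitrary active filtration yields a map \<open>h'\<close>, which is shown to be a
  valid partition. It therefore agrees with \<open>h\<close>, and both lists can be rebuilt from
  it.\<close>

lemma active_filtration_unique:
  assumes act: "is_active_filtration N B (F', F)"
  shows "F' = ext_chain" "F = int_chain"
proof -
  \<comment> \<open>Complements make the increasing list decreasing, so that both halves fall under
    the same lemmas.\<close>
  define U where "U = map ((-) E) F"
  have ne: "F' \<noteq> []" "F \<noteq> []" and lst: "last F' = {}" "last F = E" and hd: "hd F' = hd F"
    and srt: "sorted_wrt (\<supset>) F'" "sorted_wrt (\<subset>) F"
    and mins: "sorted_wrt (<) (map Min (ext_parts F'))" "sorted_wrt (<) (map Min (int_parts F))"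
    and basis_F: "\<And>k. k \<in> {1..<length F} \<Longrightarrow>
      basis (minor N (F ! k) (F ! (k - 1))) (B \<inter> (F ! k - F ! (k - 1))) \<and>
      uniactive_internal (minor N (F ! k) (F ! (k - 1))) (B \<inter> (F ! k - F ! (k - 1)))"
    and basis_F': "\<And>k. k \<in> {1..<length F'} \<Longrightarrow>
      basis (minor N (F' ! (k - 1)) (F' ! k)) (B \<inter> (F' ! (k - 1) - F' ! k)) \<and>
      uniactive_external (minor N (F' ! (k - 1)) (F' ! k)) (B \<inter> (F' ! (k - 1) - F' ! k))"
    using act unfolding is_active_filtration_def connected_filtration_def by auto
  have F_mono: "F ! i \<subseteq> F ! j" if "i \<le> j" "j < length F" for i j
    using sorted_wrt_nth_less[OF srt(2), of i j] that by (cases "i = j") auto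
  have F_E: "F ! i \<subseteq> E" if "i < length F" for i
    using F_mono[of i "length F - 1"] that ne lst by (auto simp: last_conv_nth)
  have F_E': "A \<subseteq> E" if "A \<in> set F" for A using F_E that by (auto simp: in_set_conv_nth)
  have decF': "decreasing F'" using ne lst srt by (simp add: decreasing_def)
  have decU: "decreasing U"
  proof -
    have "sorted_wrt (\<lambda>A A'. E - A \<supset> E - A') F"
      using F_E' by (intro sorted_wrt_mono_rel[OF _ srt(2)]) blast
    then show ?thesis using ne lst by (simp add: decreasing_def U_def last_map sorted_wrt_map)
  qed
  have lenU: "length U = length F" by (simp add: U_def)
  have U_nth: "U ! k = E - F ! k" if "k < length F" for k using that by (simp add: U_def)
  have U_diff: "U ! (k - 1) - U ! k = F ! k - F ! (k - 1)" if "k \<in> {1..<length F}" for k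
  proof -
    have "k < length F" "k - 1 < length F" using that by auto
    then show ?thesis using U_nth F_E[of k] by auto
  qed
  have hdU: "hd U = E - hd F'" using hd ne by (simp add: U_def hd_map)
  have hdF'E: "hd F' \<subseteq> E" using hd F_E[of 0] ne by (simp add: hd_conv_nth)
  have F'_E: "F' ! i \<subseteq> E" if "i < length F'" for i
    using decreasing_nth_mono[OF decF', of 0 i] that hdF'E ne by (simp add: hd_conv_nth)
  have parts_U: "ext_parts U = int_parts F"
  proof -
    have "map ((-) E) U = F" unfolding U_def map_map by (rule map_idI) (simp add: double_diff F_E')
    moreover have "int_parts (map ((-) E) U) = ext_parts U"
      by (rule int_parts_map) (auto simp: U_def)
    ultimately show ?thesis by simp
  qed

  \<comment> \<open>Closure starts at the empty set, climbs along \<open>F'\<close> to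
    \<open>hd F' = hd F\<close>, and continues along \<open>F\<close>. Only then are the minors
    known to be compatible with \<open>B\<close>.\<close>
  define cl where "cl G \<longleftrightarrow> (\<forall>e\<in>G - B. supp (W e) \<subseteq> G)" for G
  have cl_step: "cl A" if "cl G" "G \<subseteq> A" "A \<subseteq> E" "basis (minor N A G) (B \<inter> (A - G))" for A G
  proof -
    have "om_trace N A G" using om_dual_pair that by (simp add: om_trace_def)
    then show ?thesis
      using om_trace.fund_supp_subset_if_basis_minor[of N A G B] B that by (auto simp: cl_def)
  qed
  have cl_F': "cl (F' ! j)" if "j < length F'" for j
  proof -
    have "j \<le> length F' - 1" using that by simp
    then show ?thesis
    proof (induction rule: inc_induct)
      case base
      then show ?case using lst ne by (simp add: last_conv_nth cl_def)
    next
      case (step n)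
      then have k: "Suc n \<in> {1..<length F'}" by auto
      have n: "Suc n < length F'" "n < length F'" using k by auto
      show ?case
      proof (rule cl_step)
        show "cl (F' ! Suc n)" by (rule step.IH)
        show "F' ! Suc n \<subseteq> F' ! n" by (rule decreasing_nth_mono[OF decF' _ n(1)]) simp
        show "F' ! n \<subseteq> E" by (rule F'_E[OF n(2)])
        show "basis (minor N (F' ! n) (F' ! Suc n)) (B \<inter> (F' ! n - F' ! Suc n))"
          using basis_F'[OF k] by simp
      qed
    qed
  qed
  have cl_F: "cl (F ! j)" if "j < length F" for j
    using that
  proof (induction j)
    case 0
    then show ?case using cl_F'[of 0] hd ne by (simp add: hd_conv_nth)
  next
    case (Suc n)
    then have k: "Suc n \<in> {1..<length F}" by auto
    show ?case
    proof (rule cl_step)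
      show "cl (F ! n)" using Suc by simp
      show "F ! n \<subseteq> F ! Suc n" using F_mono[of n "Suc n"] Suc.prems by simp
      show "F ! Suc n \<subseteq> E" by (rule F_E[OF Suc.prems])
      show "basis (minor N (F ! Suc n) (F ! n)) (B \<inter> (F ! Suc n - F ! n))"
        using basis_F[OF k] by simp
    qed
  qed

  have minor_F': "ordered_om_minor N (F' ! (k - 1)) (F' ! k) B" if k: "k \<in> {1..<length F'}" for k
  proof -
    have "k < length F'" "k - 1 < length F'" using k by auto
    then show ?thesis
      using om_dual_pair B cl_F' F'_E decreasing_nth_mono[OF decF', of "k - 1" k]
      by (simp add: ordered_om_minor_def om_minor_def om_trace_def om_minor_axioms_def cl_def)
  qed
  have minor_F: "ordered_om_minor N (F ! k) (F ! (k - 1)) B" if k: "k \<in> {1..<length F}" for k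
  proof -
    have "k < length F" "k - 1 < length F" using k by auto
    then show ?thesis
      using om_dual_pair B cl_F F_E F_mono[of "k - 1" k]
      by (simp add: ordered_om_minor_def om_minor_def om_trace_def om_minor_axioms_def cl_def)
  qed

  \<comment> \<open>\<open>pt L x\<close> is the difference that contains \<open>x\<close>;
    \<open>h'\<close> takes its minimum, in \<open>F'\<close> for external elements and in
    \<open>U\<close> for internal ones.\<close>
  define pt where "pt L x = L ! (level L x - 1) - L ! level L x" for L :: "'a set list" and x
  define h' where "h' x = Min (if x \<in> hd F' then pt F' x else pt U x)" for x
  have pt_mem: "x \<in> pt L x" if "decreasing L" "x \<in> hd L" for L x
    using level(2)[OF that] by (simp add: pt_def)
  have pt_eq: "y \<in> hd L \<and> pt L y = pt L x" if "decreasing L" "x \<in> hd L" "y \<in> pt L x" for L x y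
    using level_unique[OF that(1) level(1)[OF that(1,2)], of y] that(3) by (simp add: pt_def)
  have pt_le: "Min (pt L x) \<le> Min (pt L y)"
    if L: "decreasing L" "sorted_wrt (<) (map Min (ext_parts L))" "x \<in> hd L" "y \<in> hd L"
      "y \<in> L ! (level L x - 1)" for L x y
  proof -
    have lx: "level L x \<in> {1..<length L}" and ly: "level L y \<in> {1..<length L}"
      by (fact level(1)[OF L(1,3)] level(1)[OF L(1,4)])+
    have "level L x - 1 < level L y" using level(3)[OF L(1,4), of "level L x - 1"] L(5) lx by auto
    then have le: "level L x - 1 \<le> level L y - 1" by simp
    have nth: "map Min (ext_parts L) ! (level L z - 1) = Min (pt L z)"
      "level L z - 1 < length (map Min (ext_parts L))"
      if "level L z \<in> {1..<length L}" for z
      using that by (auto simp: ext_parts_def pt_def)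
    show ?thesis
      using le sorted_nth_iff(1)[OF L(2) nth(2)[OF lx] nth(2)[OF ly]] nth(1)[OF lx] nth(1)[OF ly]
      by simp
  qed
  have minor_x: "\<exists>A G. ordered_om_minor N A G B \<and> A - G = pt F' x \<and>
      Min (A - G) \<notin> B \<and> ordered_om_minor.uniactive N A G B (Min (A - G))" if x: "x \<in> hd F'" for x
  proof -
    have k: "level F' x \<in> {1..<length F'}" using level(1)[OF decF' x] .
    interpret P: ordered_om_minor N "F' ! (level F' x - 1)" "F' ! level F' x" B
      by (rule minor_F'[OF k])
    have "F' ! (level F' x - 1) - F' ! level F' x \<noteq> {}" using level(2)[OF decF' x] by blast
    from P.uniactiveD(2)[OF this] basis_F'[OF k] P.ordered_om_minor_axioms show ?thesis
      unfolding pt_def by blast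
  qed
  have minor_x': "\<exists>A G. ordered_om_minor N A G B \<and> A - G = pt U x \<and>
      Min (A - G) \<in> B \<and> ordered_om_minor.uniactive N A G B (Min (A - G))" if x: "x \<in> hd U" for x
  proof -
    have k: "level U x \<in> {1..<length F}" using level(1)[OF decU x] lenU by simp
    interpret P: ordered_om_minor N "F ! level U x" "F ! (level U x - 1)" B
      by (rule minor_F[OF k])
    have "F ! level U x - F ! (level U x - 1) \<noteq> {}"
      using level(2)[OF decU x] U_diff[OF k] by blast
    from P.uniactiveD(1)[OF this] basis_F[OF k] P.ordered_om_minor_axioms show ?thesis
      unfolding pt_def U_diff[OF k] by blast
  qed
  \<comment> \<open>Both sides are treated together, with \<open>L\<close> being \<open>F'\<close>
    or \<open>U\<close>; uniactivity of the minor supplies the smaller neighbour.\<close>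
  have part: "h' x \<in> E \<and> h' (h' x) = h' x \<and> h' x \<le> x \<and> (h' x \<in> hd F' \<longleftrightarrow> x \<in> hd F') \<and>
      (h' x \<in> B \<longleftrightarrow> x \<notin> hd F') \<and>
      (x \<noteq> h' x \<longrightarrow> (\<exists>y<x. W x y \<noteq> 0 \<and> h' y = h' x \<and> (y \<in> hd F' \<longleftrightarrow> x \<in> hd F')))"
    if xE: "x \<in> E" for x
  proof -
    have "\<exists>L A G. decreasing L \<and> x \<in> hd L \<and> ordered_om_minor N A G B \<and>
        A - G = pt L x \<and> (Min (A - G) \<in> B \<longleftrightarrow> x \<notin> hd F') \<and>
        ordered_om_minor.uniactive N A G B (Min (A - G)) \<and>
        (\<forall>y\<in>hd L. (y \<in> hd F' \<longleftrightarrow> x \<in> hd F') \<and> h' y = Min (pt L y))"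
    proof (cases "x \<in> hd F'")
      case True
      then show ?thesis using minor_x[OF True] decF' by (intro exI[of _ F']) (auto simp: h'_def)
    next
      case False
      then have "x \<in> hd U" using xE hdU by simp
      then show ?thesis using minor_x' decU hdU False by (intro exI[of _ U]) (auto simp: h'_def)
    qed
    then obtain L A G where L: "decreasing L" "x \<in> hd L" "ordered_om_minor N A G B" "A - G = pt L x"
      "Min (A - G) \<in> B \<longleftrightarrow> x \<notin> hd F'" "ordered_om_minor.uniactive N A G B (Min (A - G))"
      "\<And>y. y \<in> hd L \<Longrightarrow> (y \<in> hd F' \<longleftrightarrow> x \<in> hd F') \<and> h' y = Min (pt L y)" by blast
    interpret P: ordered_om_minor N A G B by (rule L(3))
    define a where "a = Min (A - G)"
    have hx: "h' x = a" using L(2,4,7) by (simp add: a_def)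
    have same: "(y \<in> hd F' \<longleftrightarrow> x \<in> hd F') \<and> h' y = a" if "y \<in> A - G" for y
    proof -
      have "y \<in> hd L \<and> pt L y = pt L x" using pt_eq[OF L(1,2)] that L(4) by blast
      then show ?thesis using L(4,7) by (simp add: a_def)
    qed
    have a: "a \<in> A - G" "\<And>z. z \<in> A - G \<Longrightarrow> a \<le> z"
      "\<And>z. z \<in> A - G \<Longrightarrow> z \<noteq> a \<Longrightarrow> \<exists>y\<in>A - G. y < z \<and> W z y \<noteq> 0"
      using P.uniactive_props[OF L(6)] by (simp_all add: a_def)
    have xAG: "x \<in> A - G" using pt_mem[OF L(1,2)] L(4) by simp
    have "a \<in> E" using a(1) P.F by blast
    moreover have "\<exists>y<x. W x y \<noteq> 0 \<and> h' y = h' x \<and> (y \<in> hd F' \<longleftrightarrow> x \<in> hd F')" if "x \<noteq> a"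
      using a(3)[OF xAG that] same hx by blast
    ultimately show ?thesis using hx same[OF a(1)] a(2)[OF xAG] L(5) by (auto simp: a_def)
  qed
  \<comment> \<open>For external \<open>x\<close> this is closure of the last set of
    \<open>F'\<close> containing \<open>x\<close>. For internal \<open>x\<close> it is the transpose
    of closure of the last set of \<open>F\<close> missing \<open>x\<close>.\<close>
  have closed': "(y \<in> E - hd F' \<longleftrightarrow> x \<in> E - hd F') \<and> h' x \<le> h' y"
    if x: "x \<in> E" "x \<in> B \<longleftrightarrow> x \<in> E - hd F'" "W x y \<noteq> 0" for x y
  proof (cases "x \<in> hd F'")
    case True
    define j where "j = level F' x - 1"
    have j: "j < length F'" using level(1)[OF decF' True] by (auto simp: j_def)
    have "x \<in> F' ! j - B" using level(2)[OF decF' True] x(2) True by (auto simp: j_def)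
    then have "y \<in> F' ! j" using cl_F'[OF j] x(3) by (auto simp: cl_def supp_def)
    moreover from this have "y \<in> hd F'"
      using decreasing_nth_mono[OF decF', of 0 j] j ne by (auto simp: hd_conv_nth)
    ultimately show ?thesis using pt_le[OF decF' mins(1) True] True by (simp add: h'_def j_def)
  next
    case False
    then have xU: "x \<in> hd U" using x(1) hdU by simp
    define j where "j = level U x - 1"
    have j: "j < length F" using level(1)[OF decU xU] lenU by (auto simp: j_def)
    have xj: "x \<notin> F ! j" using level(2)[OF decU xU] U_nth[OF j] by (auto simp: j_def)
    have yE: "y \<in> E" using V_E[OF B x(1,3)] .
    have "y \<notin> F ! j"
    proof
      assume yj: "y \<in> F ! j"
      then have "y \<noteq> x" using xj by blast
      then have "y \<in> F ! j - B" using V_side[OF B x(1,3)] x(1,2) False yj by blast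
      then have "W y x = 0" using cl_F[OF j] xj by (auto simp: cl_def supp_def)
      then show False using V_adj[OF B x(1) yE] x(3) by blast
    qed
    then have "y \<in> U ! j" using U_nth[OF j] yE by simp
    moreover have "y \<notin> hd F'"
      using \<open>y \<notin> F ! j\<close> F_mono[of 0 j] j hd ne by (auto simp: hd_conv_nth)
    ultimately show ?thesis
      using pt_le[OF decU _ xU, of y] mins(2) parts_U hdU yE False x(1) by (simp add: h'_def j_def)
  qed
  \<comment> \<open>The minimum of a part is active because \<open>h' x \<le> h' y \<le> y\<close>
    for each of its neighbours \<open>y\<close>.\<close>
  have act': "x = h' x \<longleftrightarrow> active x" if x: "x \<in> E" for x
  proof
    assume "active x"
    then show "x = h' x" using part[OF x] active_iff[OF x] by (metis not_le)
  next
    assume hx: "x = h' x"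
    have "x \<le> y" if "W x y \<noteq> 0" for y
    proof -
      have "x \<in> B \<longleftrightarrow> x \<in> E - hd F'" using part[OF x] hx x by auto
      then have "h' x \<le> h' y" using closed'[OF x _ that] by blast
      moreover have "h' y \<le> y" using part[OF V_E[OF B x that]] by blast
      ultimately show ?thesis using hx by simp
    qed
    then show "active x" using active_iff[OF x] by blast
  qed
  have "valid_part E B W h' (E - hd F')"
    unfolding valid_part_def
  proof (intro conjI ballI impI allI)
    fix x y assume "x \<in> E" "x \<in> B \<longleftrightarrow> x \<in> E - hd F'" "W x y \<noteq> 0"
    then show "y \<in> E - hd F' \<longleftrightarrow> x \<in> E - hd F'" "h' x \<le> h' y" using closed' by blast+
  next
    fix x assume x: "x \<in> E" "x \<noteq> Min (supp (W x))"
    then have "x \<noteq> h' x" using act'[OF x(1)] by (simp add: active_def)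
    then obtain y where "y < x" "W x y \<noteq> 0" "h' y = h' x" "y \<in> hd F' \<longleftrightarrow> x \<in> hd F'"
      using part[OF x(1)] by blast
    then show "\<exists>y<x. W x y \<noteq> 0 \<and> h' y = h' x \<and> (y \<in> E - hd F' \<longleftrightarrow> x \<in> E - hd F')"
      using V_E[OF B x(1)] x(1) by blast
  next
    fix x assume x: "x \<in> E" "x = Min (supp (W x))"
    then have "x = h' x" using act'[OF x(1)] by (simp add: active_def)
    then show "h' x = x" "x \<in> E - hd F' \<longleftrightarrow> x \<in> B" using part[OF x(1)] x(1) by auto
  qed blast
  then have eq: "h x = h' x" "x \<in> I \<longleftrightarrow> x \<in> E - hd F'" if "x \<in> E" for x
    using valid_partition_unique that by blast+
  have I: "I = E - hd F'" using eq(2) I_sub by blast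
  have hdF': "hd F' = E - I" using I hdF'E by blast
  have "F' = up_sets (hd F') h'"
  proof (rule up_sets_unique[OF decF' _ mins(1)])
    show "finite (hd F')" using fin hdF' by simp
    fix k x assume k: "k \<in> {1..<length F'}" and x: "x \<in> F' ! (k - 1) - F' ! k"
    show "h' x = Min (F' ! (k - 1) - F' ! k)"
      using level_unique[OF decF' k x] by (simp add: h'_def pt_def)
  qed
  then show "F' = ext_chain" using hdF' up_sets_cong[of "E - I" h h'] eq(1) by simp
  have "U = up_sets (hd U) h'"
  proof (rule up_sets_unique[OF decU])
    show "finite (hd U)" using fin hdU I by simp
    show "sorted_wrt (<) (map Min (ext_parts U))" using mins(2) parts_U by simp
    fix k x assume k: "k \<in> {1..<length U}" and x: "x \<in> U ! (k - 1) - U ! k"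
    have "x \<in> hd U" "level U x = k" using level_unique[OF decU k x] by blast+
    then show "h' x = Min (U ! (k - 1) - U ! k)" using hdU by (simp add: h'_def pt_def)
  qed
  then have "U = up_sets I h" using hdU I up_sets_cong[of I h h'] eq(1) I_sub by auto
  moreover have "map ((-) E) U = F" unfolding U_def map_map by (rule map_idI) (simp add: double_diff F_E')
  ultimately show "F = int_chain" by simp
qed

lemma active_filtration_eq: "active_filtration N B = (ext_chain, int_chain)"
  unfolding active_filtration_def
proof (rule the_equality)
  fix \<F> assume "is_active_filtration N B \<F>"
  then show "\<F> = (ext_chain, int_chain)"
    using active_filtration_unique by (cases \<F>) blast
qed (rule is_active_filtration)

lemma active_partition_eq: "active_partition N B = (\<lambda>a. {x \<in> E. h x = a}) ` h ` E"
proof -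
  have 1: "{x \<in> S. h x = a} = {x \<in> E. h x = a}" if "a \<in> h ` S" "S = I \<or> S = E - I" for a S
    using that h_label I_sub by auto
  have "set (ext_parts ext_chain) = (\<lambda>a. {x \<in> E. h x = a}) ` h ` (E - I)"
    unfolding ext_parts_chain set_map set_sorted_list_of_set[OF finite_imageI[OF fin(1)]]
    by (rule image_cong[OF refl 1]) simp_all
  moreover have "set (int_parts int_chain) = (\<lambda>a. {x \<in> E. h x = a}) ` h ` I"
    unfolding int_parts_chain set_map set_sorted_list_of_set[OF finite_imageI[OF fin(2)]]
    by (rule image_cong[OF refl 1]) simp_all
  moreover have "h ` E = h ` (E - I) \<union> h ` I" using I_sub by blast
  ultimately show ?thesis by (simp add: active_partition_def active_filtration_eq image_Un)
qed

lemma active_partition_Min: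
  assumes "e \<in> E"
  shows "\<exists>P\<in>active_partition N B. e \<in> P \<and> h e = Min P"
  using assms Min_class[of "h e"] by (auto simp: active_partition_eq)

text \<open>Positive circuits and, dually, positive cocircuits have the minima and unions prescribed
  by the partition, so the filtration of \<open>N\<close> is that of \<open>B\<close>. In each minor
  the sign condition makes the trace of \<open>B\<close> the active basis.\<close>

lemma opposite_alpha:
  assumes opp: "opposite_signs E (om_vec N B) h"
  shows "alpha N = B"
proof -
  interpret O: optimal_partition E "circuits N" "cocircuits N" "Collect (basis N)" B h I
    by unfold_locales (rule opp)
  interpret D: optimal_partition E "cocircuits N" "circuits N"
    "(\<lambda>B. E - B) ` Collect (basis N)" "E - B" h "E - I"
    by (rule O.optimal_partition_dual)
  have map_nth': "map (\<lambda>k. f (as ! k)) [0..<length as] = map f as" for f :: "'a \<Rightarrow> 'a set" and as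
    by (metis (no_types, lifting) map_map map_nth comp_apply map_cong)
  have ext: "om_ext N = ext_chain"
  proof -
    have "pos_circuits N = O.pos" by (simp add: pos_circuits_def O.pos_def)
    then show ?thesis
      using O.pos_min O.pos_union
        map_nth'[of "\<lambda>a. {x \<in> E - I. a \<le> h x}" "sorted_list_of_set (h ` (E - I))"]
      unfolding om_ext_def up_sets_def Let_def by simp
  qed
  have int: "om_int N = int_chain"
  proof -
    have "pos_cocircuits N = D.pos" by (simp add: pos_cocircuits_def D.pos_def)
    moreover have "E - (E - I) = I" using I_sub by blast
    ultimately show ?thesis
      using D.pos_min D.pos_union
        map_nth'[of "\<lambda>a. E - {x \<in> I. a \<le> h x}" "sorted_list_of_set (h ` I)"]
      unfolding om_int_def up_sets_def Let_def by (simp add: o_def)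
  qed
  have sgn: "W x (Min {y \<in> A - G. W x y \<noteq> 0}) = -1"
    if "A - G = {x \<in> E. h x = a}" "x \<in> A - G" "x \<noteq> a" for A G a x
  proof -
    have x: "x \<in> E" "h x = a" using that by auto
    then have "\<not> active x" using active(1) that(3) by auto
    then have "W x (Min {y. W x y \<noteq> 0 \<and> h y = h x}) = -1"
      using opp x by (auto simp: opposite_signs_def active_def)
    moreover have "{y. W x y \<noteq> 0 \<and> h y = h x} = {y \<in> A - G. W x y \<noteq> 0}"
      using that(1) x V_E[OF B x(1)] by auto
    ultimately show ?thesis by simp
  qed
  have ints: "alpha_bounded (minor N (int_chain ! k) (int_chain ! (k - 1))) =
      B \<inter> (int_chain ! k - int_chain ! (k - 1))" if k: "k \<in> {1..<length int_chain}" for k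
  proof -
    interpret P: ordered_om_minor N "int_chain ! k" "int_chain ! (k - 1)" B
      by (rule internal_minor[OF k])
    obtain a where "a \<in> h ` E"
      and a: "a \<in> B" "int_chain ! k - int_chain ! (k - 1) = {x \<in> E. h x = a}" "P.uniactive a"
      by (rule internal_part[OF k])
    show ?thesis by (rule P.alpha_bounded_minor[OF a(3) sgn[OF a(2)] a(1)])
  qed
  have exts: "alpha_dual_bounded (minor N (ext_chain ! (k - 1)) (ext_chain ! k)) =
      B \<inter> (ext_chain ! (k - 1) - ext_chain ! k)" if k: "k \<in> {1..<length ext_chain}" for k
  proof -
    interpret P: ordered_om_minor N "ext_chain ! (k - 1)" "ext_chain ! k" B
      by (rule external_minor[OF k])
    obtain a where "a \<in> h ` E"
      and a: "a \<notin> B" "ext_chain ! (k - 1) - ext_chain ! k = {x \<in> E. h x = a}" "P.uniactive a"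
      by (rule external_part[OF k])
    show ?thesis by (rule P.alpha_dual_bounded_minor[OF a(3) sgn[OF a(2)] a(1)])
  qed
  have "alpha N = (\<Union>k\<in>{1..<length int_chain}. B \<inter> (int_chain ! k - int_chain ! (k - 1))) \<union>
      (\<Union>k\<in>{1..<length ext_chain}. B \<inter> (ext_chain ! (k - 1) - ext_chain ! k))"
    unfolding alpha_def om_active_filtration_def ext int using ints exts by simp
  also have "\<dots> = B"
  proof
    show "B \<subseteq> (\<Union>k\<in>{1..<length int_chain}. B \<inter> (int_chain ! k - int_chain ! (k - 1))) \<union>
      (\<Union>k\<in>{1..<length ext_chain}. B \<inter> (ext_chain ! (k - 1) - ext_chain ! k))"
    proof
      fix b assume b: "b \<in> B"
      then have bE: "b \<in> E" using bases_sub[OF B] by blast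
      show "b \<in> (\<Union>k\<in>{1..<length int_chain}. B \<inter> (int_chain ! k - int_chain ! (k - 1))) \<union>
        (\<Union>k\<in>{1..<length ext_chain}. B \<inter> (ext_chain ! (k - 1) - ext_chain ! k))"
      proof (cases "b \<in> I")
        case True
        then have bh: "b \<in> hd (up_sets I h)" by (simp only: hd_up_sets[OF fin(2)])
        define k where "k = level (up_sets I h) b"
        have k: "k \<in> {1..<length int_chain}" using level(1)[OF chain_decreasing(2) bh] by (simp add: k_def)
        have "b \<in> int_chain ! k - int_chain ! (k - 1)"
          unfolding int_chain_diff[OF k] using level(2)[OF chain_decreasing(2) bh] by (simp add: k_def)
        then show ?thesis using k b by blast
      next
        case False
        then have bh: "b \<in> hd ext_chain" using bE by (simp only: hd_up_sets[OF fin(1)] Diff_iff simp_thms)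
        show ?thesis
          using level(1)[OF chain_decreasing(1) bh] level(2)[OF chain_decreasing(1) bh] b by blast
      qed
    qed
  qed blast
  finally show ?thesis .
qed

end

section \<open>Reorientations and the procedure\<close>

definition flip :: "'a set \<Rightarrow> 'a signed_set \<Rightarrow> 'a signed_set" where
  "flip A X = (\<lambda>e. if e \<in> A then - X e else X e)"

lemma flip_simps [simp]:
  "supp (flip A X) = supp X" "flip A (flip A X) = X" "flip A X e = 0 \<longleftrightarrow> X e = 0"
  by (auto simp: flip_def supp_def)

lemma flip_uminus: "flip A (- X) = - flip A X"
  by (auto simp: flip_def)

lemma orthogonal_flip: "orthogonal (flip A X) (flip A Y) \<longleftrightarrow> orthogonal X Y"
proof -
  have "flip A X e * flip A Y e = X e * Y e" for e by (simp add: flip_def)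
  then show ?thesis by (simp add: orthogonal_def)
qed

lemma ground_reorientation [simp]: "ground (reorientation A M) = ground M"
  by (simp add: reorientation_def)

lemma circuits_reorientation: "circuits (reorientation A M) = flip A ` circuits M"
  by (simp add: reorientation_def flip_def)

lemma basis_reorientation [simp]: "basis (reorientation A M) = basis M"
proof -
  have "independent (reorientation A M) = independent M"
    by (auto simp: independent_def circuits_reorientation fun_eq_iff)
  then show ?thesis by (simp add: basis_def fun_eq_iff)
qed

lemma meets_bases_reorientation [simp]: "meets_bases (reorientation A M) = meets_bases M"
  by (simp add: meets_bases_def fun_eq_iff)

lemma cocircuits_reorientation:
  assumes Y: "Y \<in> cocircuits M"
  shows "flip A Y \<in> cocircuits (reorientation A M)"
proof -
  have "flip A Y e \<in> {-1, 0, 1}" for e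
  proof -
    have "Y e \<in> {-1, 0, 1}" using Y by (simp add: cocircuits_def)
    then show ?thesis by (auto simp: flip_def)
  qed
  then show ?thesis
    using Y by (simp add: cocircuits_def circuits_reorientation orthogonal_flip)
qed

lemma oriented_matroid_reorientation:
  assumes "oriented_matroid M"
  shows "oriented_matroid (reorientation A M)"
proof -
  interpret oriented_matroid M by (rule assms)
  have flip_inj: "flip A X = flip A Y \<longleftrightarrow> X = Y" for X Y :: "'a signed_set" by (metis flip_simps(2))
  show ?thesis
  proof
    show "finite (ground (reorientation A M))" using finite_ground by simp
    fix X' assume "X' \<in> circuits (reorientation A M)"
    then obtain X where X: "X \<in> circuits M" "X' = flip A X" by (auto simp: circuits_reorientation)
    show "X' e \<in> {-1, 0, 1}" for e using signs[OF X(1), of e] X(2) by (auto simp: flip_def)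
    show "supp X' \<subseteq> ground (reorientation A M)" "supp X' \<noteq> {}"
      using supp_subset[OF X(1)] supp_nonempty[OF X(1)] X(2) by auto
    show "- X' \<in> circuits (reorientation A M)"
      using symmetric[OF X(1)] X(2) by (auto simp: circuits_reorientation flip_uminus[symmetric])
    fix Y' assume "Y' \<in> circuits (reorientation A M)"
    then obtain Y where Y: "Y \<in> circuits M" "Y' = flip A Y" by (auto simp: circuits_reorientation)
    show "X' = Y' \<or> X' = - Y'" if "supp X' \<subseteq> supp Y'"
      using incomparable[OF X(1) Y(1)] that X(2) Y(2) flip_uminus[of A Y] by auto
    show "\<exists>Z\<in>circuits (reorientation A M). Z e = 0 \<and>
         (\<forall>f. Z f = 1 \<longrightarrow> X' f = 1 \<or> Y' f = 1) \<and> (\<forall>f. Z f = -1 \<longrightarrow> X' f = -1 \<or> Y' f = -1)"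
      if "X' \<noteq> - Y'" "X' e = 1" "Y' e = -1" for e
    proof -
      \<comment> \<open>Opposite signs at \<open>e\<close> after flipping are opposite before it, so
        elimination in \<open>M\<close> applies and its values flip along.\<close>
      have "X \<noteq> Y" "X \<noteq> - Y" using that X(2) Y(2) flip_uminus[of A Y] by auto
      moreover have "X e \<noteq> 0" "Y e \<noteq> 0" "X e * Y e = -1"
        using that X(2) Y(2) by (auto simp: flip_def split: if_splits)
      ultimately obtain Z where Z: "Z \<in> circuits M" "Z e = 0"
        "\<forall>f. Z f \<noteq> 0 \<longrightarrow> Z f = X f \<or> Z f = Y f"
        using eliminate[OF X(1) Y(1), of e] by auto
      have "flip A Z f = X' f \<or> flip A Z f = Y' f" if "flip A Z f \<noteq> 0" for f
      proof -
        have "Z f = X f \<or> Z f = Y f" using Z(3) that by simp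
        then show ?thesis unfolding X(2) Y(2) flip_def by metis
      qed
      then have "\<forall>f. flip A Z f = 1 \<longrightarrow> X' f = 1 \<or> Y' f = 1"
        "\<forall>f. flip A Z f = -1 \<longrightarrow> X' f = -1 \<or> Y' f = -1"
        by (metis zero_neq_one, metis neg_equal_0_iff_equal zero_neq_one)
      moreover have "flip A Z \<in> circuits (reorientation A M)" "flip A Z e = 0"
        using Z by (auto simp: circuits_reorientation)
      ultimately show ?thesis by blast
    qed
  qed
qed

definition sgn_of :: "'a set \<Rightarrow> 'a \<Rightarrow> int" where
  "sgn_of A x = (if x \<in> A then -1 else 1)"

text \<open>The factor at \<open>x\<close> restores the value 1 there, so reorienting conjugates the
  matrix by a diagonal of signs.\<close>

lemma om_vec_reorientation:
  assumes M: "oriented_matroid M" and B: "basis M B" and x: "x \<in> ground M"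
  shows "om_vec (reorientation A M) B x = (\<lambda>y. sgn_of A x * sgn_of A y * om_vec M B x y)"
proof -
  interpret M: dual_pair "ground M" "circuits M" "cocircuits M" "Collect (basis M)"
    by (rule oriented_matroid.om_dual_pair[OF M])
  let ?N = "reorientation A M"
  interpret N: dual_pair "ground ?N" "circuits ?N" "cocircuits ?N" "Collect (basis ?N)"
    by (rule oriented_matroid.om_dual_pair[OF oriented_matroid_reorientation[OF M]])
  let ?V = "\<lambda>y. sgn_of A x * sgn_of A y * om_vec M B x y"
  have V: "?V = (if x \<in> A then - flip A (om_vec M B x) else flip A (om_vec M B x))"
    by (auto simp: sgn_of_def flip_def)
  have self: "?V x = 1" using M.V_self[of B x] B x by (simp add: sgn_of_def)
  have supp: "supp ?V = supp (om_vec M B x)" by (auto simp: sgn_of_def supp_def)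
  show ?thesis
  proof (cases "x \<in> B")
    case True
    have "?V \<in> cocircuits ?N"
      unfolding V using cocircuits_reorientation[OF M.V_D[of B x]] N.D_uminus B True by simp
    moreover have "supp (om_vec M B x) \<subseteq> insert x (ground M - B)"
      using M.fund_D(1)[of B x] B True by (simp add: fund_vec_def)
    ultimately show ?thesis using N.V_D_eq[of B x ?V] B True self supp by simp
  next
    case False
    then have xB: "x \<in> ground M - B" using x by blast
    have "flip A (om_vec M B x) \<in> circuits ?N"
      using M.V_C[of B x] B xB by (simp add: circuits_reorientation)
    then have "?V \<in> circuits ?N" unfolding V using N.C_uminus by simp
    moreover have "supp (om_vec M B x) \<subseteq> insert x B"
      using M.fund_C(1)[of B x] B xB by (simp add: fund_vec_def)
    ultimately show ?thesis using N.V_C_eq[of B x ?V] B xB self supp by simp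
  qed
qed

section \<open>Runs of the procedure for one basis\<close>

locale oriented_matroid_basis = oriented_matroid M for M :: "'a::linorder om" +
  fixes B :: "'a set"
  assumes B: "basis M B"
begin

sublocale P: ordered_dual_pair "ground M" "circuits M" "cocircuits M" "Collect (basis M)"
  using om_dual_pair by (simp add: ordered_dual_pair_def)

abbreviation "E \<equiv> ground M"
abbreviation "W \<equiv> om_vec M B"

lemma BE: "B \<subseteq> E"
  using basis_sub[OF B] .

lemma W_facts:
  "x \<in> E \<Longrightarrow> W x x = 1" "x \<in> E \<Longrightarrow> W x y \<noteq> 0 \<Longrightarrow> y \<in> E"
  "x \<in> E \<Longrightarrow> W x y \<noteq> 0 \<Longrightarrow> y \<noteq> x \<Longrightarrow> y \<in> B \<longleftrightarrow> x \<notin> B"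
  "x \<in> E \<Longrightarrow> y \<in> E \<Longrightarrow> W x y \<noteq> 0 \<longleftrightarrow> W y x \<noteq> 0" "x \<in> E \<Longrightarrow> W x y \<in> {-1, 0, 1}"
  "x \<in> E \<Longrightarrow> finite {y. W x y \<noteq> 0}"
proof -
  have B': "B \<in> Collect (basis M)" using B by simp
  show "x \<in> E \<Longrightarrow> W x x = 1" by (rule P.V_self[OF B'])
  show "x \<in> E \<Longrightarrow> W x y \<noteq> 0 \<Longrightarrow> y \<in> E" by (rule P.V_E[OF B'])
  show "x \<in> E \<Longrightarrow> W x y \<noteq> 0 \<Longrightarrow> y \<noteq> x \<Longrightarrow> y \<in> B \<longleftrightarrow> x \<notin> B" by (rule P.V_side[OF B'])
  show "x \<in> E \<Longrightarrow> y \<in> E \<Longrightarrow> W x y \<noteq> 0 \<longleftrightarrow> W y x \<noteq> 0" by (rule P.V_adj[OF B'])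
  show "x \<in> E \<Longrightarrow> W x y \<in> {-1, 0, 1}" by (rule P.V_sign[OF B'])
  show "x \<in> E \<Longrightarrow> finite {y. W x y \<noteq> 0}" by (rule P.V_supp_finite[OF B'])
qed

definition act :: "'a \<Rightarrow> bool" where
  "act x \<longleftrightarrow> x = Min (supp (W x))"

lemma act_iff:
  assumes "x \<in> E"
  shows "act x \<longleftrightarrow> (\<forall>y. W x y \<noteq> 0 \<longrightarrow> x \<le> y)"
proof -
  have "finite (supp (W x))" "x \<in> supp (W x)"
    using W_facts(1,6)[OF assms] by (auto simp: supp_def)
  then have "Min (supp (W x)) = x \<longleftrightarrow> (\<forall>y\<in>supp (W x). x \<le> y)"
    by (metis Min_eqI Min_le)
  then show ?thesis unfolding act_def by (auto simp: supp_def)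
qed

lemma Int_act_eq: "Int_act M B = {x \<in> B. act x}"
  by (auto simp: Int_act_def act_def fund_cocircuit_om_vec)

lemma Ext_act_eq: "Ext_act M B = {x \<in> E - B. act x}"
  by (auto simp: Ext_act_def act_def fund_circuit_om_vec)

lemma act_eq: "Int_act M B \<union> Ext_act M B = {x \<in> E. act x}"
  using BE by (auto simp: Int_act_eq Ext_act_eq)

text \<open>The instructions for Part and the labels without the signs, read on a finished run. The
  label looked for first is Internal exactly if \<open>x \<notin> B\<close>.\<close>

definition rules :: "('a \<Rightarrow> 'a) \<Rightarrow> 'a set \<Rightarrow> bool" where
  "rules h I \<longleftrightarrow> I \<subseteq> E \<and>
     (\<forall>x\<in>E. act x \<longrightarrow> h x = x \<and> (x \<in> I \<longleftrightarrow> x \<in> B)) \<and>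
     (\<forall>x\<in>E. \<not> act x \<longrightarrow>
       (let below = {c. W x c \<noteq> 0 \<and> c < x}; first = {c \<in> below. c \<in> I \<longleftrightarrow> x \<notin> B} in
         if first \<noteq> {} then h x = Max (h ` first) \<and> (x \<in> I \<longleftrightarrow> x \<notin> B)
         else h x = Min (h ` below) \<and> (x \<in> I \<longleftrightarrow> x \<in> B)))"

text \<open>Let \<open>x \<in> B \<longleftrightarrow> x \<in> I\<close>. A smaller neighbour enters
  the minimum that defines \<open>h x\<close>; a greater neighbour \<open>y\<close> has
  \<open>x\<close> in its \<open>first\<close> set, so \<open>h x\<close> enters the maximum that
  defines \<open>h y\<close>. Both give \<open>h x \<le> h y\<close>.\<close>

lemma rules_valid:
  assumes "rules h I"
  shows "valid_part E B W h I"
proof -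
  have I: "I \<subseteq> E" and R1: "\<And>x. x \<in> E \<Longrightarrow> act x \<Longrightarrow> h x = x \<and> (x \<in> I \<longleftrightarrow> x \<in> B)"
    using assms by (auto simp: rules_def)
  define below where "below x = {c. W x c \<noteq> 0 \<and> c < x}" for x
  define first where "first x = {c \<in> below x. c \<in> I \<longleftrightarrow> x \<notin> B}" for x
  have R2: "if first x \<noteq> {} then h x = Max (h ` first x) \<and> (x \<in> I \<longleftrightarrow> x \<notin> B)
      else h x = Min (h ` below x) \<and> (x \<in> I \<longleftrightarrow> x \<in> B)" if "x \<in> E" "\<not> act x" for x
    using assms that unfolding rules_def Let_def first_def below_def by blast
  have fin: "finite (below x)" "finite (first x)" if "x \<in> E" for x
    by (rule finite_subset[OF _ W_facts(6)[OF that]], auto simp: below_def first_def)+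
  have ne: "below x \<noteq> {}" if "x \<in> E" "\<not> act x" for x
    using act_iff[OF that(1)] that(2) by (auto simp: below_def not_le)
  show ?thesis
    unfolding valid_part_def act_def[symmetric]
  proof (intro conjI ballI impI allI I)
    fix x y assume x: "x \<in> E" "x \<in> B \<longleftrightarrow> x \<in> I" "W x y \<noteq> 0"
    have yE: "y \<in> E" using W_facts(2)[OF x(1,3)] .
    have "(y \<in> I \<longleftrightarrow> x \<in> I) \<and> h x \<le> h y"
    proof (cases y x rule: linorder_cases)
      case less
      then have na: "\<not> act x" and yb: "y \<in> below x" using act_iff[OF x(1)] x(3) by (auto simp: below_def)
      have f: "first x = {}" using R2[OF x(1) na] x(2) by (auto split: if_splits)
      then have "h x = Min (h ` below x)" using R2[OF x(1) na] by simp
      moreover have "y \<in> I \<longleftrightarrow> x \<in> I" using f yb x(2) by (auto simp: first_def)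
      ultimately show ?thesis using yb fin(1)[OF x(1)] by simp
    next
      case greater
      have yx: "W y x \<noteq> 0" using W_facts(4)[OF x(1) yE] x(3) by blast
      then have na: "\<not> act y" using act_iff[OF yE] greater by auto
      have yB: "y \<in> B \<longleftrightarrow> x \<notin> B" using W_facts(3)[OF x(1,3)] greater by auto
      have xf: "x \<in> first y" using yx greater yB x(2) by (auto simp: first_def below_def)
      then have "first y \<noteq> {}" by blast
      then have "h y = Max (h ` first y) \<and> (y \<in> I \<longleftrightarrow> y \<notin> B)" using R2[OF yE na] by simp
      then show ?thesis using xf fin(2)[OF yE] yB x(2) by auto
    qed simp
    then show "y \<in> I \<longleftrightarrow> x \<in> I" "h x \<le> h y" by blast+
  next
    fix x assume x: "x \<in> E" "\<not> act x"
    show "\<exists>y<x. W x y \<noteq> 0 \<and> h y = h x \<and> (y \<in> I \<longleftrightarrow> x \<in> I)"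
    proof (cases "first x = {}")
      case True
      then have "h x = Min (h ` below x)" "x \<in> I \<longleftrightarrow> x \<in> B" using R2[OF x] by auto
      moreover have "Min (h ` below x) \<in> h ` below x" using fin(1)[OF x(1)] ne[OF x] by simp
      ultimately have "h x \<in> h ` below x" by simp
      then obtain y where y: "y \<in> below x" "h y = h x" by (metis imageE)
      have "y \<in> I \<longleftrightarrow> x \<in> I" using True y(1) \<open>x \<in> I \<longleftrightarrow> x \<in> B\<close> by (auto simp: first_def)
      then show ?thesis using y by (auto simp: below_def)
    next
      case False
      then have "h x = Max (h ` first x)" "x \<in> I \<longleftrightarrow> x \<notin> B" using R2[OF x] by auto
      moreover have "Max (h ` first x) \<in> h ` first x" using fin(2)[OF x(1)] False by simp
      ultimately have "h x \<in> h ` first x" by simp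
      then obtain y where y: "y \<in> first x" "h y = h x" by (metis imageE)
      then show ?thesis using \<open>x \<in> I \<longleftrightarrow> x \<notin> B\<close> by (auto simp: below_def first_def)
    qed
  next
    fix x assume "x \<in> E" "act x"
    then show "h x = x" "x \<in> I \<longleftrightarrow> x \<in> B" using R1 by blast+
  qed
qed

definition final :: "'a set \<Rightarrow> 'a state" where
  "final S = procedure M B S"

lemma step_other:
  assumes "y \<noteq> e"
  shows "part (procedure_step M B S e s) y = part s y"
    "label (procedure_step M B S e s) y = label s y"
    "y \<in> reoriented (procedure_step M B S e s) \<longleftrightarrow> y \<in> reoriented s"
  using assms by (auto simp: procedure_step_def assign_def assign_active_def Let_def)

lemma fold_step_other:
  assumes "y \<notin> set es"
  shows "part (fold (procedure_step M B S) es s) y = part s y"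
    "label (fold (procedure_step M B S) es s) y = label s y"
    "y \<in> reoriented (fold (procedure_step M B S) es s) \<longleftrightarrow> y \<in> reoriented s"
  using assms by (induction es arbitrary: s) (auto simp: step_other)

text \<open>Each step changes only the entries of its own element, so the state met by
  \<open>e\<close> is the final one restricted to the smaller elements.\<close>

lemma before_step:
  assumes e: "e \<in> E"
  shows "\<exists>s. (\<forall>y. part s y = (if y \<in> E \<and> y < e then part (final S) y else None)) \<and>
    (\<forall>y. label s y = (if y \<in> E \<and> y < e then label (final S) y else None)) \<and>
    (\<forall>y. y \<in> reoriented s \<longleftrightarrow> y \<in> E \<and> y < e \<and> y \<in> reoriented (final S)) \<and>
    part (final S) e = part (procedure_step M B S e s) e \<and>
    label (final S) e = label (procedure_step M B S e s) e \<and>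
    (e \<in> reoriented (final S) \<longleftrightarrow> e \<in> reoriented (procedure_step M B S e s))"
proof -
  define es where "es = sorted_list_of_set E"
  have es: "set es = E" "sorted_wrt (<) es" using finite_ground by (simp_all add: es_def)
  then obtain xs ys where xy: "es = xs @ e # ys" using e by (metis split_list)
  have xs: "set xs = {y \<in> E. y < e}" and ys: "y \<in> set ys \<Longrightarrow> e < y" for y
  proof -
    have 1: "\<forall>x\<in>set xs. x < e" "\<forall>y\<in>set ys. e < y"
      using es(2) unfolding xy by (auto simp: sorted_wrt_append)
    have E: "E = set xs \<union> {e} \<union> set ys" using es(1) xy by auto
    then show "set xs = {y \<in> E. y < e}" using 1 by (auto dest: less_asym)
    show "y \<in> set ys \<Longrightarrow> e < y" using 1 by blast
  qed
  let ?f = "fold (procedure_step M B S)"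
  define s0 :: "'a state" where "s0 = \<lparr>part = Map.empty, label = Map.empty, reoriented = {}\<rparr>"
  define s where "s = ?f xs s0"
  have final: "final S = ?f ys (procedure_step M B S e s)"
    by (simp add: final_def procedure_def es_def[symmetric] xy s_def s0_def)
  have e_ys: "e \<notin> set ys" using ys by blast
  have low: "part s y = part (final S) y \<and> label s y = label (final S) y \<and>
      (y \<in> reoriented s \<longleftrightarrow> y \<in> reoriented (final S))" if "y < e" for y
  proof -
    have "y \<notin> set ys" "y \<noteq> e" using that ys[of y] by auto
    then show ?thesis unfolding final by (simp add: fold_step_other step_other)
  qed
  have out: "part s y = None \<and> label s y = None \<and> y \<notin> reoriented s" if "\<not> (y \<in> E \<and> y < e)" for y
  proof -
    have "y \<notin> set xs" using that xs by simp
    then show ?thesis unfolding s_def by (simp add: fold_step_other s0_def)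
  qed
  show ?thesis
  proof (intro exI[of _ s] conjI allI)
    show "part s y = (if y \<in> E \<and> y < e then part (final S) y else None)" for y
      using low out by simp
    show "label s y = (if y \<in> E \<and> y < e then label (final S) y else None)" for y
      using low out by simp
    show "y \<in> reoriented s \<longleftrightarrow> y \<in> E \<and> y < e \<and> y \<in> reoriented (final S)" for y
      using low out by blast
    show "part (final S) e = part (procedure_step M B S e s) e"
      "label (final S) e = label (procedure_step M B S e s) e"
      "e \<in> reoriented (final S) \<longleftrightarrow> e \<in> reoriented (procedure_step M B S e s)"
      unfolding final by (rule fold_step_other[OF e_ys])+
  qed
qed

definition part_map :: "'a set \<Rightarrow> 'a \<Rightarrow> 'a" where
  "part_map S x = the (part (final S) x)"

definition internal_set :: "'a set \<Rightarrow> 'a set" where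
  "internal_set S = {x \<in> E. label (final S) x = Some Internal}"

definition reoriented_set :: "'a set \<Rightarrow> 'a set" where
  "reoriented_set S = reoriented (final S)"

lemma reoriented_set_sub: "reoriented_set S \<subseteq> E"
proof
  fix y assume "y \<in> reoriented_set S"
  then show "y \<in> E"
    using fold_step_other(3)[of y "sorted_list_of_set E" S] finite_ground
    by (fastforce simp: reoriented_set_def final_def procedure_def)
qed

lemma active_step:
  assumes e: "e \<in> E" "act e"
  shows "part (final S) e = Some e" "label (final S) e = Some (if e \<in> B then Internal else External)"
    "e \<in> reoriented_set S \<longleftrightarrow> e \<in> S"
proof -
  obtain s where s:
    "\<forall>y. y \<in> reoriented s \<longleftrightarrow> y \<in> E \<and> y < e \<and> y \<in> reoriented (final S)"
    "part (final S) e = part (procedure_step M B S e s) e"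
    "label (final S) e = label (procedure_step M B S e s) e"
    "e \<in> reoriented (final S) \<longleftrightarrow> e \<in> reoriented (procedure_step M B S e s)"
    using before_step[OF e(1), of S] by blast
  have eR: "e \<notin> reoriented s" using s(1) by blast
  have step: "procedure_step M B S e s = assign_active (if e \<in> B then Internal else External) S e s"
    using e by (auto simp: procedure_step_def Int_act_eq Ext_act_eq Let_def)
  show "part (final S) e = Some e"
    "label (final S) e = Some (if e \<in> B then Internal else External)" "e \<in> reoriented_set S \<longleftrightarrow> e \<in> S"
    unfolding reoriented_set_def s(2-4) step assign_active_def using eR by simp_all
qed

lemma om_vec_current:
  assumes "e \<in> E" "e \<notin> R"
  shows "(if e \<in> B then fund_cocircuit (reorientation R M) B e else fund_circuit (reorientation R M) B e)
    = (\<lambda>y. sgn_of R y * W e y)"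
proof -
  have "om_vec (reorientation R M) B e = (\<lambda>y. sgn_of R y * W e y)"
    using om_vec_reorientation[OF oriented_matroid_axioms B assms(1), of R] assms(2)
    by (simp add: sgn_of_def)
  then show ?thesis by (simp add: fund_cocircuit_om_vec fund_circuit_om_vec)
qed

text \<open>Rewrites a step in terms of the final maps. The delicate point is \<open>a\<close>: the
  procedure takes a minimum over the elements treated so far, the sign condition over the whole
  part.\<close>

lemma inactive_step:
  assumes e: "e \<in> E" "\<not> act e"
    and prev: "\<And>y. y \<in> E \<Longrightarrow> y < e \<Longrightarrow> part (final S) y \<noteq> None"
  defines "l \<equiv> if e \<in> B then External else Internal" and "l' \<equiv> if e \<in> B then Internal else External"
  defines "below \<equiv> {c. W e c \<noteq> 0 \<and> c < e}"
  defines "first \<equiv> {c \<in> below. label (final S) c = Some l}"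
  shows "part (final S) e = Some (if first \<noteq> {} then Max (part_map S ` first) else Min (part_map S ` below))"
    "label (final S) e = Some (if first \<noteq> {} then l else l')"
    "sgn_of (reoriented_set S) e * sgn_of (reoriented_set S) (Min {y. W e y \<noteq> 0 \<and> part_map S y = part_map S e}) *
      W e (Min {y. W e y \<noteq> 0 \<and> part_map S y = part_map S e}) = -1"
proof -
  obtain s where s_all:
    "\<forall>y. part s y = (if y \<in> E \<and> y < e then part (final S) y else None)"
    "\<forall>y. label s y = (if y \<in> E \<and> y < e then label (final S) y else None)"
    "\<forall>y. y \<in> reoriented s \<longleftrightarrow> y \<in> E \<and> y < e \<and> y \<in> reoriented_set S"
    "part (final S) e = part (procedure_step M B S e s) e"
    "label (final S) e = label (procedure_step M B S e s) e"
    "e \<in> reoriented_set S \<longleftrightarrow> e \<in> reoriented (procedure_step M B S e s)"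
    using before_step[OF e(1), of S] unfolding reoriented_set_def by blast
  note s = s_all(1-3)[rule_format] s_all(4-6)
  define X where "X = (\<lambda>y. sgn_of (reoriented s) y * W e y)"
  have eR: "e \<notin> reoriented s" using s(3) by blast
  have step: "procedure_step M B S e s = assign l l' X e s"
    using e om_vec_current[OF e(1) eR]
    by (auto simp: procedure_step_def Int_act_eq Ext_act_eq Let_def l_def l'_def X_def)
  have X0: "X y = 0 \<longleftrightarrow> W e y = 0" for y by (simp add: X_def sgn_of_def)
  have suppX: "supp X = {y. W e y \<noteq> 0}" by (auto simp: supp_def X0)
  have belowE: "c \<in> E" if "c \<in> below" for c using that W_facts(2)[OF e(1)] by (auto simp: below_def)
  have below: "{c \<in> supp X. c < e} = below" by (auto simp: below_def suppX)
  have first: "{c \<in> below. label s c = Some l} = first"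
    using s(2) belowE by (auto simp: first_def below_def)
  have hs: "the (part s c) = part_map S c" if "c \<in> below" for c
    using s(1) belowE[OF that] that by (simp add: part_map_def below_def)
  have fin: "finite below" "finite first"
    by (rule finite_subset[OF _ W_facts(6)[OF e(1)]], auto simp: below_def first_def)+
  have ne: "below \<noteq> {}" using act_iff[OF e(1)] e(2) by (auto simp: below_def not_le)
  define d where "d = (if first \<noteq> {} then Max (part_map S ` first) else Min (part_map S ` below))"
  have "(\<lambda>c. the (part s c)) ` first = part_map S ` first" "(\<lambda>c. the (part s c)) ` below = part_map S ` below"
    using hs by (auto simp: first_def image_iff)
  then have assign: "assign l l' X e s =
      (let a = Min {a \<in> supp X. ((part s)(e \<mapsto> d)) a = Some d} in
       \<lparr>part = (part s)(e \<mapsto> d), label = (label s)(e \<mapsto> (if first \<noteq> {} then l else l')),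
        reoriented = (if X e = - X a then reoriented s else insert e (reoriented s))\<rparr>)"
    unfolding assign_def Let_def below first d_def by simp
  show p: "part (final S) e = Some (if first \<noteq> {} then Max (part_map S ` first) else Min (part_map S ` below))"
    using s(4) unfolding step assign by (simp add: Let_def d_def)
  show "label (final S) e = Some (if first \<noteq> {} then l else l')"
    using s(5) unfolding step assign by (simp add: Let_def)
  have hd: "part_map S e = d" using p by (simp add: part_map_def d_def)
  have "d \<in> part_map S ` below"
  proof (cases "first = {}")
    case True
    then show ?thesis using fin ne by (simp add: d_def)
  next
    case False
    then have "Max (part_map S ` first) \<in> part_map S ` first" using fin by simp
    then show ?thesis using False by (auto simp: d_def first_def)
  qed
  then obtain c where c: "c \<in> below" "part_map S c = d" by auto
  define T where "T = {y. W e y \<noteq> 0 \<and> part_map S y = part_map S e}"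
  define T' where "T' = {a \<in> supp X. ((part s)(e \<mapsto> d)) a = Some d}"
  \<comment> \<open>The part known at this moment is the final part cut off at \<open>e\<close>. It
    contains the smaller element \<open>c\<close>, so both sets have the same minimum.\<close>
  have T': "y \<in> T' \<longleftrightarrow> y \<in> T \<and> y \<le> e" for y
  proof (cases "y = e")
    case True
    then show ?thesis using hd W_facts(1)[OF e(1)] by (auto simp: T_def T'_def suppX)
  next
    case False
    have "part s y = Some d \<longleftrightarrow> y < e \<and> part_map S y = d" if "y \<in> E"
      using s(1)[of y] prev[OF that] that by (auto simp: part_map_def)
    then show ?thesis using False hd W_facts(2)[OF e(1), of y] by (auto simp: T_def T'_def suppX)
  qed
  define a where "a = Min T"
  have finT: "finite T" by (rule finite_subset[OF _ W_facts(6)[OF e(1)]]) (auto simp: T_def)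
  have cT: "c \<in> T" "c < e" using c hd by (auto simp: T_def below_def)
  then have "a \<in> T" "a \<le> c" using finT by (auto simp: a_def intro: Min_in)
  then have ae: "a < e" "W e a \<noteq> 0" "a \<in> E" using cT W_facts(2)[OF e(1)] by (auto simp: T_def)
  have "Min T' = a"
  proof (rule Min_eqI)
    show "finite T'" using finite_subset[OF _ finT, of T'] T' by blast
    show "a \<in> T'" using T' \<open>a \<in> T\<close> ae by simp
    show "a \<le> y" if "y \<in> T'" for y using that T' finT by (simp add: a_def)
  qed
  then have eA: "e \<in> reoriented_set S \<longleftrightarrow> X e \<noteq> - X a"
    using s(6) eR unfolding step assign T'_def[symmetric] by (auto simp: Let_def)
  have Xe: "X e = 1" using W_facts(1)[OF e(1)] eR by (simp add: X_def sgn_of_def)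
  have Xa: "X a = sgn_of (reoriented_set S) a * W e a" using s(3)[of a] ae by (simp add: X_def sgn_of_def)
  have "X a = 1 \<or> X a = -1"
    using W_facts(5)[OF e(1), of a] ae by (auto simp: X_def sgn_of_def)
  then have "sgn_of (reoriented_set S) e * X a = -1" using eA Xe by (auto simp: sgn_of_def)
  then show "sgn_of (reoriented_set S) e * sgn_of (reoriented_set S) (Min {y. W e y \<noteq> 0 \<and> part_map S y = part_map S e}) *
      W e (Min {y. W e y \<noteq> 0 \<and> part_map S y = part_map S e}) = -1"
    unfolding T_def[symmetric] a_def[symmetric] using Xa by (simp add: mult.assoc)
qed

lemma part_defined: "e \<in> E \<Longrightarrow> part (final S) e \<noteq> None \<and> label (final S) e \<noteq> None"
proof -
  assume "e \<in> E"
  with finite_ground show "part (final S) e \<noteq> None \<and> label (final S) e \<noteq> None"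
  proof (induction e rule: finite_less_induct)
    case (less e)
    then have prev: "\<And>y. y \<in> E \<Longrightarrow> y < e \<Longrightarrow> part (final S) y \<noteq> None" by blast
    show ?case
      using active_step(1,2)[OF less(1), of S] inactive_step(1,2)[OF less(1) _ prev] by (cases "act e") auto
  qed
qed

lemma part_undefined: "e \<notin> E \<Longrightarrow> part (final S) e = None \<and> label (final S) e = None"
  using fold_step_other(1,2)[of e "sorted_list_of_set E" S] finite_ground
  by (simp add: final_def procedure_def)

lemma rules_procedure: "rules (part_map S) (internal_set S)"
  unfolding rules_def
proof (intro conjI ballI impI)
  show "internal_set S \<subseteq> E" by (auto simp: internal_set_def)
  show "part_map S x = x" "x \<in> internal_set S \<longleftrightarrow> x \<in> B" if "x \<in> E" "act x" for x
    using active_step[OF that, of S] that by (auto simp: part_map_def internal_set_def)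
  fix x assume x: "x \<in> E" "\<not> act x"
  define below where "below = {c. W x c \<noteq> 0 \<and> c < x}"
  define l where "l = (if x \<in> B then External else Internal)"
  define l' where "l' = (if x \<in> B then Internal else External)"
  define first where "first = {c \<in> below. label (final S) c = Some l}"
  have "c \<in> E" if "c \<in> below" for c using that W_facts(2)[OF x(1)] by (auto simp: below_def)
  then have first: "first = {c \<in> below. c \<in> internal_set S \<longleftrightarrow> x \<notin> B}"
    using part_defined[of _ S] by (auto simp: first_def l_def internal_set_def) (metis not_None_eq side.exhaust)+
  have "part (final S) x = Some (if first \<noteq> {} then Max (part_map S ` first) else Min (part_map S ` below))"
    "label (final S) x = Some (if first \<noteq> {} then l else l')"
    using inactive_step(1,2)[OF x, of S] part_defined
    unfolding first_def below_def l_def l'_def by blast+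
  then show "let below = {c. W x c \<noteq> 0 \<and> c < x}; first = {c \<in> below. c \<in> internal_set S \<longleftrightarrow> x \<notin> B} in
         if first \<noteq> {} then part_map S x = Max (part_map S ` first) \<and> (x \<in> internal_set S \<longleftrightarrow> x \<notin> B)
         else part_map S x = Min (part_map S ` below) \<and> (x \<in> internal_set S \<longleftrightarrow> x \<in> B)"
    unfolding below_def[symmetric] Let_def first[symmetric] using x(1)
    by (auto simp: part_map_def internal_set_def l_def l'_def)
qed

lemma om_partition_M: "om_partition M B (part_map S) (internal_set S)"
  using P.ordered_dual_pair_axioms B rules_valid[OF rules_procedure]
  by (simp add: om_partition_def valid_partition_def valid_partition_axioms_def)

text \<open>Different choices \<open>S\<close> give valid partitions of the same \<open>B\<close>,
  of which there is only one.\<close>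

lemma part_map_unique:
  assumes "x \<in> E"
  shows "part_map S x = part_map S' x" "x \<in> internal_set S \<longleftrightarrow> x \<in> internal_set S'"
proof -
  interpret Q: om_partition M B "part_map S" "internal_set S" by (rule om_partition_M)
  show "part_map S x = part_map S' x" "x \<in> internal_set S \<longleftrightarrow> x \<in> internal_set S'"
    using Q.valid_partition_unique[OF rules_valid[OF rules_procedure] assms] by blast+
qed

lemma part_map_props:
  assumes "x \<in> E"
  shows "part_map S x \<in> E" "act (part_map S x)" "part_map S x \<in> B \<longleftrightarrow> x \<in> internal_set S" "act x \<Longrightarrow> part_map S x = x"
    "\<not> act x \<Longrightarrow> \<exists>y\<in>E. y < x \<and> W x y \<noteq> 0 \<and> part_map S y = part_map S x"
proof -
  interpret Q: om_partition M B "part_map S" "internal_set S" by (rule om_partition_M)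
  have act: "Q.active y = act y" for y by (simp add: Q.active_def act_def)
  show "part_map S x \<in> E" "act (part_map S x)" "part_map S x \<in> B \<longleftrightarrow> x \<in> internal_set S"
    using Q.h_props[OF assms] Q.h_label_B[OF assms] act by auto
  show "part_map S x = x" if "act x" using Q.active(1)[OF assms] act that by simp
  show "\<exists>y\<in>E. y < x \<and> W x y \<noteq> 0 \<and> part_map S y = part_map S x" if "\<not> act x"
    using Q.inactive[OF assms] act that by metis
qed

lemma part_map_Int_Ext:
  assumes "x \<in> E"
  shows "part_map S x \<in> Int_act M B \<longleftrightarrow> x \<in> internal_set S" "part_map S x \<in> Ext_act M B \<longleftrightarrow> x \<notin> internal_set S"
  using part_map_props[OF assms, of S] by (auto simp: Int_act_eq Ext_act_eq)

lemma procedure_output: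
  "let s = procedure M B S in
    dom (part s) = E \<and> dom (label s) = E \<and> ran (part s) \<subseteq> Int_act M B \<union> Ext_act M B \<and>
    (\<forall>e\<in>E.
       (\<exists>P\<in>active_partition M B. e \<in> P \<and> part s e = Some (Min P)) \<and>
       (label s e = Some Internal \<longleftrightarrow> the (part s e) \<in> Int_act M B) \<and>
       (label s e = Some External \<longleftrightarrow> the (part s e) \<in> Ext_act M B))"
proof -
  interpret Q: om_partition M B "part_map S" "internal_set S" by (rule om_partition_M)
  have p: "part (final S) e = Some (part_map S e)" if "e \<in> E" for e
    using part_defined[OF that, of S] by (auto simp: part_map_def)
  have dom: "dom (part (final S)) = E" "dom (label (final S)) = E"
  proof -
    have "x \<in> dom (part (final S)) \<longleftrightarrow> x \<in> E" "x \<in> dom (label (final S)) \<longleftrightarrow> x \<in> E" for x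
      unfolding domIff using part_defined[of x S] part_undefined[of x S] by metis+
    then show "dom (part (final S)) = E" "dom (label (final S)) = E" by blast+
  qed
  have ran: "ran (part (final S)) \<subseteq> Int_act M B \<union> Ext_act M B"
  proof
    fix a assume "a \<in> ran (part (final S))"
    then obtain e where e: "part (final S) e = Some a" by (auto simp: ran_def)
    then have "e \<in> E" using dom by blast
    then show "a \<in> Int_act M B \<union> Ext_act M B" using p[of e] e part_map_Int_Ext[of e S] by auto
  qed
  have lab: "label (final S) e = Some Internal \<longleftrightarrow> e \<in> internal_set S"
    "label (final S) e = Some External \<longleftrightarrow> e \<notin> internal_set S" if "e \<in> E" for e
    using part_defined[OF that, of S] that by (auto simp: internal_set_def) (metis side.exhaust)
  have "(\<exists>P\<in>active_partition M B. e \<in> P \<and> part (final S) e = Some (Min P)) \<and>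
       (label (final S) e = Some Internal \<longleftrightarrow> the (part (final S) e) \<in> Int_act M B) \<and>
       (label (final S) e = Some External \<longleftrightarrow> the (part (final S) e) \<in> Ext_act M B)"
    if e: "e \<in> E" for e
    using Q.active_partition_Min[OF e] p[OF e] lab[OF e] part_map_Int_Ext[OF e, of S] by auto
  then show ?thesis using dom ran unfolding final_def Let_def by blast
qed

text \<open>The partition stays valid because reorienting preserves the zero pattern, and the steps
  have arranged the signs required by \<open>opposite_signs\<close>.\<close>

lemma alpha_procedure: "alpha (reorientation (reoriented_set S) M) = B"
proof -
  let ?N = "reorientation (reoriented_set S) M"
  interpret N: oriented_matroid ?N
    by (rule oriented_matroid_reorientation[OF oriented_matroid_axioms])
  have V: "om_vec ?N B x = (\<lambda>y. sgn_of (reoriented_set S) x * sgn_of (reoriented_set S) y * W x y)" if "x \<in> E" for x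
    using om_vec_reorientation[OF oriented_matroid_axioms B that] .
  have 0: "om_vec ?N B x y = 0 \<longleftrightarrow> W x y = 0" if "x \<in> E" for x y
    using V[OF that] by (simp add: sgn_of_def)
  have "valid_part E B (om_vec ?N B) (part_map S) (internal_set S)"
    by (rule valid_part_cong[OF rules_valid[OF rules_procedure] 0])
  then interpret N: om_partition ?N B "part_map S" "internal_set S"
    using N.om_dual_pair B
    by (simp add: om_partition_def valid_partition_def valid_partition_axioms_def ordered_dual_pair_def)
  have "opposite_signs (ground ?N) (om_vec ?N B) (part_map S)"
    unfolding opposite_signs_def
  proof (intro ballI impI)
    fix x assume x: "x \<in> ground ?N" "x \<noteq> Min (supp (om_vec ?N B x))"
    have xE: "x \<in> E" using x by simp
    have "supp (om_vec ?N B x) = supp (W x)" using 0[OF xE] by (simp add: supp_def)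
    then have "\<not> act x" using x(2) by (simp add: act_def)
    moreover have "{y. om_vec ?N B x y \<noteq> 0 \<and> part_map S y = part_map S x} = {y. W x y \<noteq> 0 \<and> part_map S y = part_map S x}"
      using 0[OF xE] by simp
    ultimately show "om_vec ?N B x (Min {y. om_vec ?N B x y \<noteq> 0 \<and> part_map S y = part_map S x}) = -1"
      using inactive_step(3)[OF xE, of S] part_defined V[OF xE] by simp
  qed
  then show ?thesis by (rule N.opposite_alpha)
qed

lemma reoriented_set_active: "x \<in> E \<Longrightarrow> act x \<Longrightarrow> x \<in> reoriented_set S \<longleftrightarrow> x \<in> S"
  by (rule active_step(3))

text \<open>The sign relation ties \<open>x\<close> to a smaller element \<open>a\<close> of its
  part, so two runs that differ at an active element differ on its whole part.\<close>

lemma reoriented_set_difference: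
  assumes "x \<in> E"
  shows "(x \<in> reoriented_set S \<longleftrightarrow> x \<in> reoriented_set S') \<longleftrightarrow> (part_map S x \<in> S \<longleftrightarrow> part_map S x \<in> S')"
  using finite_ground assms
proof (induction x rule: finite_less_induct)
  case (less x)
  show ?case
  proof (cases "act x")
    case True
    then show ?thesis using reoriented_set_active[OF less(1) True] part_map_props(4)[OF less(1) True] by simp
  next
    case False
    define T where "T = {y. W x y \<noteq> 0 \<and> part_map S y = part_map S x}"
    have T': "{y. W x y \<noteq> 0 \<and> part_map S' y = part_map S' x} = T"
      using part_map_unique(1)[of _ S S'] W_facts(2)[OF less(1)] less(1) by (auto simp: T_def)
    have finT: "finite T" by (rule finite_subset[OF _ W_facts(6)[OF less(1)]]) (auto simp: T_def)
    obtain y where y: "y \<in> T" "y < x" using part_map_props(5)[OF less(1) False, of S] by (auto simp: T_def)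
    define a where "a = Min T"
    have "a \<in> T" "a \<le> y" using finT y by (auto simp: a_def intro: Min_in)
    then have a: "a \<in> E" "a < x" "part_map S a = part_map S x" using y W_facts(2)[OF less(1)] by (auto simp: T_def)
    have "sgn_of (reoriented_set S) x * sgn_of (reoriented_set S) a * W x a = -1"
      "sgn_of (reoriented_set S') x * sgn_of (reoriented_set S') a * W x a = -1"
      using inactive_step(3)[OF less(1) False, of S] inactive_step(3)[OF less(1) False, of S']
        part_defined unfolding T' T_def[symmetric] a_def[symmetric] by blast+
    then have "(x \<in> reoriented_set S \<longleftrightarrow> x \<in> reoriented_set S') \<longleftrightarrow> (a \<in> reoriented_set S \<longleftrightarrow> a \<in> reoriented_set S')"
      by (auto simp: sgn_of_def split: if_splits)
    then show ?thesis using less(2)[OF a(1,2)] a(3) by simp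
  qed
qed

lemma reoriented_set_inj: "inj_on reoriented_set (Pow {x \<in> E. act x})"
  by (rule inj_onI) (use reoriented_set_active in blast)

lemma reoriented_set_sym_diff:
  assumes "S \<subseteq> {x \<in> E. act x}" "T \<subseteq> {x \<in> E. act x}"
  shows "sym_diff (reoriented_set S) {e \<in> E. part_map S' e \<in> T} = reoriented_set (sym_diff S T)"
proof (intro set_eqI)
  fix x
  show "x \<in> sym_diff (reoriented_set S) {e \<in> E. part_map S' e \<in> T} \<longleftrightarrow> x \<in> reoriented_set (sym_diff S T)"
  proof (cases "x \<in> E")
    case True
    then show ?thesis
      using reoriented_set_difference[OF True, of S "sym_diff S T"] part_map_unique(1)[OF True, of S S'] by auto
  next
    case False
    then show ?thesis using reoriented_set_sub by blast
  qed
qed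

end

section \<open>Counting reorientations\<close>

text \<open>A basis that is optimal for the greedy algorithm when the elements of \<open>A\<close> come first, the
  larger ones before the smaller ones, and then the other elements, the smaller ones before the
  larger ones.\<close>

lemma basis_for_subset:
  fixes M :: "'a::linorder om"
  assumes M: "oriented_matroid M" and A: "A \<subseteq> ground M"
  shows "\<exists>B. basis M B \<and> B - A \<subseteq> Int_act M B \<and> A - B \<subseteq> Ext_act M B"
proof -
  interpret oriented_matroid M by (rule M)
  define n where "n = card (ground M)"
  define idx where "idx x = card {y \<in> ground M. y \<le> x}" for x
  \<comment> \<open>The greedy order as weights. \<open>idx\<close> is positive on the ground set,
    which separates \<open>A\<close> from the rest, and at most \<open>n\<close>, which keeps the
    subtraction exact.\<close>
  define w where "w x = (if x \<in> A then n + idx x else n - idx x)" for x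
  have fin: "finite {y \<in> ground M. y \<le> x}" for x using finite_ground by simp
  have idx_le: "idx x \<le> n" for x
    unfolding idx_def n_def using finite_ground by (intro card_mono) auto
  have idx_pos: "idx x > 0" if "x \<in> ground M" for x
    unfolding idx_def using that fin by (auto simp: card_gt_0_iff)
  have idx_mono: "x \<le> y" if "y \<in> ground M" "idx x \<le> idx y" "x \<in> ground M" for x y
  proof (rule ccontr)
    assume "\<not> x \<le> y"
    then have "{z \<in> ground M. z \<le> y} \<subset> {z \<in> ground M. z \<le> x}" using that(3) by auto
    then have "idx y < idx x" unfolding idx_def using fin by (intro psubset_card_mono)
    then show False using that by simp
  qed
  have bases: "finite {B. basis M B}"
    by (rule finite_subset[of _ "Pow (ground M)"]) (use basis_sub finite_ground in auto)
  obtain B0 where B0: "basis M B0"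
    using independent_extend[OF finite_ground, of "{}"] supp_nonempty by (auto simp: independent_def)
  define m where "m = Max (sum w ` {B. basis M B})"
  have "m \<in> sum w ` {B. basis M B}" unfolding m_def using bases B0 by (intro Max_in) auto
  then obtain B where B: "basis M B" "sum w B = m" by auto
  have max: "sum w B' \<le> sum w B" if "basis M B'" for B'
    using that bases B(2) by (simp add: m_def)
  interpret oriented_matroid_basis M B by unfold_locales (rule B(1))
  have finB: "finite B" using BE finite_ground finite_subset by blast
  have w_le: "w e \<le> w b" if e: "e \<in> ground M - B" and b: "b \<in> B" and nz: "W e b \<noteq> 0" for e b
  proof -
    have "basis M (insert e (B - {b}))" using P.exchange_V[of B e b] B e b nz by simp
    then have "sum w (insert e (B - {b})) \<le> sum w B" by (rule max)
    moreover have "sum w (insert e (B - {b})) = w e + sum w (B - {b})" using e finB by simp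
    moreover have "sum w B = w b + sum w (B - {b})" using finB b by (simp add: sum.remove)
    ultimately show ?thesis by simp
  qed
  have "b \<in> Int_act M B" if b: "b \<in> B - A" for b
  proof -
    have bE: "b \<in> ground M" using b BE by blast
    have "b \<le> y" if nz: "W b y \<noteq> 0" for y
    proof (cases "y = b")
      case False
      have yE: "y \<in> ground M" using W_facts(2)[OF bE nz] .
      have yB: "y \<notin> B" using W_facts(3)[OF bE nz False] b by blast
      have "w y \<le> w b" using w_le[of y b] W_facts(4)[OF bE yE] nz yE yB b by blast
      then have "idx b \<le> idx y"
        using idx_le[of b] idx_le[of y] idx_pos[OF bE] b by (auto simp: w_def split: if_splits)
      then show ?thesis using idx_mono[OF yE _ bE] by blast
    qed simp
    then show ?thesis using act_iff[OF bE] b by (simp add: Int_act_eq)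
  qed
  moreover have "e \<in> Ext_act M B" if e: "e \<in> A - B" for e
  proof -
    have eE: "e \<in> ground M" using e A by blast
    have "e \<le> y" if nz: "W e y \<noteq> 0" for y
    proof (cases "y = e")
      case False
      have yE: "y \<in> ground M" using W_facts(2)[OF eE nz] .
      have yB: "y \<in> B" using W_facts(3)[OF eE nz False] e by blast
      have "w e \<le> w y" using w_le[of e y] nz eE yB e by blast
      then have "idx e \<le> idx y"
        using idx_pos[OF eE] e by (auto simp: w_def split: if_splits)
      then show ?thesis using idx_mono[OF yE _ eE] by blast
    qed simp
    then show ?thesis using act_iff[OF eE] e eE by (simp add: Ext_act_eq)
  qed
  ultimately show ?thesis using B(1) by blast
qed

lemma procedure_surjective:
  fixes M :: "'a::linorder om"
  assumes M: "oriented_matroid M" and A: "A \<subseteq> ground M"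
  shows "\<exists>B S. basis M B \<and> S \<subseteq> Int_act M B \<union> Ext_act M B \<and> A = reoriented (procedure M B S)"
proof -
  interpret oriented_matroid M by (rule M)
  define T where "T = (SIGMA B:{B. basis M B}. Pow (Int_act M B \<union> Ext_act M B))"
  define \<Phi> where "\<Phi> = (\<lambda>(B, S). reoriented (procedure M B S))"
  \<comment> \<open>\<open>S\<close> is the set of active elements toggled in \<open>B\<close>,
    which parametrises the interval attached to \<open>B\<close>.\<close>
  define \<Psi> where "\<Psi> = (\<lambda>(B, S). (B - S \<inter> Int_act M B) \<union> (S \<inter> Ext_act M B))"
  have loc: "oriented_matroid_basis M B" if "basis M B" for B
    using that by (simp add: oriented_matroid_basis_def oriented_matroid_basis_axioms_def M)
  have acts: "Int_act M B \<subseteq> B" "Ext_act M B \<subseteq> ground M - B" for B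
    by (auto simp: Int_act_def Ext_act_def)
  have reoriented_set: "reoriented (procedure M B S) = oriented_matroid_basis.reoriented_set M B S" if "basis M B" for B S
    using loc[OF that] by (simp add: oriented_matroid_basis.reoriented_set_def oriented_matroid_basis.final_def)
  have finT: "finite T"
  proof -
    have "finite {B. basis M B}"
      by (rule finite_subset[of _ "Pow (ground M)"]) (use basis_sub finite_ground in auto)
    moreover have "finite (Int_act M B \<union> Ext_act M B)" if "basis M B" for B
      using acts[of B] basis_sub[OF that] finite_ground finite_subset by (metis Diff_subset finite_UnI)
    ultimately show ?thesis unfolding T_def by (intro finite_SigmaI) auto
  qed
  \<comment> \<open>\<open>alpha\<close> of the reoriented matroid gives back the basis, and the
    active elements that were reoriented give back the choices.\<close>
  have inj: "inj_on \<Phi> T"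
  proof (rule inj_onI)
    fix p q assume p: "p \<in> T" and q: "q \<in> T" and eq: "\<Phi> p = \<Phi> q"
    obtain B S B' S' where pq: "p = (B, S)" "q = (B', S')" by (cases p; cases q) auto
    then have B: "basis M B" "S \<subseteq> Int_act M B \<union> Ext_act M B"
      and B': "basis M B'" "S' \<subseteq> Int_act M B' \<union> Ext_act M B'" using p q by (auto simp: T_def)
    have AA: "oriented_matroid_basis.reoriented_set M B S = oriented_matroid_basis.reoriented_set M B' S'"
      using eq reoriented_set[OF B(1)] reoriented_set[OF B'(1)] by (simp add: pq \<Phi>_def)
    then have BB: "B = B'"
      using oriented_matroid_basis.alpha_procedure[OF loc[OF B(1)], of S]
        oriented_matroid_basis.alpha_procedure[OF loc[OF B'(1)], of S'] by simp
    then have "S = S'"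
      using inj_onD[OF oriented_matroid_basis.reoriented_set_inj[OF loc[OF B(1)]], of S S'] AA B(2) B'(2)
        oriented_matroid_basis.act_eq[OF loc[OF B(1)]] by simp
    then show "p = q" using pq BB by simp
  qed
  have "\<Psi> ` T \<supseteq> Pow (ground M)"
  proof
    fix X assume "X \<in> Pow (ground M)"
    then obtain B where B: "basis M B" "B - X \<subseteq> Int_act M B" "X - B \<subseteq> Ext_act M B"
      using basis_for_subset[OF M] by blast
    have "X = \<Psi> (B, sym_diff X B)" using B acts[of B] by (auto simp: \<Psi>_def)
    moreover have "(B, sym_diff X B) \<in> T" using B by (auto simp: T_def)
    ultimately show "X \<in> \<Psi> ` T" by blast
  qed
  then have "card (Pow (ground M)) \<le> card (\<Psi> ` T)" using finT by (intro card_mono) auto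
  also have "\<dots> \<le> card T" by (rule card_image_le[OF finT])
  also have "\<dots> = card (\<Phi> ` T)" using card_image[OF inj] by simp
  finally have card: "card (Pow (ground M)) \<le> card (\<Phi> ` T)" .
  have "\<Phi> ` T \<subseteq> Pow (ground M)"
  proof
    fix X assume "X \<in> \<Phi> ` T"
    then obtain B S where "basis M B" "X = reoriented (procedure M B S)" by (auto simp: T_def \<Phi>_def)
    then show "X \<in> Pow (ground M)" using reoriented_set oriented_matroid_basis.reoriented_set_sub[OF loc] by simp
  qed
  then have "\<Phi> ` T = Pow (ground M)" using card finite_ground by (intro card_seteq) auto
  then have "A \<in> \<Phi> ` T" using A by blast
  then show ?thesis by (auto simp: T_def \<Phi>_def)
qed

theorem theorem6p9:
  fixes M :: "'a::linorder om" and B :: "'a set"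
  assumes "oriented_matroid M" and "basis M B"
  shows
    "(\<forall>S \<subseteq> Int_act M B \<union> Ext_act M B.
        let s = procedure M B S in
        dom (part s) = ground M \<and> dom (label s) = ground M \<and>
        ran (part s) \<subseteq> Int_act M B \<union> Ext_act M B \<and>
        (\<forall>e\<in>ground M.
           (\<exists>P\<in>active_partition M B. e \<in> P \<and> part s e = Some (Min P)) \<and>
           (label s e = Some Internal \<longleftrightarrow> the (part s e) \<in> Int_act M B) \<and>
           (label s e = Some External \<longleftrightarrow> the (part s e) \<in> Ext_act M B))) \<and>
     card (alpha_preimage M B) = 2 ^ (card (Int_act M B) + card (Ext_act M B)) \<and>
     alpha_preimage M B =
       {reoriented (procedure M B S) | S. S \<subseteq> Int_act M B \<union> Ext_act M B} \<and>
     (\<forall>S \<subseteq> Int_act M B \<union> Ext_act M B. \<forall>A \<in> alpha_preimage M B.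
        alpha_preimage M B =
          {sym_diff A {e \<in> ground M. the (part (procedure M B S) e) \<in> P \<union> Q} | P Q.
             P \<subseteq> Int_act M B \<and> Q \<subseteq> Ext_act M B})"
proof -
  interpret oriented_matroid_basis M B
    using assms by (simp add: oriented_matroid_basis_def oriented_matroid_basis_axioms_def)
  let ?act = "Int_act M B \<union> Ext_act M B"
  have reoriented_set: "reoriented (procedure M B S) = reoriented_set S" for S by (simp add: reoriented_set_def final_def)
  have h: "the (part (procedure M B S) e) = part_map S e" for S e by (simp add: part_map_def final_def)
  have sub: "Int_act M B \<subseteq> E" "Ext_act M B \<subseteq> E" and disj: "Int_act M B \<inter> Ext_act M B = {}"
    using BE by (auto simp: Int_act_eq Ext_act_eq)
  have fin: "finite (Int_act M B)" "finite (Ext_act M B)"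
    using sub finite_ground finite_subset by blast+
  have pre: "alpha_preimage M B = reoriented_set ` Pow ?act"
  proof
    show "reoriented_set ` Pow ?act \<subseteq> alpha_preimage M B"
      using reoriented_set_sub alpha_procedure by (auto simp: alpha_preimage_def)
    show "alpha_preimage M B \<subseteq> reoriented_set ` Pow ?act"
    proof
      fix A assume A: "A \<in> alpha_preimage M B"
      then have "A \<subseteq> E" by (simp add: alpha_preimage_def)
      then obtain B' S where B': "basis M B'" "S \<subseteq> Int_act M B' \<union> Ext_act M B'"
        "A = reoriented (procedure M B' S)"
        using procedure_surjective[OF assms(1)] by blast
      interpret B': oriented_matroid_basis M B' by unfold_locales (rule B'(1))
      have "A = B'.reoriented_set S" using B'(3) by (simp add: B'.reoriented_set_def B'.final_def)
      \<comment> \<open>\<open>A\<close> is an output for some basis, and \<open>alpha\<close>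
        identifies this basis.\<close>
      then have "B' = B" using B'.alpha_procedure A by (simp add: alpha_preimage_def)
      then show "A \<in> reoriented_set ` Pow ?act" using B' reoriented_set by auto
    qed
  qed
  have card: "card (alpha_preimage M B) = 2 ^ (card (Int_act M B) + card (Ext_act M B))"
    unfolding pre using reoriented_set_inj fin disj by (simp add: act_eq[symmetric] card_image card_Pow card_Un_disjoint)
  have outputs: "alpha_preimage M B = {reoriented (procedure M B S) | S. S \<subseteq> ?act}"
    unfolding pre reoriented_set by auto
  have flips: "alpha_preimage M B =
      {sym_diff A {e \<in> E. the (part (procedure M B S) e) \<in> P \<union> Q} | P Q.
        P \<subseteq> Int_act M B \<and> Q \<subseteq> Ext_act M B}"
    if A: "A \<in> alpha_preimage M B" for S A
  proof -
    obtain S0 where S0: "S0 \<subseteq> {x \<in> E. act x}" "A = reoriented_set S0" using A unfolding pre act_eq by blast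
    have diff: "sym_diff A {e \<in> E. part_map S e \<in> T} = reoriented_set (sym_diff S0 T)" if "T \<subseteq> {x \<in> E. act x}" for T
      using reoriented_set_sym_diff[OF S0(1) that] S0(2) by simp
    have "{sym_diff A {e \<in> E. part_map S e \<in> P \<union> Q} | P Q. P \<subseteq> Int_act M B \<and> Q \<subseteq> Ext_act M B} =
        reoriented_set ` Pow ?act"
    proof (intro set_eqI iffI)
      fix X assume "X \<in> {sym_diff A {e \<in> E. part_map S e \<in> P \<union> Q} | P Q.
        P \<subseteq> Int_act M B \<and> Q \<subseteq> Ext_act M B}"
      then obtain P Q where PQ: "P \<subseteq> Int_act M B" "Q \<subseteq> Ext_act M B"
        "X = sym_diff A {e \<in> E. part_map S e \<in> P \<union> Q}" by blast
      then have T: "P \<union> Q \<subseteq> {x \<in> E. act x}" unfolding act_eq[symmetric] by blast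
      then have "X = reoriented_set (sym_diff S0 (P \<union> Q))" using diff[OF T] PQ(3) by simp
      moreover have "sym_diff S0 (P \<union> Q) \<subseteq> ?act" using S0(1) T unfolding act_eq by blast
      ultimately show "X \<in> reoriented_set ` Pow ?act" by blast
    next
      fix X assume "X \<in> reoriented_set ` Pow ?act"
      then obtain S1 where S1: "S1 \<subseteq> {x \<in> E. act x}" "X = reoriented_set S1" unfolding act_eq by blast
      \<comment> \<open>Two outputs differ exactly on the parts of the active elements at which
        their choices differ.\<close>
      define T where "T = sym_diff S0 S1"
      have T: "T \<subseteq> {x \<in> E. act x}" using S0(1) S1(1) by (auto simp: T_def)
      have "sym_diff S0 T = S1" by (auto simp: T_def)
      then have "X = sym_diff A {e \<in> E. part_map S e \<in> T}" using diff[OF T] S1(2) by simp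
      moreover have "T = (T \<inter> Int_act M B) \<union> (T \<inter> Ext_act M B)"
        using T unfolding act_eq[symmetric] by blast
      ultimately show "X \<in> {sym_diff A {e \<in> E. part_map S e \<in> P \<union> Q} | P Q.
        P \<subseteq> Int_act M B \<and> Q \<subseteq> Ext_act M B}" by blast
    qed
    then show ?thesis unfolding pre h by simp
  qed
  show ?thesis
    by (intro conjI allI impI ballI procedure_output card outputs flips)
qed

end
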